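(* Let $T^*S^3=Q=\{z=(z_0,z_1,z_2,z_3)\in\mathbb{C}^4 : \sum_{i=0}^3 z_i^2=1\}$ be equipped with the Calabi-Yau structure $(\omega_{St},\Omega_{St})$. The special Lagrangian submanifolds in $Q$ which are invariant under the action of the maximal torus $T^2$ of $SO(4)$ are given by the equations $$u'(|z|^2)\,\operatorname{Im}(z_0\bar z_1)=c_1,\qquad u'(|z|^2)\,\operatorname{Im}(z_2\bar z_3)=c_2,\qquad \operatorname{Im}(z_0^2+z_1^2)=c_3,$$ where $c_1,c_2$ and $c_3$ are any real constants.
   Context: Let $|z|^2=\sum_{j}|z_j|^2$. Fix a constant $\kappa>0$ and let $u$ be the smooth function $$u(r^2)=\int_0^{\cosh^{-1}(r^2)}\left[\tfrac{3\kappa}{2}\left(\tfrac{\sinh(2\sigma)}{2}-\sigma\right)\right]^{1/3}d\sigma ;$$ $u'(|z|^2)$ denotes the derivative of $u$ with respect to its argument $r^2$, evaluated at $r^2=|z|^2$. The Stenzel (Candelas-de la Ossa) Ricci-flat Kähler form on $Q$ is the restriction of $\omega_{St}=i\partial\bar\partial\,u(|z|^2)$. The holomorphic volume form $\Omega_{St}$ on $Q$ is defined by $\frac12 d(z_0^2+z_1^2+z_2^2+z_3^2-1)\wedge\Omega_{St}=dz_0\wedge dz_1\wedge dz_2\wedge dz_3$, i.e. $\Omega_{St}(v_1,v_2,v_3)=(dz_0\wedge dz_1\wedge dz_2\wedge dz_3)(z,v_1,v_2,v_3)$ for $v_1,v_2,v_3\in T_zQ$. $Q$ is identified with $T^*S^3=\{(x,\xi)\in\mathbb{R}^4\times\mathbb{R}^4: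 |x|=1,\ x\cdot\xi=0\}$ by $(x,\xi)\mapsto z=x\cosh|\xi|+i\frac{\sinh|\xi|}{|\xi|}\xi$, which is $SO(4)$-equivariant for the actions $g(x,\xi)=(gx,g\xi)$ and $z\mapsto gz$. A real $3$-dimensional submanifold $L\subset Q$ is special Lagrangian if $\omega_{St}|_L\equiv0$ and $\operatorname{Im}\Omega_{St}|_L\equiv0$. The maximal torus $T^2\subset SO(4)$ consists of the block-diagonal matrices $\mathrm{diag}(R_{\theta_1},R_{\theta_2})$, $\theta_1,\theta_2\in[0,2\pi)$, where $R_\theta=\begin{pmatrix}\cos\theta&-\sin\theta\\ \sin\theta&\cos\theta\end{pmatrix}$.
   Formalization: The submanifolds are taken connected (else the constants may differ between components) and may be open pieces of the solution set; the solution sets are shown special Lagrangian away from points with z_0=z_1=0 or z_2=z_3=0, where they consist of crossing sheets and are not submanifolds. *)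

theory Defs
  imports "HOL-Analysis.Analysis"
begin

section \<open>Smooth maps and embedded submanifolds of Euclidean spaces\<close>

text \<open>Only meant for open \<open>S\<close>: in finite dimensions a map is \<open>C^(k+1)\<close> iff it is differentiable
  and all its directional derivatives are \<open>C^k\<close>.\<close>

primrec Ck_on :: "nat \<Rightarrow> 'a::euclidean_space set \<Rightarrow> ('a \<Rightarrow> 'b::euclidean_space) \<Rightarrow> bool" where
  "Ck_on 0 S f \<longleftrightarrow> continuous_on S f"
| "Ck_on (Suc k) S f \<longleftrightarrow>
     f differentiable_on S \<and> (\<forall>v. Ck_on k S (\<lambda>x. frechet_derivative f (at x) v))"

definition smooth_on :: "'a::euclidean_space set \<Rightarrow> ('a \<Rightarrow> 'b::euclidean_space) \<Rightarrow> bool" where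
  "smooth_on S f \<longleftrightarrow> (\<forall>k. Ck_on k S f)"

text \<open>Embedded submanifolds via slice charts: locally, a diffeomorphism of the ambient space
  carries \<open>M\<close> to a \<open>k\<close>-dimensional linear subspace.  No closedness is required.\<close>

definition smooth_submanifold :: "nat \<Rightarrow> 'a::euclidean_space set \<Rightarrow> bool" where
  "smooth_submanifold k M \<longleftrightarrow>
     (\<forall>p\<in>M. \<exists>(U::'a set) (W::'a set) \<Phi> \<Psi> (S::'a set).
        open U \<and> p \<in> U \<and> open W \<and> homeomorphism U W \<Phi> \<Psi> \<and>
        smooth_on U \<Phi> \<and> smooth_on W \<Psi> \<and>
        subspace S \<and> dim S = k \<and> \<Phi> ` (M \<inter> U) = W \<inter> S)"

definition tangent_space :: "'a::euclidean_space set \<Rightarrow> 'a \<Rightarrow> 'a set" where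
  "tangent_space M p =
     {v. \<exists>(\<epsilon>::real) \<gamma>. \<epsilon> > 0 \<and> smooth_on {-\<epsilon><..<\<epsilon>} \<gamma> \<and> \<gamma> ` {-\<epsilon><..<\<epsilon>} \<subseteq> M \<and>
           \<gamma> 0 = p \<and> (\<gamma> has_vector_derivative v) (at 0)}"

section \<open>The form \<open>i \<partial> \<partial>bar\<close>\<close>

text \<open>Wirtinger derivatives of a function with domain \<open>S\<close>.  The derivatives are taken within \<open>S\<close>,
  which only matters at boundary points of \<open>S\<close>.\<close>

definition wirt :: "(complex^'n) set \<Rightarrow> 'n::finite \<Rightarrow> (complex^'n \<Rightarrow> complex) \<Rightarrow> complex^'n \<Rightarrow> complex"
  where "wirt S j f z =
    (frechet_derivative f (at z within S) (axis j 1)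
       - \<i> * frechet_derivative f (at z within S) (axis j \<i>)) / 2"

definition wirt_bar :: "(complex^'n) set \<Rightarrow> 'n::finite \<Rightarrow> (complex^'n \<Rightarrow> complex) \<Rightarrow> complex^'n \<Rightarrow> complex"
  where "wirt_bar S j f z =
    (frechet_derivative f (at z within S) (axis j 1)
       + \<i> * frechet_derivative f (at z within S) (axis j \<i>)) / 2"

text \<open>The two-form \<open>i \<Sum>\<^sub>j\<^sub>k (\<partial>\<^sub>j \<partial>bar\<^sub>k f) dz\<^sub>j \<and> dzbar\<^sub>k\<close>; its values are real
  when \<open>f\<close> is real-valued.\<close>

definition i_del_delbar ::
    "(complex^'n) set \<Rightarrow> (complex^'n \<Rightarrow> complex) \<Rightarrow> complex^'n \<Rightarrow> complex^'n \<Rightarrow> complex^'n \<Rightarrow> complex"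
  where "i_del_delbar S f z v w =
    \<i> * (\<Sum>j\<in>UNIV. \<Sum>k\<in>UNIV. wirt S j (wirt_bar S k f) z
            * (v$j * cnj (w$k) - w$j * cnj (v$k)))"

section \<open>The Calabi-Yau structure on the quadric\<close>

text \<open>The index type \<open>4\<close> consists of \<open>0, 1, 2, 3\<close>, so coordinates are numbered from 0.\<close>

definition Q :: "(complex^4) set" where
  "Q = {z. (z$0)\<^sup>2 + (z$1)\<^sup>2 + (z$2)\<^sup>2 + (z$3)\<^sup>2 = 1}"

text \<open>As a function of \<open>t = r\<^sup>2\<close>, \<open>u\<close> is defined for \<open>t \<ge> 1\<close> only, hence its derivative is
  taken within \<open>{1..}\<close> (one-sided at \<open>t = 1\<close>, which is attained on the zero section).\<close>

definition stenzel_u :: "real \<Rightarrow> real \<Rightarrow> real" where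
  "stenzel_u \<kappa> t =
     integral {0..arcosh t} (\<lambda>\<sigma>. root 3 (3 * \<kappa> / 2 * (sinh (2 * \<sigma>) / 2 - \<sigma>)))"

definition stenzel_u' :: "real \<Rightarrow> real \<Rightarrow> real" where
  "stenzel_u' \<kappa> t = vector_derivative (stenzel_u \<kappa>) (at t within {1..})"

text \<open>The potential \<open>u(|z|\<^sup>2)\<close> lives on \<open>{z. |z|\<^sup>2 \<ge> 1}\<close>, which contains \<open>Q\<close> and is the closure of
  its interior: derivatives within it are unique and agree with those of any smooth extension.\<close>

definition stenzel_dom :: "(complex^4) set" where
  "stenzel_dom = {z. 1 \<le> (norm z)\<^sup>2}"

definition omega_St :: "real \<Rightarrow> complex^4 \<Rightarrow> complex^4 \<Rightarrow> complex^4 \<Rightarrow> complex" where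
  "omega_St \<kappa> = i_del_delbar stenzel_dom (\<lambda>z. of_real (stenzel_u \<kappa> ((norm z)\<^sup>2)))"

text \<open>\<open>(dz\<^sub>0 \<and> dz\<^sub>1 \<and> dz\<^sub>2 \<and> dz\<^sub>3)(z, v\<^sub>1, v\<^sub>2, v\<^sub>3)\<close> as the determinant with these rows.\<close>

definition Omega_St :: "complex^4 \<Rightarrow> complex^4 \<Rightarrow> complex^4 \<Rightarrow> complex^4 \<Rightarrow> complex" where
  "Omega_St z v1 v2 v3 =
     det (\<chi> i. if i = (0::4) then z else if i = 1 then v1 else if i = 2 then v2 else v3)"

definition special_lagrangian :: "real \<Rightarrow> (complex^4) set \<Rightarrow> bool" where
  "special_lagrangian \<kappa> L \<longleftrightarrow>
     L \<subseteq> Q \<and> smooth_submanifold 3 L \<and>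
     (\<forall>z\<in>L. \<forall>v\<in>tangent_space L z. \<forall>w\<in>tangent_space L z. omega_St \<kappa> z v w = 0) \<and>
     (\<forall>z\<in>L. \<forall>v1\<in>tangent_space L z. \<forall>v2\<in>tangent_space L z. \<forall>v3\<in>tangent_space L z.
        Im (Omega_St z v1 v2 v3) = 0)"

section \<open>The torus action\<close>

definition torus_mat :: "real \<Rightarrow> real \<Rightarrow> real^4^4" where
  "torus_mat a b = (\<chi> i j.
     if i = 0 then (if j = 0 then cos a else if j = 1 then - sin a else 0)
     else if i = 1 then (if j = 0 then sin a else if j = 1 then cos a else 0)
     else if i = 2 then (if j = 2 then cos b else if j = 3 then - sin b else 0)
     else (if j = 2 then sin b else if j = 3 then cos b else 0))"

definition maximal_torus :: "(real^4^4) set" where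
  "maximal_torus = {torus_mat a b | a b. a \<in> {0..<2*pi} \<and> b \<in> {0..<2*pi}}"

definition act :: "real^4^4 \<Rightarrow> complex^4 \<Rightarrow> complex^4" where
  "act g z = map_matrix complex_of_real g *v z"

definition torus_invariant :: "(complex^4) set \<Rightarrow> bool" where
  "torus_invariant L \<longleftrightarrow> (\<forall>g\<in>maximal_torus. act g ` L \<subseteq> L)"

text \<open>The points of \<open>Q\<close> with trivial stabilizer.  The complement in \<open>Q\<close> consists of the points with
  \<open>z\<^sub>0 = z\<^sub>1 = 0\<close> or \<open>z\<^sub>2 = z\<^sub>3 = 0\<close>; there the orbit is a circle and the defining equations
  below have linearly dependent differentials.\<close>

definition Q_free :: "(complex^4) set" where
  "Q_free = {z\<in>Q. \<forall>g\<in>maximal_torus. act g z = z \<longrightarrow> g = mat 1}"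

definition T2_locus :: "real \<Rightarrow> real \<Rightarrow> real \<Rightarrow> real \<Rightarrow> (complex^4) set" where
  "T2_locus \<kappa> c1 c2 c3 =
     {z\<in>Q. stenzel_u' \<kappa> ((norm z)\<^sup>2) * Im (z$0 * cnj (z$1)) = c1 \<and>
           stenzel_u' \<kappa> ((norm z)\<^sup>2) * Im (z$2 * cnj (z$3)) = c2 \<and>
           Im ((z$0)\<^sup>2 + (z$1)\<^sup>2) = c3}"

end

theory Submission
  imports Defs "HOL-Real_Asymp.Real_Asymp"
begin

text \<open>The torus is Hamiltonian: for its generators \<open>X1\<close>, \<open>X2\<close> the contractions of the Kaehler form
  are the differentials of \<open>u' Im (z\<^sub>0 cnj z\<^sub>1)\<close> and \<open>u' Im (z\<^sub>2 cnj z\<^sub>3)\<close> up to the factor \<open>-2\<close>, and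
  \<open>\<Omega>(X1, X2, w) = d(z\<^sub>0\<^sup>2 + z\<^sub>1\<^sup>2)(w) / 2\<close> on \<open>TQ\<close>.  The tangent spaces of an invariant special Lagrangian
  submanifold contain \<open>X1\<close> and \<open>X2\<close>, so the three functions are locally constant on it.  Conversely, where the
  orbit is a torus the common kernel of the three differentials is spanned by \<open>X1\<close>, \<open>X2\<close> and one
  further vector, and both forms vanish on it; independence of the differentials comes from
  \<open>t u'(t) + (t\<^sup>2 - 1) u''(t) = \<kappa> / u'(t)\<^sup>2 > 0\<close>.  Where the orbit is a circle the
  differentials degenerate and second-order information along curves takes their place.  If
  \<open>c1 = c2 = 0\<close> the factor \<open>u'\<close> can be dropped from the equations, and otherwise the locus avoids the zero
  section, so smoothness of \<open>u\<close> is only needed for \<open>t > 1\<close>.\<close>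

section \<open>Smooth maps and the inverse function theorem\<close>

text \<open>The obstacle is that the second derivative of u can be negative (it is at
  \<open>t = 1\<close>), so it is not evident that the values of the form on \<open>X1\<close>,
  \<open>X2\<close> against \<open>i X1\<close>, \<open>i X2\<close> make an invertible 2 x 2
  matrix. That matrix is needed twice: it makes the differentials independent, and it excludes the
  directions \<open>i X1\<close>, \<open>i X2\<close> from their common kernel. Its determinant is
  controlled by the quadric equation: Cauchy-Schwarz applied to (z0^2 + z1^2) + (z2^2 + z3^2) = 1
  bounds the moment maps sharply enough that positivity of the metric in the radial direction
  suffices. A second obstacle is the zero section, where \<open>arcosh\<close>, \<open>sqrt\<close>
  and the cube root in the formula for u' are all singular. There only the one-sided first
  derivatives of u and u' are computed, as limits. This is enough for \<open>omega_St\<close>, which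
  involves two derivatives of u, and for differentiating the moment maps once. That an invariant
  special Lagrangian fills an open part of the free locus is a matter of dimension and comes from
  invariance of domain.\<close>

lemma Ck_on_cong:
  assumes "open S" "\<And>x. x \<in> S \<Longrightarrow> f x = g x"
  shows "Ck_on k S f \<longleftrightarrow> Ck_on k S g"
  using assms(2)
proof (induction k arbitrary: f g)
  case 0
  then show ?case by (auto intro: continuous_on_cong[THEN iffD1])
next
  case (Suc k)
  have D: "(f has_derivative D) (at x) \<longleftrightarrow> (g has_derivative D) (at x)" if "x \<in> S" for x D
    using has_derivative_transform_within_open[OF _ \<open>open S\<close> that] Suc.prems by metis
  have F: "frechet_derivative f (at x) = frechet_derivative g (at x)" if "x \<in> S" for x
    unfolding frechet_derivative_def using D[OF that] by simp
  have "f differentiable_on S \<longleftrightarrow> g differentiable_on S"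
    using D unfolding differentiable_on_eq_differentiable_at[OF \<open>open S\<close>] differentiable_def by blast
  moreover have "Ck_on k S (\<lambda>x. frechet_derivative f (at x) v) \<longleftrightarrow> Ck_on k S (\<lambda>x. frechet_derivative g (at x) v)" for v
    by (rule Suc.IH) (simp add: F)
  ultimately show ?case by simp
qed

lemma Ck_on_SucI:
  assumes "open S" and der: "\<And>x. x \<in> S \<Longrightarrow> (f has_derivative D x) (at x)"
    and "\<And>v. Ck_on k S (\<lambda>x. D x v)"
  shows "Ck_on (Suc k) S f"
proof -
  have "f differentiable_on S"
    using der differentiable_on_eq_differentiable_at[OF \<open>open S\<close>] by (auto simp: differentiable_def)
  moreover have "Ck_on k S (\<lambda>x. frechet_derivative f (at x) v)" for v
    using assms(3)[of v] Ck_on_cong[OF \<open>open S\<close>, of "\<lambda>x. D x v" "\<lambda>x. frechet_derivative f (at x) v" k]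
      frechet_derivative_at[OF der] by simp
  ultimately show ?thesis by simp
qed

lemma Ck_on_Suc_has_derivative:
  assumes "Ck_on (Suc k) S f" "open S" "x \<in> S"
  shows "(f has_derivative frechet_derivative f (at x)) (at x)"
  using assms by (auto simp: differentiable_on_eq_differentiable_at frechet_derivative_works)

lemma Ck_on_SucD:
  assumes "Ck_on (Suc k) S f" "open S"
  shows "Ck_on k S f"
  using assms(1)
proof (induction k arbitrary: f)
  case 0
  then show ?case by (simp add: differentiable_imp_continuous_on)
next
  case (Suc k)
  then show ?case by simp
qed

lemma Ck_on_subset:
  assumes "Ck_on k S f" "T \<subseteq> S"
  shows "Ck_on k T f"
  using assms by (induction k arbitrary: f) (auto intro: continuous_on_subset differentiable_on_subset)

lemma Ck_on_const: "Ck_on k S (\<lambda>x. c)"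
proof (induction k arbitrary: c)
  case 0 then show ?case by simp
next
  case (Suc k)
  show ?case by (simp add: Suc)
qed

lemma Ck_on_add:
  assumes "open S" "Ck_on k S f" "Ck_on k S g"
  shows "Ck_on k S (\<lambda>x. f x + g x)"
  using assms(2,3)
proof (induction k arbitrary: f g)
  case 0 then show ?case by (simp add: continuous_on_add)
next
  case (Suc k)
  show ?case
  proof (rule Ck_on_SucI[OF \<open>open S\<close>])
    fix x assume "x \<in> S"
    with Suc.prems show "((\<lambda>x. f x + g x) has_derivative
      (\<lambda>v. frechet_derivative f (at x) v + frechet_derivative g (at x) v)) (at x)"
      by (intro has_derivative_add Ck_on_Suc_has_derivative[OF _ \<open>open S\<close>])
  next
    fix v
    show "Ck_on k S (\<lambda>x. frechet_derivative f (at x) v + frechet_derivative g (at x) v)"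
      using Suc by simp
  qed
qed

lemma Ck_on_sum:
  assumes "open S" "\<And>i. i \<in> I \<Longrightarrow> Ck_on k S (f i)"
  shows "Ck_on k S (\<lambda>x. \<Sum>i\<in>I. f i x)"
  using assms(2)
  by (induction I rule: infinite_finite_induct) (simp_all add: Ck_on_const Ck_on_add[OF \<open>open S\<close>])

lemma Ck_on_bounded_linear:
  assumes "open S" "bounded_linear h" "Ck_on k S f"
  shows "Ck_on k S (\<lambda>x. h (f x))"
  using assms(3)
proof (induction k arbitrary: f)
  case 0 then show ?case using bounded_linear.continuous_on[OF assms(2)] by simp
next
  case (Suc k)
  show ?case
  proof (rule Ck_on_SucI[OF \<open>open S\<close>])
    fix x assume "x \<in> S"
    with Suc.prems show "((\<lambda>x. h (f x)) has_derivative (\<lambda>v. h (frechet_derivative f (at x) v))) (at x)"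
      by (intro bounded_linear.has_derivative[OF assms(2)] Ck_on_Suc_has_derivative[OF _ \<open>open S\<close>])
  next
    fix v
    show "Ck_on k S (\<lambda>x. h (frechet_derivative f (at x) v))"
      using Suc by simp
  qed
qed

lemma Ck_on_bilinear:
  assumes "open S" "bounded_bilinear h" "Ck_on k S f" "Ck_on k S g"
  shows "Ck_on k S (\<lambda>x. h (f x) (g x))"
  using assms(3,4)
proof (induction k arbitrary: f g)
  case 0 then show ?case using bounded_bilinear.continuous_on[OF assms(2)] by simp
next
  case (Suc k)
  show ?case
  proof (rule Ck_on_SucI[OF \<open>open S\<close>])
    fix x assume "x \<in> S"
    with Suc.prems show "((\<lambda>x. h (f x) (g x)) has_derivative
      (\<lambda>v. h (f x) (frechet_derivative g (at x) v) + h (frechet_derivative f (at x) v) (g x))) (at x)"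
      by (intro bounded_bilinear.FDERIV[OF assms(2)] Ck_on_Suc_has_derivative[OF _ \<open>open S\<close>])
  next
    fix v
    note Suc.prems[THEN Ck_on_SucD, OF \<open>open S\<close>]
    with Suc show "Ck_on k S (\<lambda>x. h (f x) (frechet_derivative g (at x) v) + h (frechet_derivative f (at x) v) (g x))"
      by (intro Ck_on_add[OF \<open>open S\<close>] Suc.IH) simp_all
  qed
qed

text \<open>\<open>Ck_on\<close> speaks only of derivatives in a fixed direction, while the chain
  rule differentiates the outer map in a direction that moves with the point. Expanding that
  direction in \<open>Basis\<close> leaves products of fixed-direction terms.\<close>

lemma linear_basis_expansion:
  fixes h :: "'a::euclidean_space \<Rightarrow> 'b::real_vector"
  assumes "linear h"
  shows "h v = (\<Sum>b\<in>Basis. (v \<bullet> b) *\<^sub>R h b)"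
proof -
  have "h v = h (\<Sum>b\<in>Basis. (v \<bullet> b) *\<^sub>R b)" by (simp add: euclidean_representation)
  also have "\<dots> = (\<Sum>b\<in>Basis. (v \<bullet> b) *\<^sub>R h b)"
    by (simp only: linear_sum[OF assms] linear_scale[OF assms])
  finally show ?thesis .
qed

lemma Ck_on_inner_scaleR:
  assumes "open S" "Ck_on k S f" "Ck_on k S g"
  shows "Ck_on k S (\<lambda>x. (f x \<bullet> b) *\<^sub>R g x)"
  by (rule Ck_on_bilinear[OF \<open>open S\<close> bounded_bilinear_scaleR
        Ck_on_bounded_linear[OF \<open>open S\<close> bounded_linear_inner_left assms(2)] assms(3)])

lemma Ck_on_compose:
  fixes f :: "'a::euclidean_space \<Rightarrow> 'b::euclidean_space" and g :: "'b \<Rightarrow> 'c::euclidean_space"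
  assumes "open S" "open T" "f ` S \<subseteq> T" "Ck_on k S f" "Ck_on k T g"
  shows "Ck_on k S (\<lambda>x. g (f x))"
  using assms(4,5)
proof (induction k arbitrary: g)
  case 0
  then show ?case
    using continuous_on_compose2[of T g S f] assms(3) by simp
next
  case (Suc k)
  note f' = Ck_on_Suc_has_derivative[OF Suc.prems(1) \<open>open S\<close>]
  note g' = Ck_on_Suc_has_derivative[OF Suc.prems(2) \<open>open T\<close>]
  show ?case
  proof (rule Ck_on_SucI[OF \<open>open S\<close>])
    fix x assume x: "x \<in> S"
    then have fx: "f x \<in> T" using assms(3) by auto
    have e: "frechet_derivative g (at (f x)) (frechet_derivative f (at x) v) =
        (\<Sum>b\<in>Basis. (frechet_derivative f (at x) v \<bullet> b) *\<^sub>R frechet_derivative g (at (f x)) b)" for v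
      by (rule linear_basis_expansion[OF has_derivative_linear[OF g'[OF fx]]])
    show "((\<lambda>x. g (f x)) has_derivative (\<lambda>v. \<Sum>b\<in>Basis. (frechet_derivative f (at x) v \<bullet> b) *\<^sub>R
        frechet_derivative g (at (f x)) b)) (at x)"
      by (rule has_derivative_compose[OF f'[OF x] g'[OF fx], unfolded e])
  next
    fix v
    have "Ck_on k S (\<lambda>x. frechet_derivative f (at x) v)" using Suc.prems(1) by simp
    moreover have "Ck_on k S (\<lambda>x. frechet_derivative g (at (f x)) b)" for b
      by (rule Suc.IH[OF Ck_on_SucD[OF Suc.prems(1) \<open>open S\<close>]]) (use Suc.prems(2) in simp)
    ultimately show "Ck_on k S (\<lambda>x. \<Sum>b\<in>Basis. (frechet_derivative f (at x) v \<bullet> b) *\<^sub>R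
        frechet_derivative g (at (f x)) b)"
      by (intro Ck_on_sum[OF \<open>open S\<close>] Ck_on_inner_scaleR[OF \<open>open S\<close>])
  qed
qed

text \<open>Meant for functions that satisfy a differential equation, such as \<open>inverse\<close>
  and \<open>stenzel_p\<close>: the derivative is an expression in the function itself, so each
  order of smoothness yields the next.\<close>

lemma smooth_on_bootstrap:
  assumes "open S" and der: "\<And>x. x \<in> S \<Longrightarrow> (f has_derivative D x) (at x)"
    and "\<And>k v. Ck_on k S f \<Longrightarrow> Ck_on k S (\<lambda>x. D x v)"
  shows "smooth_on S f"
  unfolding smooth_on_def
proof
  fix k show "Ck_on k S f"
  proof (induction k)
    case 0
    show ?case using der by (auto simp: \<open>open S\<close> continuous_on_eq_continuous_at dest: has_derivative_continuous)
  next
    case (Suc k)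
    show ?case by (rule Ck_on_SucI[OF \<open>open S\<close> der assms(3)[OF Suc]])
  qed
qed

lemma smooth_on_subset: "smooth_on S f \<Longrightarrow> T \<subseteq> S \<Longrightarrow> smooth_on T f"
  by (auto simp: smooth_on_def intro: Ck_on_subset)

lemma smooth_on_compose:
  fixes f :: "'a::euclidean_space \<Rightarrow> 'b::euclidean_space" and g :: "'b \<Rightarrow> 'c::euclidean_space"
  assumes "open S" "open T" "f ` S \<subseteq> T" "smooth_on S f" "smooth_on T g"
  shows "smooth_on S (\<lambda>x. g (f x))"
  using Ck_on_compose[OF assms(1-3)] assms(4,5) unfolding smooth_on_def by blast

lemma smooth_on_const: "smooth_on S (\<lambda>x. c)"
  by (simp add: smooth_on_def Ck_on_const)

lemma smooth_on_add: "open S \<Longrightarrow> smooth_on S f \<Longrightarrow> smooth_on S g \<Longrightarrow> smooth_on S (\<lambda>x. f x + g x)"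
  by (simp add: smooth_on_def Ck_on_add)

lemma smooth_on_bounded_linear: "open S \<Longrightarrow> bounded_linear h \<Longrightarrow> smooth_on S f \<Longrightarrow> smooth_on S (\<lambda>x. h (f x))"
  by (simp add: smooth_on_def Ck_on_bounded_linear)

lemma smooth_on_bilinear:
  "open S \<Longrightarrow> bounded_bilinear h \<Longrightarrow> smooth_on S f \<Longrightarrow> smooth_on S g \<Longrightarrow> smooth_on S (\<lambda>x. h (f x) (g x))"
  by (simp add: smooth_on_def Ck_on_bilinear)

lemma smooth_on_ident: "open S \<Longrightarrow> smooth_on S (\<lambda>x. x)"
  by (rule smooth_on_bootstrap[where D = "\<lambda>x v. v"]) (auto intro: Ck_on_const has_derivative_ident)

lemma smooth_on_linear: "open S \<Longrightarrow> bounded_linear h \<Longrightarrow> smooth_on S h"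
  using smooth_on_bounded_linear[OF _ _ smooth_on_ident, of S h] by simp

lemma smooth_on_has_derivative:
  "smooth_on S f \<Longrightarrow> open S \<Longrightarrow> x \<in> S \<Longrightarrow> (f has_derivative frechet_derivative f (at x)) (at x)"
  using Ck_on_Suc_has_derivative[of 0 S f x] by (simp add: smooth_on_def del: Ck_on.simps)

lemma smooth_on_frechet_derivative:
  assumes "smooth_on S f"
  shows "smooth_on S (\<lambda>x. frechet_derivative f (at x) v)"
  unfolding smooth_on_def
proof
  fix k
  from assms have "Ck_on (Suc k) S f" unfolding smooth_on_def by blast
  then show "Ck_on k S (\<lambda>x. frechet_derivative f (at x) v)" by simp
qed

lemma smooth_on_continuous_on: "smooth_on S f \<Longrightarrow> continuous_on S f"
  unfolding smooth_on_def by (metis Ck_on.simps(1))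

lemma smooth_on_cong:
  assumes "open S" "\<And>x. x \<in> S \<Longrightarrow> f x = g x"
  shows "smooth_on S f \<longleftrightarrow> smooth_on S g"
  using Ck_on_cong[OF assms] by (simp add: smooth_on_def)

lemma Ck_on_inverse:
  fixes f :: "'a::euclidean_space \<Rightarrow> real"
  assumes "open S" "\<And>x. x \<in> S \<Longrightarrow> f x \<noteq> 0" "Ck_on k S f"
  shows "Ck_on k S (\<lambda>x. inverse (f x))"
proof -
  have o: "open (-{0::real})" by (simp add: open_Compl)
  have "smooth_on (-{0::real}) inverse"
  proof (rule smooth_on_bootstrap[OF o])
    fix x :: real assume "x \<in> -{0}"
    then show "(inverse has_derivative (\<lambda>v. (inverse x * inverse x) * (- v))) (at x)"
      by (auto intro!: derivative_eq_intros)
  next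
    fix k and v :: real assume "Ck_on k (-{0::real}) inverse"
    then show "Ck_on k (-{0::real}) (\<lambda>x. (inverse x * inverse x) * (- v))"
      by (intro Ck_on_bilinear[OF o bounded_bilinear_mult] Ck_on_const)
  qed
  then have "Ck_on k (-{0::real}) inverse" by (simp add: smooth_on_def)
  moreover have "f ` S \<subseteq> -{0}" by (rule image_subsetI) (simp add: assms(2))
  ultimately show ?thesis using Ck_on_compose[OF \<open>open S\<close> o _ assms(3)] by blast
qed

lemma smooth_on_inner_self: "open S \<Longrightarrow> smooth_on S (\<lambda>x. x \<bullet> x)"
  by (rule smooth_on_bilinear[OF _ bounded_bilinear_inner]) (auto intro: smooth_on_ident)

lemma smooth_on_Pair:
  fixes f :: "'a::euclidean_space \<Rightarrow> 'b::euclidean_space" and g :: "'a \<Rightarrow> 'c::euclidean_space"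
  assumes "open S" "smooth_on S f" "smooth_on S g"
  shows "smooth_on S (\<lambda>x. (f x, g x))"
proof -
  have "smooth_on S (\<lambda>x. (f x, 0) + (0, g x))"
    using assms by (intro smooth_on_add smooth_on_bounded_linear[where h = "\<lambda>x. (x, 0)"]
        smooth_on_bounded_linear[where h = "\<lambda>x. (0, x)"] bounded_linear_Pair bounded_linear_zero bounded_linear_ident)
  then show ?thesis by simp
qed

text \<open>From N y - N x = - N y (A y - A x) N x: as soon as norm (A y - A x) * norm (N x) is
  below 1/2, the norm of N y is at most twice that of N x, and the identity then bounds the
  difference.\<close>

lemma continuous_on_blinfun_inverse:
  fixes A N :: "'a::topological_space \<Rightarrow> 'b::real_normed_vector \<Rightarrow>\<^sub>L 'b"
  assumes cA: "continuous_on V A"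
    and NA: "\<And>y. y \<in> V \<Longrightarrow> N y o\<^sub>L A y = id_blinfun" and AN: "\<And>y. y \<in> V \<Longrightarrow> A y o\<^sub>L N y = id_blinfun"
  shows "continuous_on V N"
  unfolding continuous_on_def
proof
  fix x assume x: "x \<in> V"
  have tA: "(A \<longlongrightarrow> A x) (at x within V)" using cA x by (simp add: continuous_on_def)
  define K where "K = norm (N x)"
  have diff: "N y - N x = - (N y o\<^sub>L ((A y - A x) o\<^sub>L N x))" if "y \<in> V" for y
  proof (rule blinfun_eqI)
    fix v
    have "N y (A y (N x v)) = N x v" using NA[OF that] by (metis blinfun_apply_blinfun_compose blinfun_apply_id_blinfun)
    moreover have "A x (N x v) = v" using AN[OF x] by (metis blinfun_apply_blinfun_compose blinfun_apply_id_blinfun)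
    ultimately show "(N y - N x) v = (- (N y o\<^sub>L ((A y - A x) o\<^sub>L N x))) v"
      by (simp add: blinfun.bilinear_simps)
  qed
  have nd: "norm (N y - N x) \<le> norm (N y) * (norm (A y - A x) * K)" if "y \<in> V" for y
  proof -
    have "norm (N y - N x) \<le> norm (N y) * norm ((A y - A x) o\<^sub>L N x)"
      unfolding diff[OF that] norm_minus_cancel by (rule norm_blinfun_compose)
    also have "\<dots> \<le> norm (N y) * (norm (A y - A x) * K)"
      unfolding K_def by (intro mult_left_mono norm_blinfun_compose) simp
    finally show ?thesis .
  qed
  have t0: "((\<lambda>y. norm (A y - A x) * K) \<longlongrightarrow> 0) (at x within V)"
    using tendsto_mult_right[OF tendsto_norm[OF LIM_zero[OF tA]], of K] by simp
  then have "\<forall>\<^sub>F y in at x within V. norm (A y - A x) * K < 1/2"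
    by (rule order_tendstoD) simp
  moreover have "\<forall>\<^sub>F y in at x within V. y \<in> V" by (simp add: eventually_at_filter)
  ultimately have ev: "\<forall>\<^sub>F y in at x within V. norm (N y - N x) \<le> 2 * K * (norm (A y - A x) * K)"
  proof eventually_elim
    case (elim y)
    have "norm (N y) \<le> norm (N y - N x) + K"
      unfolding K_def using norm_triangle_ineq[of "N y - N x" "N x"] by simp
    also have "norm (N y - N x) \<le> norm (N y) * (1/2)"
      using nd[OF elim(2)] mult_left_mono[of "norm (A y - A x) * K" "1/2" "norm (N y)"] elim(1) by simp
    finally have "norm (N y) \<le> 2 * K" by simp
    then have "norm (N y) * (norm (A y - A x) * K) \<le> 2 * K * (norm (A y - A x) * K)"
      by (intro mult_right_mono) (auto simp: K_def)
    then show ?case using nd[OF elim(2)] by simp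
  qed
  have "((\<lambda>y. N y - N x) \<longlongrightarrow> 0) (at x within V)"
    by (rule Lim_null_comparison[OF ev]) (use tendsto_mult_left[OF t0, of "2*K"] in simp)
  then show "(N \<longlongrightarrow> N x) (at x within V)" by (rule LIM_zero_cancel)
qed

text \<open>The rule (A^-1)' = - A^-1 A' A^-1 evaluated at a vector. Only \<open>A\<close> applied
  to the fixed vector \<open>N x v\<close> is differentiated, which fits the fixed directions of
  \<open>Ck_on\<close>. The error splits into \<open>N y\<close> applied to the remainder of
  \<open>A\<close> and \<open>N y - N x\<close> applied to the linear part.\<close>

lemma has_derivative_blinfun_inverse_apply:
  fixes A N :: "'a::euclidean_space \<Rightarrow> 'b::real_normed_vector \<Rightarrow>\<^sub>L 'b"
  assumes "open V" "x \<in> V" "continuous_on V N"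
    and NA: "\<And>y. y \<in> V \<Longrightarrow> N y o\<^sub>L A y = id_blinfun" and AN: "\<And>y. y \<in> V \<Longrightarrow> A y o\<^sub>L N y = id_blinfun"
    and der: "((\<lambda>y. A y (N x v)) has_derivative B) (at x)"
  shows "((\<lambda>y. N y v) has_derivative (\<lambda>w. - N x (B w))) (at x)"
proof -
  define R where "R y = A y (N x v) - A x (N x v) - B (y - x)" for y
  have blB: "bounded_linear B" using der by (rule has_derivative_bounded_linear)
  obtain C where C: "\<And>w. norm (B w) \<le> norm w * C" using bounded_linear.bounded[OF blB] by blast
  have R: "((\<lambda>y. norm (R y) / norm (y - x)) \<longlongrightarrow> 0) (at x)"
    using der[unfolded has_derivative_iff_norm] by (simp add: R_def)
  have tN: "(N \<longlongrightarrow> N x) (at x)"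
    using assms(1-3) by (simp add: continuous_on_eq_continuous_at isCont_def)
  have eq: "N y v - N x v - - N x (B (y - x)) = - N y (R y) - (N y - N x) (B (y - x))" if "y \<in> V" for y
  proof -
    have "N y (A y (N x v)) = N x v" using NA[OF that] by (metis blinfun_apply_blinfun_compose blinfun_apply_id_blinfun)
    moreover have "A x (N x v) = v" using AN[OF \<open>x \<in> V\<close>] by (metis blinfun_apply_blinfun_compose blinfun_apply_id_blinfun)
    ultimately show ?thesis by (simp add: R_def blinfun.bilinear_simps)
  qed
  have "\<forall>\<^sub>F y in at x. y \<in> V" using assms(1,2) by (simp add: eventually_at_topological) blast
  then have ev: "\<forall>\<^sub>F y in at x. norm (norm (N y v - N x v - - N x (B (y - x))) / norm (y - x))
      \<le> norm (N y) * (norm (R y) / norm (y - x)) + norm (N y - N x) * C"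
    using eventually_neq_at_within[of x x UNIV]
  proof eventually_elim
    case (elim y)
    have "norm (N y v - N x v - - N x (B (y - x))) \<le> norm (N y) * norm (R y) + norm (N y - N x) * norm (B (y - x))"
      unfolding eq[OF elim(1)]
      using norm_triangle_ineq4[of "- N y (R y)" "(N y - N x) (B (y - x))"]
        norm_blinfun[of "N y" "R y"] norm_blinfun[of "N y - N x" "B (y - x)"] by simp
    also have "\<dots> \<le> norm (N y) * norm (R y) + norm (N y - N x) * (norm (y - x) * C)"
      by (intro add_left_mono mult_left_mono C) simp
    finally show ?case using elim(2) by (simp add: field_simps)
  qed
  have "((\<lambda>y. norm (N y) * (norm (R y) / norm (y - x)) + norm (N y - N x) * C) \<longlongrightarrow> norm (N x) * 0 + norm (N x - N x) * C) (at x)"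
    by (intro tendsto_intros tN R)
  then have "((\<lambda>y. norm (N y v - N x v - - N x (B (y - x))) / norm (y - x)) \<longlongrightarrow> 0) (at x)"
    using Lim_null_comparison[OF ev] by simp
  moreover have "bounded_linear (\<lambda>w. - N x (B w))"
    by (intro bounded_linear_minus bounded_linear_compose[OF blinfun.bounded_linear_right blB])
  ultimately show ?thesis by (simp add: has_derivative_iff_norm)
qed

text \<open>\<open>inverse_function_theorem\<close> supplies \<open>g\<close> and its derivative,
  the inverse \<open>N\<close> of the derivative of \<open>f\<close> along \<open>g\<close>.
  Smoothness is an induction on \<open>N\<close>: if \<open>N\<close> is C^k, then \<open>g\<close>
  is C^(k+1), and the derivative of \<open>N\<close>, an expression in \<open>N\<close> and the
  second derivative of \<open>f\<close> at \<open>g y\<close>, is again C^k.\<close>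

theorem smooth_inverse_function:
  fixes f :: "'a::euclidean_space \<Rightarrow> 'a"
  assumes "open U" "smooth_on U f" "x0 \<in> U" "bij (frechet_derivative f (at x0))"
  obtains U' V g where "open U'" "U' \<subseteq> U" "x0 \<in> U'" "open V" "homeomorphism U' V f g" "smooth_on V g"
proof -
  define Df where "Df x = frechet_derivative f (at x)" for x
  have derf: "(f has_derivative Df x) (at x)" if "x \<in> U" for x
    unfolding Df_def by (rule smooth_on_has_derivative[OF assms(2,1) that])
  define f' where "f' x = Blinfun (Df x)" for x
  have f': "blinfun_apply (f' x) = Df x" if "x \<in> U" for x
    unfolding f'_def by (rule bounded_linear_Blinfun_apply[OF has_derivative_bounded_linear[OF derf[OF that]]])
  have smD: "smooth_on U (\<lambda>x. Df x v)" for v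
    unfolding Df_def by (rule smooth_on_frechet_derivative[OF assms(2)])
  have contf: "continuous_on U f'"
  proof (rule continuous_on_blinfun_componentwise)
    fix i :: 'a
    show "continuous_on U (\<lambda>x. f' x i)"
      using smooth_on_continuous_on[OF smD[of i]] f' by (simp cong: continuous_on_cong)
  qed
  have blinv: "bounded_linear (inv (Df x))" if "x \<in> U" "bij (Df x)" for x
    by (rule linear_conv_bounded_linear[THEN iffD1, OF inj_linear_imp_inv_linear
          [OF has_derivative_linear[OF derf[OF that(1)]] bij_is_inj[OF that(2)]]])
  obtain U' V g g' where *: "open U'" "U' \<subseteq> U" "x0 \<in> U'" "open V" "f x0 \<in> V" "homeomorphism U' V f g"
    "\<And>y. y \<in> V \<Longrightarrow> (g has_derivative (g' y)) (at y)"
    "\<And>y. y \<in> V \<Longrightarrow> g' y = inv (blinfun_apply (f' (g y)))"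
    "\<And>y. y \<in> V \<Longrightarrow> bij (blinfun_apply (f' (g y)))"
  proof (rule inverse_function_theorem[OF \<open>open U\<close> _ contf \<open>x0 \<in> U\<close>])
    show "(f has_derivative blinfun_apply (f' x)) (at x)" if "x \<in> U" for x
      using derf[OF that] f'[OF that] by simp
    have b: "bij (Df x0)" using assms(4) by (simp add: Df_def)
    show "Blinfun (inv (Df x0)) o\<^sub>L f' x0 = id_blinfun"
      by (rule blinfun_eqI) (simp add: f'[OF \<open>x0 \<in> U\<close>] bounded_linear_Blinfun_apply[OF blinv[OF \<open>x0 \<in> U\<close> b]] inv_f_f[OF bij_is_inj[OF b]])
  qed blast
  have gU: "g y \<in> U" if "y \<in> V" for y using * that by (auto simp: homeomorphism_def)
  have bijD: "bij (Df (g y))" if "y \<in> V" for y using *(9)[OF that] f'[OF gU[OF that]] by simp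
  have g'D: "g' y = inv (Df (g y))" if "y \<in> V" for y using *(8)[OF that] f'[OF gU[OF that]] by simp
  define A where "A y = f' (g y)" for y
  define N where "N y = Blinfun (g' y)" for y
  have N: "blinfun_apply (N y) = g' y" if "y \<in> V" for y
    unfolding N_def by (rule bounded_linear_Blinfun_apply[OF has_derivative_bounded_linear[OF *(7)[OF that]]])
  have A: "blinfun_apply (A y) = Df (g y)" if "y \<in> V" for y
    unfolding A_def by (rule f'[OF gU[OF that]])
  have NA: "N y o\<^sub>L A y = id_blinfun" if "y \<in> V" for y
    by (rule blinfun_eqI) (simp add: N[OF that] A[OF that] g'D[OF that] inv_f_f[OF bij_is_inj[OF bijD[OF that]]])
  have AN: "A y o\<^sub>L N y = id_blinfun" if "y \<in> V" for y
    by (rule blinfun_eqI) (simp add: N[OF that] A[OF that] g'D[OF that] surj_f_inv_f[OF bij_is_surj[OF bijD[OF that]]])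
  have cg: "continuous_on V g" using *(6) by (simp add: homeomorphism_def)
  have "continuous_on V A"
    unfolding A_def using gU by (intro continuous_on_compose2[OF contf cg]) auto
  note cN = continuous_on_blinfun_inverse[OF this NA AN]
  define D2 where "D2 x u w = frechet_derivative (\<lambda>x. Df x u) (at x) w" for x u w
  have derD: "((\<lambda>x. Df x u) has_derivative D2 x u) (at x)" if "x \<in> U" for x u
    unfolding D2_def by (rule smooth_on_has_derivative[OF smD assms(1) that])
  \<comment> \<open>\<open>D2 x u\<close> is defined separately for each \<open>u\<close>, so only
    linearity in \<open>w\<close> is immediate; linearity in \<open>u\<close> follows from that of
    \<open>Df x\<close> by uniqueness of derivatives.\<close>
  have D2lin: "D2 x u w = (\<Sum>b\<in>Basis. (u \<bullet> b) *\<^sub>R D2 x b w)" if "x \<in> U" for x u w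
  proof -
    have "((\<lambda>x. \<Sum>b\<in>Basis. (u \<bullet> b) *\<^sub>R Df x b) has_derivative (\<lambda>w. \<Sum>b\<in>Basis. (u \<bullet> b) *\<^sub>R D2 x b w)) (at x)"
      by (intro has_derivative_sum has_derivative_scaleR_right derD that)
    then have "((\<lambda>x. Df x u) has_derivative (\<lambda>w. \<Sum>b\<in>Basis. (u \<bullet> b) *\<^sub>R D2 x b w)) (at x)"
      by (rule has_derivative_transform_within_open[OF _ \<open>open U\<close> that])
        (metis linear_basis_expansion has_derivative_linear derf)
    from has_derivative_unique[OF this derD[OF that]] show ?thesis by metis
  qed
  have smD2: "smooth_on U (\<lambda>x. D2 x u w)" for u w
    unfolding D2_def by (rule smooth_on_frechet_derivative[OF smD])
  define E where "E y v w = - N y (D2 (g y) (N y v) (N y w))" for y v w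
  have derN: "((\<lambda>y. N y v) has_derivative E y v) (at y)" if "y \<in> V" for y v
  proof -
    have "((\<lambda>y'. A y' (N y v)) has_derivative (\<lambda>w. D2 (g y) (N y v) (N y w))) (at y)"
    proof (rule has_derivative_transform_within_open[OF _ \<open>open V\<close> that])
      show "((\<lambda>y'. Df (g y') (N y v)) has_derivative (\<lambda>w. D2 (g y) (N y v) (N y w))) (at y)"
        using has_derivative_compose[OF *(7)[OF that] derD[OF gU[OF that]]] by (simp add: N[OF that])
    qed (simp add: A)
    from has_derivative_blinfun_inverse_apply[OF \<open>open V\<close> that cN NA AN this]
    show ?thesis by (simp add: E_def[abs_def])
  qed
  \<comment> \<open>All three moving arguments are expanded in \<open>Basis\<close>, so that only
    evaluations of \<open>N\<close> and \<open>D2\<close> at fixed vectors remain.\<close>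
  have E: "E y v w = (\<Sum>d\<in>Basis. \<Sum>b\<in>Basis. \<Sum>c\<in>Basis.
      (N y v \<bullet> b) *\<^sub>R ((N y w \<bullet> c) *\<^sub>R ((D2 (g y) b c \<bullet> d) *\<^sub>R (- N y d))))" if "y \<in> V" for y v w
  proof -
    have "D2 (g y) b (N y w) = (\<Sum>c\<in>Basis. (N y w \<bullet> c) *\<^sub>R D2 (g y) b c)" for b
      by (rule linear_basis_expansion[OF has_derivative_linear[OF derD[OF gU[OF that]]]])
    then have D2: "D2 (g y) (N y v) (N y w) \<bullet> d = (\<Sum>b\<in>Basis. \<Sum>c\<in>Basis.
        (N y v \<bullet> b) * ((N y w \<bullet> c) * (D2 (g y) b c \<bullet> d)))" for d
      unfolding D2lin[OF gU[OF that], of "N y v"]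
      by (simp add: inner_sum_left sum_distrib_left)
    have "N y u = (\<Sum>d\<in>Basis. (u \<bullet> d) *\<^sub>R N y d)" for u
      by (rule linear_basis_expansion) (simp add: blinfun.bounded_linear_right bounded_linear.linear)
    from this[of "D2 (g y) (N y v) (N y w)"]
    have "E y v w = - (\<Sum>d\<in>Basis. (D2 (g y) (N y v) (N y w) \<bullet> d) *\<^sub>R N y d)"
      unfolding E_def by (rule arg_cong)
    also have "\<dots> = (\<Sum>d\<in>Basis. (\<Sum>b\<in>Basis. \<Sum>c\<in>Basis.
        (N y v \<bullet> b) * ((N y w \<bullet> c) * (D2 (g y) b c \<bullet> d))) *\<^sub>R (- N y d))"
      by (simp only: D2 scaleR_minus_right sum_negf)
    finally show ?thesis by (simp only: scaleR_sum_left scaleR_scaleR)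
  qed
  have ckg': "Ck_on k V (\<lambda>y. g' y v)" if "Ck_on k V (\<lambda>y. N y v)" for k v
    using Ck_on_cong[OF \<open>open V\<close>, of "\<lambda>y. N y v" "\<lambda>y. g' y v" k] N that by simp
  have ckN: "\<forall>v. Ck_on k V (\<lambda>y. N y v)" for k
  proof (induction k)
    case 0
    show ?case by (simp add: blinfun.continuous_on[OF cN])
  next
    case (Suc k)
    have "Ck_on (Suc k) V g"
      by (rule Ck_on_SucI[OF \<open>open V\<close> *(7) ckg']) (use Suc in blast)+
    then have ckg: "Ck_on k V g" by (rule Ck_on_SucD[OF _ \<open>open V\<close>])
    have ckD2: "Ck_on k V (\<lambda>y. D2 (g y) b c)" for b c
    proof (rule Ck_on_compose[OF \<open>open V\<close> \<open>open U\<close> _ ckg])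
      show "g ` V \<subseteq> U" using gU by (rule image_subsetI)
      show "Ck_on k U (\<lambda>x. D2 x b c)" using smD2 unfolding smooth_on_def by blast
    qed
    show ?case
    proof
      fix v
      show "Ck_on (Suc k) V (\<lambda>y. N y v)"
      proof (rule Ck_on_SucI[OF \<open>open V\<close> derN])
        fix w
        have "Ck_on k V (\<lambda>y. \<Sum>d\<in>Basis. \<Sum>b\<in>Basis. \<Sum>c\<in>Basis.
      (N y v \<bullet> b) *\<^sub>R ((N y w \<bullet> c) *\<^sub>R ((D2 (g y) b c \<bullet> d) *\<^sub>R (- N y d))))"
          using Suc ckD2 by (intro Ck_on_sum[OF \<open>open V\<close>] Ck_on_inner_scaleR[OF \<open>open V\<close>]
              Ck_on_bounded_linear[OF \<open>open V\<close> bounded_linear_minus[OF bounded_linear_ident]]) auto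
        then show "Ck_on k V (\<lambda>y. E y v w)"
          by - (rule iffD2[OF Ck_on_cong[OF \<open>open V\<close>]], erule E, assumption)
      qed
    qed
  qed
  have "Ck_on (Suc k) V g" for k
    by (rule Ck_on_SucI[OF \<open>open V\<close> *(7) ckg']) (use ckN in blast)+
  then have "smooth_on V g" unfolding smooth_on_def using Ck_on_SucD[OF _ \<open>open V\<close>] by blast
  then show ?thesis using that * by blast
qed

section \<open>Submanifolds and their tangent spaces\<close>

text \<open>The space is the direct sum of the kernel and the range of the right inverse, by x = (x
  - R (D x)) + R (D x).\<close>

lemma dim_kernel_surj:
  fixes D :: "'a::euclidean_space \<Rightarrow> 'b::euclidean_space"
  assumes "linear D" "linear R" "\<And>y. D (R y) = y"
  shows "dim {x. D x = 0} + DIM('b) = DIM('a)"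
proof -
  let ?K = "{x. D x = 0}"
  have K: "subspace ?K" using linear_subspace_kernel[OF assms(1)] .
  have R: "subspace (range R)" by (rule linear_subspace_image[OF assms(2) subspace_UNIV])
  have "inj R" using assms(3) by (metis injI)
  then have dimR: "dim (range R) = DIM('b)" using dim_image_eq[OF assms(2), of UNIV] by simp
  have "x \<in> {x + y |x y. x \<in> ?K \<and> y \<in> range R}" for x
  proof -
    have "x - R (D x) \<in> ?K" by (simp add: linear_diff[OF assms(1)] assms(3))
    moreover have "x = (x - R (D x)) + R (D x)" by simp
    ultimately show ?thesis by blast
  qed
  then have sum: "{x + y |x y. x \<in> ?K \<and> y \<in> range R} = UNIV" by blast
  have int: "?K \<inter> range R = {0}"
    using assms(3) linear_0[OF assms(2)] linear_0[OF assms(1)] by (auto simp: image_iff)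
  show ?thesis using dim_sums_Int[OF K R] unfolding sum int dimR by simp
qed

text \<open>The chart at \<open>p\<close> is \<open>z \<mapsto> z + R (G z - c - DG\<^sub>p z)\<close> with \<open>R\<close> a right inverse of \<open>DG\<^sub>p\<close>: its
  derivative at \<open>p\<close> is the identity and \<open>DG\<^sub>p\<close> maps its value at \<open>z\<close> to \<open>G z - c\<close>.\<close>

theorem smooth_submanifold_level_set:
  fixes G :: "'a::euclidean_space \<Rightarrow> 'b::euclidean_space"
  assumes "open U" "smooth_on U G" "DIM('a) = k + DIM('b)"
    and surj: "\<And>p. p \<in> U \<Longrightarrow> G p = c \<Longrightarrow> surj (frechet_derivative G (at p))"
  shows "smooth_submanifold k {z \<in> U. G z = c}"
  unfolding smooth_submanifold_def
proof
  fix p assume "p \<in> {z \<in> U. G z = c}"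
  then have p: "p \<in> U" "G p = c" by auto
  define D where "D = frechet_derivative G (at p)"
  have der: "(G has_derivative D) (at p)" unfolding D_def by (rule smooth_on_has_derivative[OF assms(2,1) p(1)])
  have linD: "linear D" by (rule has_derivative_linear[OF der])
  obtain R where R: "linear R" "D \<circ> R = id"
    using linear_surjective_right_inverse[OF linD] surj[OF p] unfolding D_def by blast
  have DR: "D (R y) = y" for y using R(2) by (metis comp_apply id_apply)
  have blR: "bounded_linear R" and blD: "bounded_linear D"
    using R(1) linD linear_conv_bounded_linear by blast+
  define \<Phi> where "\<Phi> z = z + R (G z + (- c + - D z))" for z
  have sm: "smooth_on U \<Phi>"
    unfolding \<Phi>_def using \<open>open U\<close> assms(2)
    by (intro smooth_on_add smooth_on_ident smooth_on_bounded_linear[OF _ blR] smooth_on_const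
        smooth_on_bounded_linear[OF _ bounded_linear_minus[OF blD]])
  have "(\<Phi> has_derivative (\<lambda>v. v + R (D v + (0 + - D v)))) (at p)"
    unfolding \<Phi>_def
    by (intro has_derivative_add has_derivative_ident bounded_linear.has_derivative[OF blR] der
        has_derivative_const has_derivative_minus bounded_linear.has_derivative[OF blD])
  then have "frechet_derivative \<Phi> (at p) = (\<lambda>v. v)"
    by (simp add: frechet_derivative_at[symmetric] linear_0[OF R(1)])
  then have "bij (frechet_derivative \<Phi> (at p))" by (simp add: bij_id[unfolded id_def])
  from smooth_inverse_function[OF \<open>open U\<close> sm p(1) this]
  obtain U' V g where IF: "open U'" "U' \<subseteq> U" "p \<in> U'" "open V" "homeomorphism U' V \<Phi> g" "smooth_on V g" .
  have D\<Phi>: "D (\<Phi> z) = G z - c" for z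
    by (simp add: \<Phi>_def linear_add[OF linD] DR)
  have im: "\<Phi> ` ({z \<in> U. G z = c} \<inter> U') = V \<inter> {x. D x = 0}"
  proof (intro equalityI subsetI)
    fix y assume "y \<in> \<Phi> ` ({z \<in> U. G z = c} \<inter> U')"
    then show "y \<in> V \<inter> {x. D x = 0}" using IF(5) D\<Phi> by (auto simp: homeomorphism_def)
  next
    fix y assume y: "y \<in> V \<inter> {x. D x = 0}"
    then have "y \<in> \<Phi> ` U'" using IF(5) by (simp add: homeomorphism_def)
    then obtain z where "z \<in> U'" "y = \<Phi> z" by blast
    then show "y \<in> \<Phi> ` ({z \<in> U. G z = c} \<inter> U')" using y D\<Phi>[of z] IF(2) by auto
  qed
  have dim: "dim {x. D x = 0} = k" using dim_kernel_surj[OF linD R(1) DR] assms(3) by simp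
  have sub: "subspace {x. D x = 0}" by (rule linear_subspace_kernel[OF linD])
  show "\<exists>U' (W::'a set) \<Phi> \<Psi> S. open U' \<and> p \<in> U' \<and> open W \<and> homeomorphism U' W \<Phi> \<Psi> \<and>
      smooth_on U' \<Phi> \<and> smooth_on W \<Psi> \<and> subspace S \<and> dim S = k \<and> \<Phi> ` ({z \<in> U. G z = c} \<inter> U') = W \<inter> S"
    by (rule exI[of _ U'], rule exI[of _ V], rule exI[of _ \<Phi>], rule exI[of _ g], rule exI[of _ "{x. D x = 0}"])
      (intro conjI IF(1,3-6) smooth_on_subset[OF sm IF(2)] im dim sub)
qed

lemma smooth_submanifold_chartE:
  fixes M :: "'a::euclidean_space set"
  assumes "smooth_submanifold k M" "p \<in> M"
  obtains U \<Phi> \<Psi> S and W :: "'a set" where "open U" "p \<in> U" "open W" "homeomorphism U W \<Phi> \<Psi>"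
    "smooth_on U \<Phi>" "smooth_on W \<Psi>" "subspace S" "dim S = k" "\<Phi> ` (M \<inter> U) = W \<inter> S"
  using bspec[OF assms(1)[unfolded smooth_submanifold_def] assms(2)] by (elim exE conjE) (rule that, assumption+)

section \<open>Charts, and inclusions between submanifolds of equal dimension\<close>

lemma smooth_submanifold_Int_open:
  fixes M :: "'a::euclidean_space set"
  assumes "smooth_submanifold k M" "open O'"
  shows "smooth_submanifold k (M \<inter> O')"
  unfolding smooth_submanifold_def
proof
  fix p assume p: "p \<in> M \<inter> O'"
  obtain U \<Phi> \<Psi> S and W :: "'a set" where ch: "open U" "p \<in> U" "open W" "homeomorphism U W \<Phi> \<Psi>"
      "smooth_on U \<Phi>" "smooth_on W \<Psi>" "subspace S" "dim S = k" "\<Phi> ` (M \<inter> U) = W \<inter> S"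
    by (rule smooth_submanifold_chartE[OF assms(1) IntD1[OF p]])
  let ?W = "\<Phi> ` (U \<inter> O')"
  have "openin (top_of_set W) ?W"
    by (rule homeomorphism_imp_open_map[OF ch(4)]) (use ch(1) assms(2) in \<open>simp add: openin_open_Int\<close>)
  then have oW: "open ?W" using ch(3) openin_open_eq by blast
  have sub: "?W \<subseteq> W" using ch(4) by (auto simp: homeomorphism_def)
  have hom: "homeomorphism (U \<inter> O') ?W \<Phi> \<Psi>"
    by (rule homeomorphism_of_subsets[OF ch(4) _ sub]) auto
  have "inj_on \<Phi> U" using ch(4) by (metis homeomorphism_def inj_onI)
  then have "\<Phi> ` ((M \<inter> O') \<inter> (U \<inter> O')) = \<Phi> ` (M \<inter> U) \<inter> ?W"
    unfolding inj_on_def by blast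
  also have "\<dots> = ?W \<inter> S" using ch(9) sub by blast
  finally have im: "\<Phi> ` (M \<inter> O' \<inter> (U \<inter> O')) = ?W \<inter> S" .
  show "\<exists>U (W::'a set) \<Phi> \<Psi> S. open U \<and> p \<in> U \<and> open W \<and> homeomorphism U W \<Phi> \<Psi> \<and>
      smooth_on U \<Phi> \<and> smooth_on W \<Psi> \<and> subspace S \<and> dim S = k \<and> \<Phi> ` (M \<inter> O' \<inter> U) = W \<inter> S"
    by (rule exI[of _ "U \<inter> O'"], rule exI[of _ ?W], rule exI[of _ \<Phi>], rule exI[of _ \<Psi>], rule exI[of _ S])
      (use ch(2) p in \<open>auto intro!: oW hom open_Int ch(1) assms(2) smooth_on_subset[OF ch(5)]
        smooth_on_subset[OF ch(6) sub] ch(7,8) simp: im\<close>)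
qed

text \<open>An inverse chart of \<open>L\<close> followed by a chart of \<open>M\<close> is a
  continuous injection from an open part of \<open>S1\<close> into \<open>S\<close>. The two
  subspaces have the same dimension, so invariance of domain makes the image open in
  \<open>S\<close>.\<close>

lemma openin_smooth_submanifold:
  fixes M L :: "'a::euclidean_space set"
  assumes "smooth_submanifold k M" "smooth_submanifold k L" "L \<subseteq> M"
  shows "openin (top_of_set M) L"
proof (subst openin_subopen, intro ballI)
  fix p assume p: "p \<in> L"
  obtain U \<Phi> \<Psi> S and W :: "'a set" where ch: "open U" "p \<in> U" "open W" "homeomorphism U W \<Phi> \<Psi>"
      "smooth_on U \<Phi>" "smooth_on W \<Psi>" "subspace S" "dim S = k" "\<Phi> ` (M \<inter> U) = W \<inter> S"
    by (rule smooth_submanifold_chartE[OF assms(1) subsetD[OF assms(3) p]])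
  obtain U1 \<Phi>1 \<Psi>1 S1 and W1 :: "'a set" where ch1: "open U1" "p \<in> U1" "open W1" "homeomorphism U1 W1 \<Phi>1 \<Psi>1"
      "smooth_on U1 \<Phi>1" "smooth_on W1 \<Psi>1" "subspace S1" "dim S1 = k" "\<Phi>1 ` (L \<inter> U1) = W1 \<inter> S1"
    by (rule smooth_submanifold_chartE[OF assms(2) p])
  have h: "\<And>x. x \<in> U \<Longrightarrow> \<Psi> (\<Phi> x) = x" "\<And>x. x \<in> U1 \<Longrightarrow> \<Psi>1 (\<Phi>1 x) = x"
      "\<And>x. x \<in> W1 \<Longrightarrow> \<Phi>1 (\<Psi>1 x) = x" "continuous_on U \<Phi>" "continuous_on W1 \<Psi>1"
    using ch(4) ch1(4) by (auto simp: homeomorphism_def)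
  \<comment> \<open>The part of the slice of \<open>L\<close> that lands in the chart domain of
    \<open>M\<close>, where both charts can be composed.\<close>
  define D where "D = S1 \<inter> (W1 \<inter> \<Psi>1 -` U)"
  have "open (W1 \<inter> \<Psi>1 -` U)" by (rule continuous_open_preimage[OF h(5) ch1(3) ch(1)])
  then have oD: "openin (top_of_set S1) D" unfolding D_def by (rule openin_open_Int)
  have DL: "\<Psi>1 d \<in> L \<inter> U1 \<inter> U" if "d \<in> D" for d
  proof -
    from that have "d \<in> \<Phi>1 ` (L \<inter> U1)" using ch1(9) by (auto simp: D_def)
    then show ?thesis using that h(2) by (auto simp: D_def)
  qed
  have im: "\<Phi> (\<Psi>1 d) \<in> S" if "d \<in> D" for d
    using DL[OF that] assms(3) ch(9) by blast
  have "openin (top_of_set S) ((\<lambda>d. \<Phi> (\<Psi>1 d)) ` D)"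
  proof (rule invariance_of_domain_subspaces[OF oD ch1(7) ch(7)])
    show "dim S \<le> dim S1" using ch(8) ch1(8) by simp
    show "continuous_on D (\<lambda>d. \<Phi> (\<Psi>1 d))"
      by (rule continuous_on_compose2[OF h(4) continuous_on_subset[OF h(5)]]) (auto simp: D_def)
    show "(\<lambda>d. \<Phi> (\<Psi>1 d)) \<in> D \<rightarrow> S" using im by auto
    show "inj_on (\<lambda>d. \<Phi> (\<Psi>1 d)) D"
    proof (rule inj_onI)
      fix x y assume "x \<in> D" "y \<in> D" "\<Phi> (\<Psi>1 x) = \<Phi> (\<Psi>1 y)"
      then have "\<Psi>1 x = \<Psi>1 y" using DL h(1) by (metis IntD2)
      then show "x = y" using h(3) \<open>x \<in> D\<close> \<open>y \<in> D\<close> by (metis D_def IntE)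
    qed
  qed
  then obtain T where T: "open T" "(\<lambda>d. \<Phi> (\<Psi>1 d)) ` D = S \<inter> T" by (auto simp: openin_open)
  have oO: "open (U \<inter> \<Phi> -` T)" by (rule continuous_open_preimage[OF h(4) ch(1) T(1)])
  have "M \<inter> (U \<inter> \<Phi> -` T) \<subseteq> L"
  proof
    fix q assume q: "q \<in> M \<inter> (U \<inter> \<Phi> -` T)"
    then have "\<Phi> q \<in> S \<inter> T" using ch(9) by blast
    then obtain d where "d \<in> D" "\<Phi> q = \<Phi> (\<Psi>1 d)" unfolding T(2)[symmetric] by blast
    then have "q = \<Psi>1 d" using h(1) q DL by (metis IntD1 IntD2)
    then show "q \<in> L" using DL[OF \<open>d \<in> D\<close>] by simp
  qed
  moreover have "p \<in> \<Phi> -` T"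
  proof -
    have "\<Phi>1 p \<in> D" using p ch1(2,9) ch(2) h(2) by (auto simp: D_def)
    then have "\<Phi> (\<Psi>1 (\<Phi>1 p)) \<in> S \<inter> T" unfolding T(2)[symmetric] by blast
    then show ?thesis using h(2)[OF ch1(2)] by simp
  qed
  moreover have "openin (top_of_set M) (M \<inter> (U \<inter> \<Phi> -` T))" by (rule openin_open_Int[OF oO])
  ultimately show "\<exists>T. openin (top_of_set M) T \<and> p \<in> T \<and> T \<subseteq> L" using p ch(2) assms(3) by blast
qed

section \<open>Tangent vectors in charts, and functions with vanishing tangential derivative\<close>

lemma has_vector_derivative_quotient:
  fixes f :: "real \<Rightarrow> 'a::real_normed_vector"
  assumes "(f has_vector_derivative v) (at 0)"
  shows "((\<lambda>s. (f s - f 0) /\<^sub>R s) \<longlongrightarrow> v) (at 0)"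
proof -
  have "((\<lambda>h. norm (f (0 + h) - f 0 - h *\<^sub>R v) / norm h) \<longlongrightarrow> 0) (at 0)"
    using assms unfolding has_vector_derivative_def has_derivative_at by blast
  moreover have "\<forall>\<^sub>F h in at (0::real). norm (f (0 + h) - f 0 - h *\<^sub>R v) / norm h = norm ((f h - f 0) /\<^sub>R h - v)"
    using eventually_neq_at_within[of 0 0 UNIV]
  proof eventually_elim
    case (elim h)
    then have "(f h - f 0) /\<^sub>R h - v = (f (0 + h) - f 0 - h *\<^sub>R v) /\<^sub>R h"
      by (simp add: scaleR_diff_right)
    then show ?case by (simp add: divide_inverse_commute)
  qed
  ultimately have "((\<lambda>h. norm ((f h - f 0) /\<^sub>R h - v)) \<longlongrightarrow> 0) (at 0)"
    by (rule Lim_transform_eventually)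
  then show ?thesis by (rule LIM_zero_cancel[OF tendsto_norm_zero_cancel])
qed

lemma tangent_spaceE:
  assumes "v \<in> tangent_space M p"
  obtains \<epsilon> \<gamma> where "\<epsilon> > 0" "smooth_on {-\<epsilon><..<\<epsilon>} \<gamma>" "\<And>s. s \<in> {-\<epsilon><..<\<epsilon>} \<Longrightarrow> \<gamma> s \<in> M" "\<gamma> 0 = p"
    "(\<gamma> has_vector_derivative v) (at 0)"
  using assms unfolding tangent_space_def by blast

text \<open>The difference quotients of the curve seen in the chart lie in the subspace
  \<open>S\<close>, and \<open>S\<close> is closed.\<close>

lemma tangent_space_chart_dest:
  fixes \<Phi> :: "'a::euclidean_space \<Rightarrow> 'b::euclidean_space"
  assumes "v \<in> tangent_space M p" "open U" "p \<in> U" "(\<Phi> has_derivative D) (at p)"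
    "subspace S" "\<Phi> ` (M \<inter> U) \<subseteq> S"
  shows "D v \<in> S"
proof -
  obtain \<epsilon> \<gamma> where g: "\<epsilon> > 0" "smooth_on {-\<epsilon><..<\<epsilon>} \<gamma>" "\<And>s. s \<in> {-\<epsilon><..<\<epsilon>} \<Longrightarrow> \<gamma> s \<in> M" "\<gamma> 0 = p"
    "(\<gamma> has_vector_derivative v) (at 0)" using tangent_spaceE[OF assms(1)] by blast
  have "((\<lambda>s. \<Phi> (\<gamma> s)) has_vector_derivative D v) (at 0)"
    using has_derivative_compose[OF g(5)[unfolded has_vector_derivative_def], of \<Phi> D] assms(4) g(4)
      linear_scale[OF has_derivative_linear[OF assms(4)]] by (simp add: has_vector_derivative_def)
  note lim = has_vector_derivative_quotient[OF this]
  have "(\<gamma> \<longlongrightarrow> p) (at 0)"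
    using has_vector_derivative_continuous[OF g(5)] g(4) by (simp add: continuous_within)
  from topological_tendstoD[OF this assms(2,3)] have "\<forall>\<^sub>F s in at 0. \<gamma> s \<in> U" .
  moreover have "\<forall>\<^sub>F s in at 0. s \<in> {-\<epsilon><..<\<epsilon>}"
    using g(1) eventually_at_in_open'[of "{-\<epsilon><..<\<epsilon>}" 0] by simp
  ultimately have "\<forall>\<^sub>F s in at 0. (\<Phi> (\<gamma> s) - \<Phi> (\<gamma> 0)) /\<^sub>R s \<in> S"
  proof eventually_elim
    case (elim s)
    then have "\<Phi> (\<gamma> s) \<in> S" "\<Phi> (\<gamma> 0) \<in> S" using assms(3,6) g(1,3,4) g(3)[of 0] by auto
    then show ?case using assms(5) by (intro subspace_scale subspace_diff)
  qed
  then show ?thesis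
    by (rule Lim_in_closed_set[OF closed_subspace[OF assms(5)] _ _ lim]) simp
qed

text \<open>The required curve is the image of the straight segment through \<open>q\<close> in
  direction \<open>s\<close>, which stays in \<open>S\<close>.\<close>

lemma tangent_space_chart_intro:
  fixes \<Psi> :: "'b::euclidean_space \<Rightarrow> 'a::euclidean_space"
  assumes "open W" "smooth_on W \<Psi>" "q \<in> W" "q \<in> S" "s \<in> S" "subspace S" "\<Psi> ` (W \<inter> S) \<subseteq> M"
  shows "frechet_derivative \<Psi> (at q) s \<in> tangent_space M (\<Psi> q)"
proof -
  define c where "c x = q + x *\<^sub>R s" for x
  have "open (c -` W)" unfolding c_def using assms(1)
    by (intro open_vimage continuous_intros) 
  moreover have "0 \<in> c -` W" using assms(3) by (simp add: c_def)
  ultimately obtain \<epsilon> where e: "\<epsilon> > 0" "ball 0 \<epsilon> \<subseteq> c -` W" using open_contains_ball by blast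
  have b: "ball 0 \<epsilon> = {-\<epsilon><..<\<epsilon>}" by (auto simp: dist_real_def)
  have smc: "smooth_on {-\<epsilon><..<\<epsilon>} c"
    unfolding c_def by (intro smooth_on_add smooth_on_const smooth_on_linear bounded_linear_scaleR_left) auto
  have "smooth_on {-\<epsilon><..<\<epsilon>} (\<lambda>x. \<Psi> (c x))"
    using e(2) by (intro smooth_on_compose[OF _ assms(1) _ smc assms(2)]) (auto simp: b)
  moreover have "(\<lambda>x. \<Psi> (c x)) ` {-\<epsilon><..<\<epsilon>} \<subseteq> M"
  proof (rule image_subsetI)
    fix x assume "x \<in> {-\<epsilon><..<\<epsilon>}"
    then have "c x \<in> W" using e(2) b by blast
    moreover have "c x \<in> S" unfolding c_def using assms(4-6) by (intro subspace_add subspace_scale)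
    ultimately show "\<Psi> (c x) \<in> M" using assms(7) by blast
  qed
  moreover have "((\<lambda>x. \<Psi> (c x)) has_vector_derivative frechet_derivative \<Psi> (at q) s) (at 0)"
  proof -
    have dc: "(c has_derivative (\<lambda>h. h *\<^sub>R s)) (at 0)" unfolding c_def by (auto intro!: derivative_eq_intros)
    have d: "(\<Psi> has_derivative frechet_derivative \<Psi> (at q)) (at (c 0))"
      using smooth_on_has_derivative[OF assms(2,1,3)] by (simp add: c_def)
    from has_derivative_compose[OF dc d] show ?thesis
      using linear_scale[OF has_derivative_linear[OF d]] by (simp add: has_vector_derivative_def)
  qed
  moreover have "\<Psi> (c 0) = \<Psi> q" by (simp add: c_def)
  ultimately show ?thesis using e(1) unfolding tangent_space_def
    by - (rule CollectI, rule exI[of _ \<epsilon>], rule exI[of _ "\<lambda>x. \<Psi> (c x)"], blast)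
qed

lemma chart_inverse_image:
  assumes "homeomorphism U W \<Phi> \<Psi>" "\<Phi> ` (M \<inter> U) = W \<inter> S"
  shows "\<Psi> ` (W \<inter> S) \<subseteq> M"
proof (rule image_subsetI)
  fix y assume "y \<in> W \<inter> S"
  then obtain x where "x \<in> M" "x \<in> U" "y = \<Phi> x" unfolding assms(2)[symmetric] by blast
  then show "\<Psi> y \<in> M" using homeomorphism_apply1[OF assms(1)] by simp
qed

text \<open>The sum of two curves need not stay in \<open>M\<close>, so the vectors are added in the
  slice \<open>S\<close> of a chart; differentiating \<open>\<Psi> (\<Phi> x) = x\<close> brings the
  sum back.\<close>

lemma tangent_space_add:
  fixes M :: "'a::euclidean_space set"
  assumes "smooth_submanifold k M" "p \<in> M" "v \<in> tangent_space M p" "w \<in> tangent_space M p"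
  shows "v + w \<in> tangent_space M p"
proof -
  obtain U \<Phi> \<Psi> S and W :: "'a set" where ch: "open U" "p \<in> U" "open W" "homeomorphism U W \<Phi> \<Psi>"
      "smooth_on U \<Phi>" "smooth_on W \<Psi>" "subspace S" "dim S = k" "\<Phi> ` (M \<inter> U) = W \<inter> S"
    by (rule smooth_submanifold_chartE[OF assms(1,2)])
  note d = smooth_on_has_derivative[OF ch(5,1,2)]
  have sub: "\<Phi> ` (M \<inter> U) \<subseteq> S" using ch(9) by simp
  let ?D = "frechet_derivative \<Phi> (at p)"
  have "?D v \<in> S" "?D w \<in> S"
    using tangent_space_chart_dest[OF _ ch(1,2) d ch(7) sub] assms(3,4) by blast+
  then have S: "?D (v + w) \<in> S" using linear_add[OF has_derivative_linear[OF d]] subspace_add[OF ch(7)] by simp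
  have q: "\<Phi> p \<in> W" "\<Phi> p \<in> S" using ch(2,9) assms(2) by blast+
  have retr: "\<Psi> (\<Phi> x) = x" if "x \<in> U" for x using ch(4) that by (simp add: homeomorphism_def)
  note d2 = smooth_on_has_derivative[OF ch(6,3) q(1)]
  have "((\<lambda>x. \<Psi> (\<Phi> x)) has_derivative (\<lambda>v. frechet_derivative \<Psi> (at (\<Phi> p)) (?D v))) (at p)"
    by (rule has_derivative_compose[OF d d2])
  moreover have "((\<lambda>x. \<Psi> (\<Phi> x)) has_derivative (\<lambda>v. v)) (at p)"
    by (rule has_derivative_transform_within_open[OF has_derivative_ident ch(1,2)]) (simp add: retr)
  ultimately have "frechet_derivative \<Psi> (at (\<Phi> p)) (?D (v + w)) = v + w"
    using has_derivative_unique by metis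
  with tangent_space_chart_intro[OF ch(3,6) q S ch(7) chart_inverse_image[OF ch(4,9)]]
  show ?thesis by (simp add: retr[OF ch(2)])
qed

text \<open>\<open>F\<close> is differentiable only within \<open>Z\<close>, which need not be open.
  Pulling \<open>F\<close> back to a segment in a chart gives a path inside \<open>L\<close>, hence
  inside \<open>Z\<close>, along which the derivative vanishes; this yields local constancy.\<close>

lemma constant_on_connected_submanifold:
  fixes F :: "'a::euclidean_space \<Rightarrow> real"
  assumes "smooth_submanifold k L" "connected L" "L \<subseteq> Z"
    and der: "\<And>z. z \<in> L \<Longrightarrow> (F has_derivative F' z) (at z within Z)"
    and zero: "\<And>z v. z \<in> L \<Longrightarrow> v \<in> tangent_space L z \<Longrightarrow> F' z v = 0"
  shows "\<exists>c. \<forall>z\<in>L. F z = c"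
proof -
  have loc: "\<exists>T. openin (top_of_set L) T \<and> p \<in> T \<and> (\<forall>x\<in>T. F x = F p)" if p: "p \<in> L" for p
  proof -
    obtain U \<Phi> \<Psi> S and W :: "'a set" where ch: "open U" "p \<in> U" "open W" "homeomorphism U W \<Phi> \<Psi>"
      "smooth_on U \<Phi>" "smooth_on W \<Psi>" "subspace S" "dim S = k" "\<Phi> ` (L \<inter> U) = W \<inter> S"
      by (rule smooth_submanifold_chartE[OF assms(1) p])
    note WS = chart_inverse_image[OF ch(4,9)]
    have retr: "\<Psi> (\<Phi> x) = x" if "x \<in> U" for x using ch(4) that by (simp add: homeomorphism_def)
    have q: "\<Phi> p \<in> W" using ch(2,9) p by blast
    obtain e where e: "e > 0" "ball (\<Phi> p) e \<subseteq> W" using ch(3) q open_contains_ball by blast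
    let ?T = "L \<inter> (U \<inter> \<Phi> -` ball (\<Phi> p) e)"
    have "open (U \<inter> \<Phi> -` ball (\<Phi> p) e)"
      by (rule continuous_open_preimage[OF smooth_on_continuous_on[OF ch(5)] ch(1) open_ball])
    then have oT: "openin (top_of_set L) ?T" by (rule openin_open_Int)
    have pT: "p \<in> ?T" using p ch(2) e(1) by simp
    have "F x = F p" if x: "x \<in> ?T" for x
    proof -
      define c where "c s = \<Phi> p + s *\<^sub>R (\<Phi> x - \<Phi> p)" for s :: real
      have S: "\<Phi> p \<in> S" "\<Phi> x \<in> S" using x pT ch(9) by blast+
      have cB: "c s \<in> W \<inter> S" if s: "s \<in> {0..1}" for s
      proof -
        have "c s = (1 - s) *\<^sub>R \<Phi> p + s *\<^sub>R \<Phi> x" by (simp add: c_def algebra_simps)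
        then have "c s \<in> ball (\<Phi> p) e"
          using convexD[OF convex_ball, of "\<Phi> p" "\<Phi> p" e "\<Phi> x" "1-s" s] x e(1) s by simp
        moreover have "c s \<in> S" unfolding c_def by (intro subspace_add subspace_scale subspace_diff S ch(7))
        ultimately show ?thesis using e(2) by blast
      qed
      have "((\<lambda>s. F (\<Psi> (c s))) has_derivative (\<lambda>h. 0)) (at s within {0..1})" if s: "s \<in> {0..1}" for s
      proof -
        have cs: "c s \<in> W" "c s \<in> S" using cB[OF s] by auto
        have "(c has_derivative (\<lambda>h. h *\<^sub>R (\<Phi> x - \<Phi> p))) (at s within {0..1})"
          unfolding c_def by (auto intro!: derivative_eq_intros)
        from has_derivative_compose[OF this smooth_on_has_derivative[OF ch(6,3) cs(1)]]
        have d1: "((\<lambda>s. \<Psi> (c s)) has_derivative (\<lambda>h. frechet_derivative \<Psi> (at (c s)) (h *\<^sub>R (\<Phi> x - \<Phi> p)))) (at s within {0..1})" .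
        have im: "(\<lambda>s. \<Psi> (c s)) ` {0..1} \<subseteq> Z" using cB WS assms(3) by blast
        have L: "\<Psi> (c s) \<in> L" using cs WS by blast
        have tan: "frechet_derivative \<Psi> (at (c s)) (h *\<^sub>R (\<Phi> x - \<Phi> p)) \<in> tangent_space L (\<Psi> (c s))" for h
          by (rule tangent_space_chart_intro[OF ch(3,6) cs _ ch(7) WS])
            (intro subspace_scale subspace_diff S ch(7))
        have "((\<lambda>s. F (\<Psi> (c s))) has_derivative (\<lambda>h. F' (\<Psi> (c s)) (frechet_derivative \<Psi> (at (c s)) (h *\<^sub>R (\<Phi> x - \<Phi> p))))) (at s within {0..1})"
          by (rule has_derivative_in_compose[OF d1 has_derivative_subset[OF der[OF L] im]])
        then show ?thesis by (simp add: zero[OF L tan])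
      qed
      from has_derivative_zero_constant[OF convex_real_interval(5) this]
      have "F (\<Psi> (c 1)) = F (\<Psi> (c 0))" by fastforce
      then show "F x = F p" using retr x pT by (simp add: c_def)
    qed
    then show ?thesis using oT pT by blast
  qed
  show ?thesis
  proof (cases "L = {}")
    case False
    then obtain p where p: "p \<in> L" by blast
    \<comment> \<open>With \<open>P\<close> left general, one argument covers both halves of the
      separation: the points with the value \<open>F p\<close> and those with another value.\<close>
    have "openin (top_of_set L) {x \<in> L. P (F x)}" for P
    proof (subst openin_subopen, intro ballI)
      fix x assume x: "x \<in> {x \<in> L. P (F x)}"
      then obtain T where T: "openin (top_of_set L) T" "x \<in> T" "\<forall>y\<in>T. F y = F x" using loc[of x] by blast
      have "y \<in> {x \<in> L. P (F x)}" if "y \<in> T" for y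
        using T(3) that x openin_imp_subset[OF T(1)] by (simp add: subset_eq)
      then show "\<exists>T. openin (top_of_set L) T \<and> x \<in> T \<and> T \<subseteq> {x \<in> L. P (F x)}"
        using T by blast
    qed
    note o = this[of "\<lambda>y. y = F p"] this[of "\<lambda>y. y \<noteq> F p"]
    have "{x \<in> L. F x = F p} \<noteq> {}" using p by blast
    moreover have "{x \<in> L. F x = F p} \<inter> {x \<in> L. F x \<noteq> F p} = {}" by blast
    moreover have "L \<subseteq> {x \<in> L. F x = F p} \<union> {x \<in> L. F x \<noteq> F p}" by blast
    ultimately have "{x \<in> L. F x \<noteq> F p} = {}"
      using assms(2)[unfolded connected_openin] o by meson
    then show ?thesis by blast
  qed simp
qed

section \<open>The Stenzel potential\<close>

text \<open>With \<open>t = cosh \<sigma>\<close> this is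
  \<open>sinh (2 * \<sigma>) / 2 - \<sigma>\<close>, the expression under the cube root in the
  integrand of u.\<close>

definition stenzel_B :: "real \<Rightarrow> real" where
  "stenzel_B t = t * sqrt (t\<^sup>2 - 1) - arcosh t"

text \<open>The closed form of \<open>u'\<close>.  At \<open>t = 1\<close> the quotient would be \<open>0 / 0 = 0\<close>; \<open>root 3 \<kappa>\<close> is its limit.\<close>

definition stenzel_p :: "real \<Rightarrow> real \<Rightarrow> real" where
  "stenzel_p \<kappa> t = (if t = 1 then root 3 \<kappa> else root 3 (3 * \<kappa> / 2 * stenzel_B t) / sqrt (t\<^sup>2 - 1))"

lemma square_minus_one_pos: "t\<^sup>2 - 1 > 0" if "t > 1" for t :: real
  using one_less_power[OF that, of 2] by linarith

lemma filterlim_arcosh_at_right_1: "filterlim arcosh (at_right 0) (at_right (1::real))"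
  unfolding filterlim_at using tendsto_arcosh_at_left_1 by (simp add: eventually_at_filter)

lemma stenzel_B_deriv:
  assumes "t > 1"
  shows "(stenzel_B has_real_derivative 2 * sqrt (t\<^sup>2 - 1)) (at t)"
proof -
  have p: "t\<^sup>2 - 1 > 0" using square_minus_one_pos[OF assms] .
  have "(stenzel_B has_real_derivative (sqrt (t\<^sup>2 - 1) + t * (t / sqrt (t\<^sup>2 - 1)) - 1 / sqrt (t\<^sup>2 - 1))) (at t)"
  proof -
    have "\<not> t\<^sup>2 < 1" "t\<^sup>2 \<noteq> 1" using p by linarith+
    then show ?thesis
      unfolding stenzel_B_def using assms by (auto intro!: derivative_eq_intros simp: field_simps)
  qed
  also have "sqrt (t\<^sup>2 - 1) + t * (t / sqrt (t\<^sup>2 - 1)) - 1 / sqrt (t\<^sup>2 - 1) = sqrt (t\<^sup>2 - 1) + (t\<^sup>2 - 1) / sqrt (t\<^sup>2 - 1)"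
    by (simp add: power2_eq_square diff_divide_distrib)
  also have "\<dots> = 2 * sqrt (t\<^sup>2 - 1)" using p by (simp add: real_div_sqrt)
  finally show ?thesis .
qed

lemma stenzel_B_pos:
  assumes "t > 1"
  shows "stenzel_B t > 0"
proof -
  have "stenzel_B 1 < stenzel_B t"
  proof (rule DERIV_pos_imp_increasing_open[OF assms])
    fix x :: real assume "1 < x" "x < t"
    then show "\<exists>y. (stenzel_B has_real_derivative y) (at x) \<and> 0 < y"
      using stenzel_B_deriv[of x] by (intro exI[of _ "2 * sqrt (x\<^sup>2 - 1)"]) simp
  next
    show "continuous_on {1..t} stenzel_B"
      unfolding stenzel_B_def by (intro continuous_intros continuous_on_arcosh) auto
  qed
  then show ?thesis by (simp add: stenzel_B_def)
qed

lemma stenzel_p_pos: "\<kappa> > 0 \<Longrightarrow> t \<ge> 1 \<Longrightarrow> stenzel_p \<kappa> t > 0"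
  using stenzel_B_pos[of t] by (auto simp: stenzel_p_def)

text \<open>With s = sqrt (t^2 - 1) and R = s p, differentiating R^3 = (3 \<kappa> / 2) B with B' =
  2 s gives R' = \<kappa> s / R^2. The result is written in terms of \<open>stenzel_p\<close>
  itself: in this form it is the differential equation that gives both smoothness and radial
  positivity.\<close>

lemma stenzel_p_deriv:
  assumes "\<kappa> > 0" "t > 1"
  shows "(stenzel_p \<kappa> has_real_derivative (\<kappa> / (stenzel_p \<kappa> t)\<^sup>2 - t * stenzel_p \<kappa> t) / (t\<^sup>2 - 1)) (at t)"
proof -
  define s where "s = sqrt (t\<^sup>2 - 1)"
  define R where "R = root 3 (3 * \<kappa> / 2 * stenzel_B t)"
  have s: "s > 0" "s\<^sup>2 = t\<^sup>2 - 1" using square_minus_one_pos[OF assms(2)] by (auto simp: s_def)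
  have R: "R > 0" using stenzel_B_pos[OF assms(2)] assms(1) by (simp add: R_def)
  have pR: "stenzel_p \<kappa> t = R / s" using assms(2) by (simp add: stenzel_p_def R_def s_def)
  have dR: "((\<lambda>t. root 3 (3 * \<kappa> / 2 * stenzel_B t)) has_real_derivative \<kappa> * s / R\<^sup>2) (at t)"
  proof -
    have "(root 3 has_real_derivative inverse (real 3 * R ^ (3 - Suc 0))) (at (3 * \<kappa> / 2 * stenzel_B t))"
      unfolding R_def using stenzel_B_pos[OF assms(2)] assms(1) by (intro DERIV_real_root) auto
    moreover have "((\<lambda>t. 3 * \<kappa> / 2 * stenzel_B t) has_real_derivative 3 * \<kappa> / 2 * (2 * s)) (at t)"
      unfolding s_def by (rule DERIV_cmult[OF stenzel_B_deriv[OF assms(2)]])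
    ultimately have "((\<lambda>t. root 3 (3 * \<kappa> / 2 * stenzel_B t)) has_real_derivative
        inverse (real 3 * R ^ (3 - Suc 0)) * (3 * \<kappa> / 2 * (2 * s))) (at t)"
      by (rule DERIV_chain2)
    then show ?thesis using R by (simp add: field_simps)
  qed
  have ds: "((\<lambda>t. sqrt (t\<^sup>2 - 1)) has_real_derivative t / s) (at t)"
    using square_minus_one_pos[OF assms(2)] s(1) unfolding s_def by (auto intro!: derivative_eq_intros simp: field_simps)
  have "((\<lambda>t. root 3 (3 * \<kappa> / 2 * stenzel_B t) / sqrt (t\<^sup>2 - 1)) has_real_derivative
      ((\<kappa> * s / R\<^sup>2) * s - R * (t / s)) / (s * s)) (at t)"
    using DERIV_divide[OF dR ds] s(1) by (simp add: R_def s_def)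
  also have "((\<kappa> * s / R\<^sup>2) * s - R * (t / s)) / (s * s) = (\<kappa> / (stenzel_p \<kappa> t)\<^sup>2 - t * stenzel_p \<kappa> t) / (t\<^sup>2 - 1)"
    unfolding pR s(2)[symmetric] using s(1) R by (simp add: field_simps power2_eq_square)
  finally have d: "((\<lambda>t. root 3 (3 * \<kappa> / 2 * stenzel_B t) / sqrt (t\<^sup>2 - 1)) has_real_derivative
      (\<kappa> / (stenzel_p \<kappa> t)\<^sup>2 - t * stenzel_p \<kappa> t) / (t\<^sup>2 - 1)) (at t)" .
  show ?thesis
    by (rule has_field_derivative_transform_within_open[OF d open_greaterThan[of 1]])
      (use assms(2) in \<open>auto simp: stenzel_p_def\<close>)
qed

text \<open>Neither the cube root at 0 nor the square root at 0 is differentiable, so the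
  denominator is moved under the cube root as its third power. The quotient \<open>A\<close> there
  has the nonzero limit 2/3. In x = \<open>arcosh t\<close> it expands as 2/3 - x^2/5 + ..., while t
  - 1 = x^2/2 + ..., which is the origin of -2/5.\<close>

lemma stenzel_p_deriv_1:
  assumes "\<kappa> > 0"
  shows "\<exists>p'. (stenzel_p \<kappa> has_real_derivative p') (at 1 within {1..})"
proof -
  define A where "A t = (if t = 1 then 2 / 3 else stenzel_B t / sqrt (t\<^sup>2 - 1) ^ 3)" for t
  have lim: "((\<lambda>x::real. ((cosh x * sinh x - x) / sinh x ^ 3 - 2 / 3) / (cosh x - 1)) \<longlongrightarrow> - 2 / 5) (at_right 0)"
    by real_asymp
  have "((\<lambda>t. (A t - A 1) / (t - 1)) \<longlongrightarrow> - 2 / 5) (at_right 1)"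
  proof (rule Lim_transform_eventually[OF filterlim_compose[OF lim filterlim_arcosh_at_right_1]])
    show "\<forall>\<^sub>F x in at_right 1. ((cosh (arcosh x) * sinh (arcosh x) - arcosh x) / sinh (arcosh x) ^ 3 - 2 / 3) / (cosh (arcosh x) - 1) =
         (A x - A 1) / (x - 1)"
      unfolding eventually_at_filter by (simp add: A_def stenzel_B_def sinh_arcosh_real)
  qed
  then have "(A has_real_derivative (- 2 / 5)) (at 1 within {1..})"
    by (simp add: has_field_derivative_iff at_within_Ici_at_right)
  from DERIV_cmult[OF this, of "3 * \<kappa> / 2"]
  have dA: "((\<lambda>t. 3 * \<kappa> / 2 * A t) has_real_derivative (3 * \<kappa> / 2 * (- 2 / 5))) (at 1 within {1..})" .
  have "(root 3 has_real_derivative inverse (real 3 * root 3 (3 * \<kappa> / 2 * A 1) ^ (3 - Suc 0))) (at (3 * \<kappa> / 2 * A 1))"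
    using assms by (intro DERIV_real_root) (auto simp: A_def)
  from DERIV_chain2[OF this dA]
  have d: "((\<lambda>t. root 3 (3 * \<kappa> / 2 * A t)) has_real_derivative
      inverse (real 3 * root 3 (3 * \<kappa> / 2 * A 1) ^ (3 - Suc 0)) * (3 * \<kappa> / 2 * (- 2 / 5))) (at 1 within {1..})" .
  have "root 3 (3 * \<kappa> / 2 * A t) = stenzel_p \<kappa> t" if "t \<in> {1..}" for t
  proof (cases "t = 1")
    case False
    then have "sqrt (t\<^sup>2 - 1) > 0" using that square_minus_one_pos[of t] by simp
    then show ?thesis
      using False by (simp add: A_def stenzel_p_def real_root_mult real_root_divide real_root_power[symmetric] real_root_power_cancel)
  qed (simp add: A_def stenzel_p_def)
  with has_field_derivative_transform_within[OF d zero_less_one, of "stenzel_p \<kappa>"] show ?thesis by auto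
qed

text \<open>For \<open>t > 1\<close> this is the chain rule. At 1 the derivative of
  \<open>arcosh\<close> is infinite and the integrand vanishes, so l'Hopital is applied, using
  continuity of \<open>stenzel_p\<close> at 1.\<close>

lemma stenzel_u_deriv:
  assumes "\<kappa> > 0" "t \<ge> 1"
  shows "(stenzel_u \<kappa> has_real_derivative stenzel_p \<kappa> t) (at t within {1..})"
proof -
  define f where "f \<sigma> = root 3 (3 * \<kappa> / 2 * (sinh (2 * \<sigma>) / 2 - \<sigma>))" for \<sigma> :: real
  define F where "F x = integral {0..x} f" for x
  have cf: "continuous_on S f" for S
    unfolding f_def sinh_def by (intro continuous_intros) auto
  have uF: "stenzel_u \<kappa> = (\<lambda>t. F (arcosh t))"
    by (rule ext) (simp only: stenzel_u_def F_def f_def[abs_def])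
  have d: "(stenzel_u \<kappa> has_real_derivative stenzel_p \<kappa> t) (at t)" if t: "t > 1" for t
  proof -
    define \<tau> where "\<tau> = arcosh t"
    have \<tau>: "\<tau> > 0" using t by (simp add: \<tau>_def arcosh_real_gt_1_iff)
    have "(F has_real_derivative f \<tau>) (at \<tau> within {0..\<tau>+1})"
      unfolding F_def using \<tau> by (intro integral_has_real_derivative cf) auto
    then have "(F has_real_derivative f \<tau>) (at \<tau>)" using \<tau> by (simp add: at_within_Icc_at)
    moreover have "((arcosh :: real \<Rightarrow> real) has_real_derivative 1 / sqrt (t\<^sup>2 - 1)) (at t)"
      using t by (auto intro!: derivative_eq_intros)
    ultimately have "(stenzel_u \<kappa> has_real_derivative f \<tau> * (1 / sqrt (t\<^sup>2 - 1))) (at t)"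
      unfolding uF \<tau>_def by (rule DERIV_chain2)
    moreover have "f \<tau> = root 3 (3 * \<kappa> / 2 * stenzel_B t)"
    proof -
      have "sinh (2 * \<tau>) / 2 = t * sqrt (t\<^sup>2 - 1)"
        using t unfolding sinh_double by (simp add: \<tau>_def sinh_arcosh_real)
      then show ?thesis by (simp add: f_def stenzel_B_def \<tau>_def)
    qed
    ultimately show ?thesis using t by (simp add: stenzel_p_def)
  qed
  show ?thesis
  proof (cases "t = 1")
    case False
    then show ?thesis using d[of t] assms(2) by (simp add: has_field_derivative_at_within)
  next
    case True
    obtain p' where "(stenzel_p \<kappa> has_real_derivative p') (at 1 within {1..})"
      using stenzel_p_deriv_1[OF assms(1)] by blast
    then have "continuous (at 1 within {1..}) (stenzel_p \<kappa>)" by (rule DERIV_continuous)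
    then have pc: "(stenzel_p \<kappa> \<longlongrightarrow> stenzel_p \<kappa> 1) (at_right 1)"
      by (simp add: continuous_within at_within_Ici_at_right)
    have u1: "stenzel_u \<kappa> 1 = 0" by (simp add: stenzel_u_def)
    have "(F has_real_derivative f 0) (at 0 within {0..1})"
      unfolding F_def by (intro integral_has_real_derivative cf) auto
    then have "continuous (at 0 within {0..1}) F" by (rule DERIV_continuous)
    then have "(F \<longlongrightarrow> F 0) (at_right 0)" by (simp add: continuous_within at_within_Icc_at_right)
    from filterlim_compose[OF this filterlim_arcosh_at_right_1]
    have uc: "(stenzel_u \<kappa> \<longlongrightarrow> 0) (at_right 1)" unfolding uF by (simp add: F_def)
    have "((\<lambda>t. stenzel_u \<kappa> t / (t - 1)) \<longlongrightarrow> stenzel_p \<kappa> 1) (at_right 1)"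
    proof (rule lhopital_right[OF uc])
      show "((\<lambda>t. t - 1) \<longlongrightarrow> 0) (at_right (1::real))" by (auto intro!: tendsto_eq_intros)
      show "\<forall>\<^sub>F t in at_right (1::real). t - 1 \<noteq> 0" by (simp add: eventually_at_filter)
      show "\<forall>\<^sub>F t in at_right (1::real). (1::real) \<noteq> 0" by simp
      show "\<forall>\<^sub>F t in at_right 1. (stenzel_u \<kappa> has_real_derivative stenzel_p \<kappa> t) (at t)"
        using d by (simp add: eventually_at_filter)
      show "\<forall>\<^sub>F t in at_right (1::real). ((\<lambda>t. t - 1) has_real_derivative 1) (at t)"
        by (auto intro!: always_eventually derivative_eq_intros)
      show "((\<lambda>t. stenzel_p \<kappa> t / 1) \<longlongrightarrow> stenzel_p \<kappa> 1) (at_right 1)" using pc by simp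
    qed
    then show ?thesis
      by (simp add: True has_field_derivative_iff at_within_Ici_at_right u1)
  qed
qed

lemma stenzel_u'_eq:
  assumes "\<kappa> > 0" "t \<ge> 1"
  shows "stenzel_u' \<kappa> t = stenzel_p \<kappa> t"
proof -
  have "at_right t \<le> at t within {1..}" using assms(2) by (intro at_le) auto
  then have "at t within {1..} \<noteq> bot" using trivial_limit_at_right_real[of t] by (metis bot.extremum_uniqueI)
  then show ?thesis
    unfolding stenzel_u'_def
    by (rule vector_derivative_within) (use stenzel_u_deriv[OF assms] in \<open>simp add: has_real_derivative_iff_has_vector_derivative\<close>)
qed

text \<open>Bootstrapping on the differential equation, which is rational in \<open>t\<close> and
  \<open>stenzel_p\<close> with denominators that do not vanish for \<open>t > 1\<close>. It is
  spelled with products, sums and \<open>inverse\<close> to match the closure rules.\<close>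

lemma smooth_on_stenzel_p:
  assumes "\<kappa> > 0"
  shows "smooth_on {1<..} (stenzel_p \<kappa>)"
proof (rule smooth_on_bootstrap)
  show o: "open {1::real<..}" by simp
  fix t :: real assume "t \<in> {1<..}"
  then show "(stenzel_p \<kappa> has_derivative (\<lambda>v. ((\<kappa> * (inverse (stenzel_p \<kappa> t) * inverse (stenzel_p \<kappa> t)) +
      - (t * stenzel_p \<kappa> t)) * inverse (t * t + - 1)) * v)) (at t)"
    using stenzel_p_deriv[OF assms, of t]
    by (simp add: has_field_derivative_def divide_inverse power2_eq_square)
next
  fix k and v :: real assume C: "Ck_on k {1<..} (stenzel_p \<kappa>)"
  have o: "open {1::real<..}" by simp
  have id: "Ck_on k {1<..} (\<lambda>t::real. t)" using smooth_on_ident[OF o] by (simp add: smooth_on_def)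
  have "Ck_on k {1<..} (\<lambda>t. inverse (stenzel_p \<kappa> t))"
    by (rule Ck_on_inverse[OF o _ C]) (metis stenzel_p_pos[OF assms] greaterThan_iff less_eq_real_def order_less_irrefl)
  moreover have "Ck_on k {1<..} (\<lambda>t::real. inverse (t * t + - 1))"
  proof (rule Ck_on_inverse[OF o])
    show "Ck_on k {1<..} (\<lambda>t::real. t * t + - 1)"
      by (intro Ck_on_add Ck_on_bilinear[OF _ bounded_bilinear_mult] Ck_on_const id o)
  qed (use square_minus_one_pos in \<open>force simp: power2_eq_square\<close>)
  moreover have "Ck_on k {1<..} (\<lambda>t. - (t * stenzel_p \<kappa> t))"
    by (intro Ck_on_bounded_linear[OF o bounded_linear_minus[OF bounded_linear_ident]]
        Ck_on_bilinear[OF o bounded_bilinear_mult] id C)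
  ultimately show "Ck_on k {1<..} (\<lambda>t. ((\<kappa> * (inverse (stenzel_p \<kappa> t) * inverse (stenzel_p \<kappa> t)) +
      - (t * stenzel_p \<kappa> t)) * inverse (t * t + - 1)) * v)"
    by (intro Ck_on_add[OF o] Ck_on_bilinear[OF o bounded_bilinear_mult] Ck_on_const)
qed

text \<open>The last inequality is positivity of the Stenzel metric in the radial direction; the left
  hand side equals \<open>\<kappa> / u'(t)\<^sup>2\<close>, which is the Monge-Ampere equation for \<open>u\<close>.\<close>

lemma stenzel_u'_derivative:
  assumes "\<kappa> > 0"
  obtains p' where "\<And>t. t \<ge> 1 \<Longrightarrow> (stenzel_u' \<kappa> has_real_derivative p' t) (at t within {1..})"
    "\<And>t. t \<ge> 1 \<Longrightarrow> t * stenzel_u' \<kappa> t + (t\<^sup>2 - 1) * p' t > 0"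
proof -
  obtain q where q: "(stenzel_p \<kappa> has_real_derivative q) (at 1 within {1..})"
    using stenzel_p_deriv_1[OF assms] by blast
  \<comment> \<open>At \<open>t = 1\<close> the quotient is 0/0 and the one-sided derivative takes
    its place. There the factor t^2 - 1 leaves just u'(1) in the inequality.\<close>
  define p' where "p' t = (if t = 1 then q else (\<kappa> / (stenzel_p \<kappa> t)\<^sup>2 - t * stenzel_p \<kappa> t) / (t\<^sup>2 - 1))" for t
  have "(stenzel_p \<kappa> has_real_derivative p' t) (at t within {1..})" if "t \<ge> 1" for t
    using q stenzel_p_deriv[OF assms, of t] that by (auto simp: p'_def intro: has_field_derivative_at_within)
  then have "(stenzel_u' \<kappa> has_real_derivative p' t) (at t within {1..})" if "t \<ge> 1" for t
    using has_field_derivative_transform_within[of "stenzel_p \<kappa>" "p' t" t "{1..}" 1 "stenzel_u' \<kappa>"] that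
      stenzel_u'_eq[OF assms] by simp
  moreover have "t * stenzel_u' \<kappa> t + (t\<^sup>2 - 1) * p' t > 0" if t: "t \<ge> 1" for t
  proof (cases "t = 1")
    case True
    then show ?thesis using stenzel_p_pos[OF assms] by (simp add: stenzel_u'_eq[OF assms])
  next
    case False
    then have "t\<^sup>2 - 1 \<noteq> 0" using t square_minus_one_pos[of t] by linarith
    then have "t * stenzel_u' \<kappa> t + (t\<^sup>2 - 1) * p' t = \<kappa> / (stenzel_p \<kappa> t)\<^sup>2"
      using False t by (simp add: p'_def stenzel_u'_eq[OF assms])
    then show ?thesis using assms stenzel_p_pos[OF assms t] by simp
  qed
  ultimately show ?thesis using that by blast
qed

section \<open>Linear algebra on the tangent spaces of the quadric\<close>

lemma UNIV_4': "(UNIV :: 4 set) = {0, 1, 2, 3}"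
proof -
  \<comment> \<open>\<open>exhaust_4\<close> lists 1, 2, 3, 4, and 4 equals 0 in this type.\<close>
  have "x \<in> {0, 1, 2, 3}" for x :: 4 using exhaust_4[of x] by auto
  then show ?thesis by blast
qed

lemma scaleR_complex: "a *\<^sub>R x = of_real a * x" for x :: complex
  by (rule scaleR_conv_of_real)

lemma sum_4': "(\<Sum>j\<in>UNIV. f (j::4)) = f 0 + f 1 + f 2 + f 3"
  unfolding UNIV_4' by (simp add: add.assoc)

lemma forall_4': "(\<forall>j::4. P j) \<longleftrightarrow> P 0 \<and> P 1 \<and> P 2 \<and> P 3"
  using UNIV_4' by (metis UNIV_I insertE emptyE)

definition vec4 :: "'a \<Rightarrow> 'a \<Rightarrow> 'a \<Rightarrow> 'a \<Rightarrow> 'a^4" where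
  "vec4 a b c d = (\<chi> i. if i = 0 then a else if i = 1 then b else if i = 2 then c else d)"

lemma vec4_nth [simp]: "vec4 a b c d $ 0 = a" "vec4 a b c d $ 1 = b" "vec4 a b c d $ 2 = c" "vec4 a b c d $ 3 = d"
  by (simp_all add: vec4_def)

lemma vec4_eq_iff: "v = w \<longleftrightarrow> v$0 = w$0 \<and> v$1 = w$1 \<and> v$2 = w$2 \<and> v$3 = w$3" for v w :: "'a^4"
  by (simp add: vec_eq_iff forall_4')

lemma det_4:
  "det (A::'a::comm_ring_1^4^4) =
    A$0$0 * (A$1$1 * (A$2$2 * A$3$3 - A$2$3 * A$3$2) - A$1$2 * (A$2$1 * A$3$3 - A$2$3 * A$3$1) + A$1$3 * (A$2$1 * A$3$2 - A$2$2 * A$3$1))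
  - A$0$1 * (A$1$0 * (A$2$2 * A$3$3 - A$2$3 * A$3$2) - A$1$2 * (A$2$0 * A$3$3 - A$2$3 * A$3$0) + A$1$3 * (A$2$0 * A$3$2 - A$2$2 * A$3$0))
  + A$0$2 * (A$1$0 * (A$2$1 * A$3$3 - A$2$3 * A$3$1) - A$1$1 * (A$2$0 * A$3$3 - A$2$3 * A$3$0) + A$1$3 * (A$2$0 * A$3$1 - A$2$1 * A$3$0))
  - A$0$3 * (A$1$0 * (A$2$1 * A$3$2 - A$2$2 * A$3$1) - A$1$1 * (A$2$0 * A$3$2 - A$2$2 * A$3$0) + A$1$2 * (A$2$0 * A$3$1 - A$2$1 * A$3$0))"
proof -
  have f: "finite {1::4, 2, 3}" "0 \<notin> {1::4, 2, 3}" "finite {2::4, 3}" "1 \<notin> {2::4, 3}" "finite {3::4}" "2 \<notin> {3::4}"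
    by auto
  show ?thesis
    unfolding det_def UNIV_4'
    unfolding sum_over_permutations_insert[OF f(1,2)]
    unfolding sum_over_permutations_insert[OF f(3,4)]
    unfolding sum_over_permutations_insert[OF f(5,6)]
    unfolding permutes_sing
    by (simp add: sign_swap_id permutation_swap_id sign_compose sign_id swap_id_eq permutation_compose algebra_simps)
qed

lemma Omega_St_eq:
  "Omega_St z u v w =
    z$0 * (u$1 * (v$2 * w$3 - v$3 * w$2) - u$2 * (v$1 * w$3 - v$3 * w$1) + u$3 * (v$1 * w$2 - v$2 * w$1))
  - z$1 * (u$0 * (v$2 * w$3 - v$3 * w$2) - u$2 * (v$0 * w$3 - v$3 * w$0) + u$3 * (v$0 * w$2 - v$2 * w$0))
  + z$2 * (u$0 * (v$1 * w$3 - v$3 * w$1) - u$1 * (v$0 * w$3 - v$3 * w$0) + u$3 * (v$0 * w$1 - v$1 * w$0))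
  - z$3 * (u$0 * (v$1 * w$2 - v$2 * w$1) - u$1 * (v$0 * w$2 - v$2 * w$0) + u$2 * (v$0 * w$1 - v$1 * w$0))"
  unfolding Omega_St_def det_4 by simp

lemma Omega_St_linear:
  "Omega_St z (u + u') v w = Omega_St z u v w + Omega_St z u' v w"
  "Omega_St z u (v + v') w = Omega_St z u v w + Omega_St z u v' w"
  "Omega_St z u v (w + w') = Omega_St z u v w + Omega_St z u v w'"
  "Omega_St z (a *\<^sub>R u) v w = a *\<^sub>R Omega_St z u v w"
  "Omega_St z u (a *\<^sub>R v) w = a *\<^sub>R Omega_St z u v w"
  "Omega_St z u v (a *\<^sub>R w) = a *\<^sub>R Omega_St z u v w"
  unfolding Omega_St_eq by (simp_all add: scaleR_complex algebra_simps)

lemma Omega_St_alternating: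
  "Omega_St z u u w = 0" "Omega_St z u v u = 0" "Omega_St z v u u = 0"
  "Omega_St z v u w = - Omega_St z u v w" "Omega_St z u w v = - Omega_St z u v w"
  unfolding Omega_St_eq by (simp_all add: algebra_simps)

text \<open>The factor, a 3 x 3 determinant, is real: on the real span of three vectors the
  vanishing of the imaginary part is decided by a single value.\<close>

lemma Omega_St_span:
  "Omega_St z (a1 *\<^sub>R u + b1 *\<^sub>R v + c1 *\<^sub>R w) (a2 *\<^sub>R u + b2 *\<^sub>R v + c2 *\<^sub>R w) (a3 *\<^sub>R u + b3 *\<^sub>R v + c3 *\<^sub>R w) =
    (a1 * (b2 * c3 - b3 * c2) - b1 * (a2 * c3 - a3 * c2) + c1 * (a2 * b3 - a3 * b2)) *\<^sub>R Omega_St z u v w"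
proof -
  have "Omega_St z v w u = Omega_St z u v w" "Omega_St z w u v = Omega_St z u v w" "Omega_St z w v u = - Omega_St z u v w"
    using Omega_St_alternating(4,5) by (metis minus_minus)+
  then show ?thesis
    using Omega_St_alternating(4)[of z v u w] Omega_St_alternating(5)[of z u w v]
    by (simp add: Omega_St_linear Omega_St_alternating(1-3) scaleR_complex algebra_simps)
qed

section \<open>Hermitian and complex bilinear products, and the generators of the torus\<close>

definition herm :: "complex^4 \<Rightarrow> complex^4 \<Rightarrow> complex" where
  "herm v w = (\<Sum>j\<in>UNIV. v$j * cnj (w$j))"

lemma herm_4: "herm v w = v$0 * cnj (w$0) + v$1 * cnj (w$1) + v$2 * cnj (w$2) + v$3 * cnj (w$3)"
  by (simp add: herm_def sum_4')

text \<open>The shape of i del delbar P(|z|^2) for p = P' and q = P'': the first term comes from the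
  Hessian of |z|^2, the second from its gradient taken twice.\<close>

definition kahler :: "real \<Rightarrow> real \<Rightarrow> complex^4 \<Rightarrow> complex^4 \<Rightarrow> complex^4 \<Rightarrow> real" where
  "kahler p q z v w = p * Im (herm v w) + q * Im (herm v z * cnj (herm w z))"

lemma herm_linear:
  "herm (u + v) w = herm u w + herm v w" "herm u (v + w) = herm u v + herm u w"
  "herm (a *\<^sub>R v) w = a *\<^sub>R herm v w" "herm v (a *\<^sub>R w) = a *\<^sub>R herm v w"
  by (simp_all add: herm_4 scaleR_complex algebra_simps)

lemma kahler_linear:
  "kahler p q z (u + v) w = kahler p q z u w + kahler p q z v w"
  "kahler p q z u (v + w) = kahler p q z u v + kahler p q z u w"
  "kahler p q z (a *\<^sub>R v) w = a * kahler p q z v w"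
  "kahler p q z v (a *\<^sub>R w) = a * kahler p q z v w"
  by (simp_all add: kahler_def herm_linear algebra_simps)

lemma herm_swap: "cnj (herm v w) = herm w v"
  by (simp add: herm_4 mult.commute)

lemma kahler_swap: "kahler p q z v w = - kahler p q z w v"
proof -
  have "Im (herm v w) = - Im (herm w v)" using arg_cong[OF herm_swap[of w v], of Im] by simp
  then show ?thesis by (simp add: kahler_def algebra_simps)
qed

definition cdot :: "complex^4 \<Rightarrow> complex^4 \<Rightarrow> complex" where
  "cdot z w = z$0 * w$0 + z$1 * w$1 + z$2 * w$2 + z$3 * w$3"

lemma Q_iff_cdot: "z \<in> Q \<longleftrightarrow> cdot z z = 1"
  by (simp add: Q_def cdot_def power2_eq_square)

text \<open>The infinitesimal generators of the torus action.\<close>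

definition X1 :: "complex^4 \<Rightarrow> complex^4" where "X1 z = vec4 (- z$1) (z$0) 0 0"
definition X2 :: "complex^4 \<Rightarrow> complex^4" where "X2 z = vec4 0 0 (- z$3) (z$2)"

text \<open>C^4 splits into two copies of C^2, one for each circle. \<open>m1\<close>,
  \<open>m2\<close> are the moment maps of the flat form up to a constant factor, \<open>n1\<close>,
  \<open>n2\<close> the squared norms of the two parts.\<close>

definition m1 :: "complex^4 \<Rightarrow> real" where "m1 z = Im (z$0 * cnj (z$1))"
definition m2 :: "complex^4 \<Rightarrow> real" where "m2 z = Im (z$2 * cnj (z$3))"
definition n1 :: "complex^4 \<Rightarrow> real" where "n1 z = (norm (z$0))\<^sup>2 + (norm (z$1))\<^sup>2"
definition n2 :: "complex^4 \<Rightarrow> real" where "n2 z = (norm (z$2))\<^sup>2 + (norm (z$3))\<^sup>2"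

lemma norm_sq_n: "(norm z)\<^sup>2 = n1 z + n2 z" for z :: "complex^4"
  by (simp add: norm_vec_def L2_set_def sum_4' n1_def n2_def)

lemma inner_herm: "z \<bullet> w = Re (herm w z)" for z w :: "complex^4"
  by (simp add: inner_vec_def sum_4' herm_4 inner_complex_def mult.commute)

text \<open>Since \<open>herm (X1 z) z\<close> is the imaginary number 2 i \<open>m1 z\<close>, the
  second term of \<open>kahler\<close> becomes a multiple of the derivative of |z|^2. The right-hand
  sides are what the product rule gives for P(|z|^2) \<open>m1 z\<close> and P(|z|^2)
  \<open>m2 z\<close>.\<close>

lemma kahler_X:
  "kahler p q z (X1 z) w = q * (2 * (z \<bullet> w)) * m1 z + p * Im (w$0 * cnj (z$1) + z$0 * cnj (w$1))"
  "kahler p q z (X2 z) w = q * (2 * (z \<bullet> w)) * m2 z + p * Im (w$2 * cnj (z$3) + z$2 * cnj (w$3))"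
proof -
  have "herm (X1 z) z = \<i> * of_real (2 * m1 z)" "herm (X2 z) z = \<i> * of_real (2 * m2 z)"
    by (simp_all add: herm_4 X1_def X2_def m1_def m2_def complex_eq_iff)
  then show "kahler p q z (X1 z) w = q * (2 * (z \<bullet> w)) * m1 z + p * Im (w$0 * cnj (z$1) + z$0 * cnj (w$1))"
    "kahler p q z (X2 z) w = q * (2 * (z \<bullet> w)) * m2 z + p * Im (w$2 * cnj (z$3) + z$2 * cnj (w$3))"
    unfolding kahler_def inner_herm by (simp_all add: herm_4[of _ w] X1_def X2_def algebra_simps)
qed

text \<open>The first equation says that torus orbits are isotropic; the others give minus the Gram
  matrix of \<open>X1\<close>, \<open>X2\<close> for the symmetric form associated with
  \<open>kahler\<close>.\<close>

lemma kahler_X_X: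
  "kahler p q z (X1 z) (X2 z) = 0"
  "kahler p q z (X1 z) (\<i> *s X1 z) = - (p * n1 z + 4 * q * (m1 z)\<^sup>2)"
  "kahler p q z (X1 z) (\<i> *s X2 z) = - (4 * q * m1 z * m2 z)"
  "kahler p q z (X2 z) (\<i> *s X1 z) = - (4 * q * m1 z * m2 z)"
  "kahler p q z (X2 z) (\<i> *s X2 z) = - (p * n2 z + 4 * q * (m2 z)\<^sup>2)"
  unfolding kahler_X inner_herm n1_def n2_def cmod_power2
  by (simp_all add: herm_4 X1_def X2_def m1_def m2_def power2_eq_square algebra_simps)

lemma Omega_St_X1_X2:
  assumes "z \<in> Q" "cdot z w = 0"
  shows "Omega_St z (X1 z) (X2 z) w = z$0 * w$0 + z$1 * w$1"
proof -
  \<comment> \<open>A polynomial identity on all of C^4; the quadric and its tangent equation enter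
    only afterwards, as values of the two \<open>cdot\<close> factors.\<close>
  have "Omega_St z (X1 z) (X2 z) w = cdot z z * (z$0 * w$0 + z$1 * w$1) - ((z$0)\<^sup>2 + (z$1)\<^sup>2) * cdot z w"
    by (simp add: Omega_St_eq X1_def X2_def cdot_def power2_eq_square algebra_simps)
  then show ?thesis using assms by (simp add: Q_iff_cdot)
qed

text \<open>z0^2 + z1^2 = (z0 + i z1)(z0 - i z1), and the squared norms of the factors are n1 + 2 m1
  and n1 - 2 m1.\<close>

lemma norm_sum_squares:
  "(norm ((z$0)\<^sup>2 + (z$1)\<^sup>2))\<^sup>2 = (n1 z)\<^sup>2 - 4 * (m1 z)\<^sup>2"
  "(norm ((z$2)\<^sup>2 + (z$3)\<^sup>2))\<^sup>2 = (n2 z)\<^sup>2 - 4 * (m2 z)\<^sup>2"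
  unfolding n1_def n2_def cmod_power2
  by (simp_all add: m1_def m2_def power2_eq_square algebra_simps)

lemma n_nonneg: "n1 z \<ge> 0" "n2 z \<ge> 0"
  by (simp_all add: n1_def n2_def)

lemma norm_sum_squares_le:
  "norm ((z$0)\<^sup>2 + (z$1)\<^sup>2) \<le> n1 z" "norm ((z$2)\<^sup>2 + (z$3)\<^sup>2) \<le> n2 z"
  by (rule power2_le_imp_le[OF _ n_nonneg(1)], unfold norm_sum_squares, simp)
    (rule power2_le_imp_le[OF _ n_nonneg(2)], unfold norm_sum_squares, simp)

lemma Q_norm_sum_squares_ge_1:
  assumes "z \<in> Q"
  shows "1 \<le> norm ((z$0)\<^sup>2 + (z$1)\<^sup>2) + norm ((z$2)\<^sup>2 + (z$3)\<^sup>2)"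
  using norm_triangle_ineq[of "(z$0)\<^sup>2 + (z$1)\<^sup>2" "(z$2)\<^sup>2 + (z$3)\<^sup>2"] assms
  by (simp add: Q_def add.assoc)

text \<open>Cauchy-Schwarz with \<open>a = z\<^sub>0\<^sup>2 + z\<^sub>1\<^sup>2\<close> and \<open>b = z\<^sub>2\<^sup>2 + z\<^sub>3\<^sup>2\<close>:
  \<open>1 \<le> (|a| + |b|)\<^sup>2 \<le> (n1 + n2) (|a|\<^sup>2 / n1 + |b|\<^sup>2 / n2)\<close>.\<close>

lemma Gram_bound:
  assumes "z \<in> Q"
  shows "4 * (n1 z + n2 z) * ((m1 z)\<^sup>2 * n2 z + (m2 z)\<^sup>2 * n1 z) \<le> n1 z * n2 z * ((n1 z + n2 z)\<^sup>2 - 1)"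
proof -
  define a where "a = norm ((z$0)\<^sup>2 + (z$1)\<^sup>2)"
  define b where "b = norm ((z$2)\<^sup>2 + (z$3)\<^sup>2)"
  note ab = norm_sum_squares[of z, folded a_def b_def]
  have "1 \<le> (a + b)\<^sup>2" using Q_norm_sum_squares_ge_1[OF assms] by (simp add: a_def b_def one_le_power)
  then have "n1 z * n2 z * 1 \<le> n1 z * n2 z * (a + b)\<^sup>2" using n_nonneg by (intro mult_left_mono mult_nonneg_nonneg)
  also have "\<dots> \<le> n1 z * n2 z * (a + b)\<^sup>2 + (a * n2 z - b * n1 z)\<^sup>2" by simp
  also have "\<dots> = (n1 z + n2 z) * (a\<^sup>2 * n2 z + b\<^sup>2 * n1 z)"
    by (simp add: power2_eq_square algebra_simps)
  finally show ?thesis unfolding ab by (simp add: power2_eq_square algebra_simps)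
qed

lemma n_sum_ge_1:
  assumes "z \<in> Q"
  shows "1 \<le> n1 z + n2 z"
  using norm_sum_squares_le[of z] Q_norm_sum_squares_ge_1[OF assms] by linarith

text \<open>On the zero section the chain 1 \<le> |z0^2 + z1^2| + |z2^2 + z3^2| \<le> n1 + n2
  consists of equalities, and \<open>norm_sum_squares\<close> then forces the moment maps to vanish.
  Thus a nonzero \<open>c1\<close> or \<open>c2\<close> keeps a locus away from
  \<open>t = 1\<close>.\<close>

lemma zero_section_m:
  assumes "z \<in> Q" "n1 z + n2 z = 1"
  shows "m1 z = 0" "m2 z = 0"
proof -
  have "norm ((z$0)\<^sup>2 + (z$1)\<^sup>2) = n1 z" "norm ((z$2)\<^sup>2 + (z$3)\<^sup>2) = n2 z"
    using norm_sum_squares_le[of z] Q_norm_sum_squares_ge_1[OF assms(1)] assms(2) by linarith+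
  then show "m1 z = 0" "m2 z = 0" using norm_sum_squares[of z] by (simp_all only: diff_self) auto
qed

text \<open>The left-hand side times \<open>p\<close> is the determinant of the Gram matrix. For
  negative \<open>q\<close> an upper bound on the moment maps is required: \<open>Gram_bound\<close>
  turns the radial hypothesis, multiplied by n1 n2, into n1 + n2 times the claim.\<close>

lemma Gram_pos:
  assumes "z \<in> Q" "p > 0" "(n1 z + n2 z) * p + ((n1 z + n2 z)\<^sup>2 - 1) * q > 0" "n1 z > 0" "n2 z > 0"
  shows "p * (n1 z * n2 z) + 4 * q * ((m1 z)\<^sup>2 * n2 z + (m2 z)\<^sup>2 * n1 z) > 0"
proof (cases "q \<ge> 0")
  case True
  have "0 < p * (n1 z * n2 z)" "0 \<le> 4 * q * ((m1 z)\<^sup>2 * n2 z + (m2 z)\<^sup>2 * n1 z)"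
    using True assms by auto
  then show ?thesis by linarith
next
  case False
  let ?t = "n1 z + n2 z"
  let ?E = "(m1 z)\<^sup>2 * n2 z + (m2 z)\<^sup>2 * n1 z"
  have "0 < n1 z * n2 z * (?t * p + (?t\<^sup>2 - 1) * q)" using assms by (intro mult_pos_pos)
  also have "\<dots> = ?t * p * (n1 z * n2 z) + q * (n1 z * n2 z * (?t\<^sup>2 - 1))" by (simp add: algebra_simps)
  also have "\<dots> \<le> ?t * p * (n1 z * n2 z) + q * (4 * ?t * ?E)"
    using Gram_bound[OF assms(1)] False by (intro add_left_mono mult_left_mono_neg) auto
  also have "\<dots> = ?t * (p * (n1 z * n2 z) + 4 * q * ?E)" by (simp add: algebra_simps)
  finally show ?thesis using assms(4,5) by (simp add: zero_less_mult_iff)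
qed

lemma linear_system_2:
  fixes a b d :: real
  assumes "a * d - b * b \<noteq> 0"
  shows "\<exists>x y. a * x + b * y = r \<and> b * x + d * y = s"
proof (intro exI conjI)
  let ?D = "a * d - b * b"
  have "a * ((d * r - b * s) / ?D) + b * ((a * s - b * r) / ?D) = (r * ?D) / ?D"
    by (simp add: add_divide_distrib[symmetric] algebra_simps)
  then show "a * ((d * r - b * s) / ?D) + b * ((a * s - b * r) / ?D) = r" using assms by simp
  have "b * ((d * r - b * s) / ?D) + d * ((a * s - b * r) / ?D) = (s * ?D) / ?D"
    by (simp add: add_divide_distrib[symmetric] algebra_simps)
  then show "b * ((d * r - b * s) / ?D) + d * ((a * s - b * r) / ?D) = s" using assms by simp
qed

lemma linear_system_2_unique:
  fixes a b d :: real
  assumes "a * d - b * b \<noteq> 0" "a * x + b * y = 0" "b * x + d * y = 0"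
  shows "x = 0" "y = 0"
proof -
  have "(a * d - b * b) * x = d * (a * x + b * y) - b * (b * x + d * y)"
    "(a * d - b * b) * y = a * (b * x + d * y) - b * (a * x + b * y)" by (simp_all add: algebra_simps)
  then have "(a * d - b * b) * x = 0" "(a * d - b * b) * y = 0" unfolding assms(2,3) by simp_all
  then show "x = 0" "y = 0" using assms(1) by simp_all
qed

text \<open>For \<open>p = u'(|z|\<^sup>2)\<close> and \<open>q = u''(|z|\<^sup>2)\<close> the form \<open>- 2 kahler p q z\<close> is \<open>omega_St\<close>; the case \<open>p = 1\<close>, \<open>q = 0\<close>
  is the flat one.  The hypothesis \<open>pq\<close> is positivity in the radial direction.\<close>

locale free_point =
  fixes z :: "complex^4" and p q :: real
  assumes zQ: "z \<in> Q" and p: "p > 0" and pq: "(norm z)\<^sup>2 * p + ((norm z)^4 - 1) * q > 0"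
    and n1: "n1 z > 0" and n2: "n2 z > 0"
begin

lemma Gram_det:
  "(p * n1 z + 4 * q * (m1 z)\<^sup>2) * (p * n2 z + 4 * q * (m2 z)\<^sup>2) - (4 * q * m1 z * m2 z) * (4 * q * m1 z * m2 z) \<noteq> 0"
proof -
  have "(norm z)^4 = (n1 z + n2 z)\<^sup>2"
    by (metis norm_sq_n power2_eq_square power4_eq_xxxx mult.assoc)
  then have "p * (p * (n1 z * n2 z) + 4 * q * ((m1 z)\<^sup>2 * n2 z + (m2 z)\<^sup>2 * n1 z)) > 0"
    using Gram_pos[OF zQ p _ n1 n2] pq p by (simp add: norm_sq_n)
  then show ?thesis by (simp add: power2_eq_square algebra_simps)
qed

text \<open>The vectors \<open>X1 z\<close>, \<open>X2 z\<close> and \<open>N\<close> are a complex basis of \<open>T\<^sub>zQ\<close>.\<close>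

definition N :: "complex^4" where
  "N = vec4 (cnj (z$0) / of_real (n1 z)) (cnj (z$1) / of_real (n1 z)) (- cnj (z$2) / of_real (n2 z)) (- cnj (z$3) / of_real (n2 z))"

lemma n_cnj: "z$0 * cnj (z$0) + z$1 * cnj (z$1) = of_real (n1 z)" "z$2 * cnj (z$2) + z$3 * cnj (z$3) = of_real (n2 z)"
  by (simp_all add: n1_def n2_def complex_mult_cnj cmod_power2)

text \<open>The opposite signs make \<open>N\<close> tangent to the quadric, while along it z0^2 +
  z1^2 changes at the nonzero rate 2.\<close>

lemma N: "z$0 * N$0 + z$1 * N$1 = 1" "z$2 * N$2 + z$3 * N$3 = -1"
  using n1 n2 n_cnj by (simp_all add: N_def add_divide_distrib[symmetric] diff_divide_distrib[symmetric])
   (simp_all add: field_simps)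

text \<open>In each copy of C^2 the complex line orthogonal, for the bilinear product, to (z0, z1)
  is spanned by (-z1, z0). The coefficients \<open>\<alpha>\<close> and \<open>\<beta>\<close> come
  from Hermitian projection to these spanning vectors; their real and imaginary parts are the four
  coefficients.\<close>

lemma tangent_decomposition:
  assumes "cdot z w = 0" "z$0 * w$0 + z$1 * w$1 = 0"
  shows "\<exists>a b c d. w = a *\<^sub>R X1 z + b *\<^sub>R X2 z + c *\<^sub>R (\<i> *s X1 z) + d *\<^sub>R (\<i> *s X2 z)"
proof -
  have w23: "z$2 * w$2 + z$3 * w$3 = 0" using assms by (simp add: cdot_def add.assoc)
  define \<alpha> where "\<alpha> = (cnj (z$0) * w$1 - cnj (z$1) * w$0) / of_real (n1 z)"
  define \<beta> where "\<beta> = (cnj (z$2) * w$3 - cnj (z$3) * w$2) / of_real (n2 z)"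
  have ne: "of_real (n1 z) \<noteq> (0::complex)" "of_real (n2 z) \<noteq> (0::complex)" using n1 n2 by auto
  have alphan: "cnj (z$0) * w$1 - cnj (z$1) * w$0 = \<alpha> * of_real (n1 z)" using ne by (simp add: \<alpha>_def)
  have betan: "cnj (z$2) * w$3 - cnj (z$3) * w$2 = \<beta> * of_real (n2 z)" using ne by (simp add: \<beta>_def)
  have w0: "w$0 = - (\<alpha> * z$1)"
  proof -
    have "w$0 * of_real (n1 z) = - ((cnj (z$0) * w$1 - cnj (z$1) * w$0) * z$1) + cnj (z$0) * (z$0 * w$0 + z$1 * w$1)"
      unfolding n_cnj[symmetric] by (simp add: algebra_simps)
    then have "w$0 * of_real (n1 z) = (- (\<alpha> * z$1)) * of_real (n1 z)"
      unfolding alphan assms(2) by simp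
    then show ?thesis using mult_right_cancel ne(1) by blast
  qed
  have w1: "w$1 = \<alpha> * z$0"
  proof -
    have "w$1 * of_real (n1 z) = (cnj (z$0) * w$1 - cnj (z$1) * w$0) * z$0 + cnj (z$1) * (z$0 * w$0 + z$1 * w$1)"
      unfolding n_cnj[symmetric] by (simp add: algebra_simps)
    then have "w$1 * of_real (n1 z) = (\<alpha> * z$0) * of_real (n1 z)"
      unfolding alphan assms(2) by simp
    then show ?thesis using mult_right_cancel ne(1) by blast
  qed
  have w2: "w$2 = - (\<beta> * z$3)"
  proof -
    have "w$2 * of_real (n2 z) = - ((cnj (z$2) * w$3 - cnj (z$3) * w$2) * z$3) + cnj (z$2) * (z$2 * w$2 + z$3 * w$3)"
      unfolding n_cnj[symmetric] by (simp add: algebra_simps)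
    then have "w$2 * of_real (n2 z) = (- (\<beta> * z$3)) * of_real (n2 z)"
      unfolding betan w23 by simp
    then show ?thesis using mult_right_cancel ne(2) by blast
  qed
  have w3: "w$3 = \<beta> * z$2"
  proof -
    have "w$3 * of_real (n2 z) = (cnj (z$2) * w$3 - cnj (z$3) * w$2) * z$2 + cnj (z$3) * (z$2 * w$2 + z$3 * w$3)"
      unfolding n_cnj[symmetric] by (simp add: algebra_simps)
    then have "w$3 * of_real (n2 z) = (\<beta> * z$2) * of_real (n2 z)"
      unfolding betan w23 by simp
    then show ?thesis using mult_right_cancel ne(2) by blast
  qed
  have "w = Re \<alpha> *\<^sub>R X1 z + Re \<beta> *\<^sub>R X2 z + Im \<alpha> *\<^sub>R (\<i> *s X1 z) + Im \<beta> *\<^sub>R (\<i> *s X2 z)"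
    unfolding vec4_eq_iff by (simp add: w0 w1 w2 w3 X1_def X2_def complex_eq_iff)
  then show ?thesis by blast
qed

text \<open>The common kernel of the differentials of the defining functions; by
  \<open>kahler_X\<close> the two middle conditions are those of the moment maps. At a free point of
  a submanifold lying in a locus, it contains the tangent space.\<close>

definition K :: "(complex^4) set" where
  "K = {w. cdot z w = 0 \<and> kahler p q z (X1 z) w = 0 \<and> kahler p q z (X2 z) w = 0 \<and> Im (z$0 * w$0 + z$1 * w$1) = 0}"

lemma K_subspace: "v \<in> K \<Longrightarrow> w \<in> K \<Longrightarrow> v + a *\<^sub>R w \<in> K"
proof -
  assume vw: "v \<in> K" "w \<in> K"
  let ?w = "v + a *\<^sub>R w"
  have "cdot z ?w = cdot z v + a *\<^sub>R cdot z w"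
    by (simp add: cdot_def scaleR_complex algebra_simps)
  then have "cdot z ?w = 0" using vw by (simp add: K_def)
  moreover have "Im (z$0 * ?w$0 + z$1 * ?w$1) = Im (z$0 * v$0 + z$1 * v$1) + a * Im (z$0 * w$0 + z$1 * w$1)"
    by (simp add: algebra_simps)
  then have "Im (z$0 * ?w$0 + z$1 * ?w$1) = 0"
    using vw unfolding K_def mem_Collect_eq by (metis add_0 mult_zero_right)
  moreover have "kahler p q z (X1 z) ?w = 0" "kahler p q z (X2 z) ?w = 0"
    using vw by (simp_all add: K_def kahler_linear)
  ultimately show ?thesis unfolding K_def mem_Collect_eq by blast
qed

lemma X_in_K: "X1 z \<in> K" "X2 z \<in> K"
proof -
  have "kahler p q z v v = 0" for v using kahler_swap[of p q z v v] by simp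
  then show "X1 z \<in> K" "X2 z \<in> K"
    using kahler_X_X(1)[of p q z] kahler_swap[of p q z "X2 z" "X1 z"]
    by (simp_all add: K_def cdot_def X1_def X2_def)
qed

text \<open>Pairing with \<open>X1\<close>, \<open>X2\<close> applies the Gram matrix, up to sign,
  to the coefficients of \<open>i X1\<close> and \<open>i X2\<close>, so these vanish.\<close>

lemma K_vertical:
  assumes "w \<in> K" "z$0 * w$0 + z$1 * w$1 = 0"
  shows "\<exists>a b. w = a *\<^sub>R X1 z + b *\<^sub>R X2 z"
proof -
  have w: "cdot z w = 0" "kahler p q z (X1 z) w = 0" "kahler p q z (X2 z) w = 0" using assms(1) by (auto simp: K_def)
  obtain a b c d where abcd: "w = a *\<^sub>R X1 z + b *\<^sub>R X2 z + c *\<^sub>R (\<i> *s X1 z) + d *\<^sub>R (\<i> *s X2 z)"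
    using tangent_decomposition[OF w(1) assms(2)] by blast
  have X: "kahler p q z (X1 z) (X1 z) = 0" "kahler p q z (X2 z) (X2 z) = 0" "kahler p q z (X2 z) (X1 z) = 0"
    using X_in_K by (simp_all add: K_def)
  have "(p * n1 z + 4 * q * (m1 z)\<^sup>2) * c + (4 * q * m1 z * m2 z) * d = 0"
    using w(2) unfolding abcd by (simp add: kahler_linear kahler_X_X X algebra_simps)
  moreover have "(4 * q * m1 z * m2 z) * c + (p * n2 z + 4 * q * (m2 z)\<^sup>2) * d = 0"
    using w(3) unfolding abcd by (simp add: kahler_linear kahler_X_X X algebra_simps)
  ultimately have "c = 0" "d = 0" using linear_system_2_unique[OF Gram_det] by blast+
  then show ?thesis using abcd by auto
qed

text \<open>On \<open>K\<close> the differential of z0^2 + z1^2 takes real values, so one vector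
  \<open>u\<close> outside its kernel suffices and the rest is \<open>K_vertical\<close>. If there
  is no such vector, \<open>X1\<close> can serve as \<open>u\<close>.\<close>

lemma K_span: "\<exists>u\<in>K. \<forall>w\<in>K. \<exists>a b c. w = a *\<^sub>R X1 z + b *\<^sub>R X2 z + c *\<^sub>R u"
proof (cases "\<forall>w\<in>K. z$0 * w$0 + z$1 * w$1 = 0")
  case True
  then show ?thesis using K_vertical X_in_K(1) by (metis add.right_neutral scaleR_zero_left)
next
  case False
  then obtain u where u: "u \<in> K" "z$0 * u$0 + z$1 * u$1 \<noteq> 0" by blast
  define f where "f w = Re (z$0 * w$0 + z$1 * w$1)" for w :: "complex^4"
  have fK: "z$0 * w$0 + z$1 * w$1 = of_real (f w)" if "w \<in> K" for w
    using that by (simp add: K_def f_def complex_eq_iff)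
  have fu: "f u \<noteq> 0" using u(2) unfolding fK[OF u(1)] by simp
  have "\<exists>a b c. w = a *\<^sub>R X1 z + b *\<^sub>R X2 z + c *\<^sub>R u" if w: "w \<in> K" for w
  proof -
    let ?v = "w + (- (f w / f u)) *\<^sub>R u"
    have "z$0 * ?v$0 + z$1 * ?v$1 = (z$0 * w$0 + z$1 * w$1) - of_real (f w / f u) * (z$0 * u$0 + z$1 * u$1)"
      by (simp add: scaleR_complex algebra_simps)
    also have "\<dots> = 0" unfolding fK[OF w] fK[OF u(1)] using fu by simp
    finally obtain a b where "?v = a *\<^sub>R X1 z + b *\<^sub>R X2 z"
      using K_vertical[OF K_subspace[OF w u(1)]] by blast
    then have "w = a *\<^sub>R X1 z + b *\<^sub>R X2 z + (f w / f u) *\<^sub>R u" by (simp add: algebra_simps)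
    then show ?thesis by blast
  qed
  then show ?thesis using u(1) by blast
qed

lemma kahler_K: "v \<in> K \<Longrightarrow> w \<in> K \<Longrightarrow> kahler p q z v w = 0"
proof -
  assume v: "v \<in> K" and w: "w \<in> K"
  obtain u where u: "u \<in> K" "\<forall>w\<in>K. \<exists>a b c. w = a *\<^sub>R X1 z + b *\<^sub>R X2 z + c *\<^sub>R u" using K_span by blast
  obtain a b c where v': "v = a *\<^sub>R X1 z + b *\<^sub>R X2 z + c *\<^sub>R u" using u(2) v by blast
  obtain a' b' c' where w': "w = a' *\<^sub>R X1 z + b' *\<^sub>R X2 z + c' *\<^sub>R u" using u(2) w by blast
  have X: "kahler p q z (X1 z) x = 0" "kahler p q z (X2 z) x = 0" if "x \<in> K" for x using that by (simp_all add: K_def)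
  have "kahler p q z u u = 0" using kahler_swap[of p q z u u] by linarith
  moreover have "kahler p q z u (X1 z) = 0" using X(1)[OF u(1)] kahler_swap[of p q z u "X1 z"] by linarith
  moreover have "kahler p q z u (X2 z) = 0" using X(2)[OF u(1)] kahler_swap[of p q z u "X2 z"] by linarith
  ultimately have "kahler p q z u w = 0" unfolding w' by (simp add: kahler_linear)
  then show ?thesis unfolding v' by (simp add: kahler_linear X[OF w])
qed

lemma Omega_K: "v1 \<in> K \<Longrightarrow> v2 \<in> K \<Longrightarrow> v3 \<in> K \<Longrightarrow> Im (Omega_St z v1 v2 v3) = 0"
proof -
  assume v: "v1 \<in> K" "v2 \<in> K" "v3 \<in> K"
  obtain u where u: "u \<in> K" "\<forall>w\<in>K. \<exists>a b c. w = a *\<^sub>R X1 z + b *\<^sub>R X2 z + c *\<^sub>R u" using K_span by blast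
  obtain a b c where v1: "v1 = a *\<^sub>R X1 z + b *\<^sub>R X2 z + c *\<^sub>R u" using u(2) v by blast
  obtain a' b' c' where v2: "v2 = a' *\<^sub>R X1 z + b' *\<^sub>R X2 z + c' *\<^sub>R u" using u(2) v by blast
  obtain a'' b'' c'' where v3: "v3 = a'' *\<^sub>R X1 z + b'' *\<^sub>R X2 z + c'' *\<^sub>R u" using u(2) v by blast
  have "Im (Omega_St z (X1 z) (X2 z) u) = 0"
    using u(1) Omega_St_X1_X2[OF zQ, of u] by (simp add: K_def)
  then show ?thesis unfolding v1 v2 v3 Omega_St_span by simp
qed

text \<open>The vector is built from directions that act almost triangularly: \<open>z\<close> moves
  the quadric equation, \<open>i N\<close> then adjusts the third function, and \<open>i X1\<close>,
  \<open>i X2\<close> leave both unchanged and correct the moment maps by inverting the Gram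
  matrix.\<close>

lemma differential_surj:
  "\<exists>w. 2 * cdot z w = c \<and> kahler p q z (X1 z) w = r1 \<and> kahler p q z (X2 z) w = r2 \<and> 2 * Im (z$0 * w$0 + z$1 * w$1) = r3"
proof -
  \<comment> \<open>The multiple of \<open>z\<close> already contributes c/2 times z0^2 + z1^2;
    \<open>\<nu>\<close> is what is missing from r3/2 in the imaginary part.\<close>
  define \<nu> where "\<nu> = r3 / 2 - Im (c / 2 * ((z$0)\<^sup>2 + (z$1)\<^sup>2))"
  define w' where "w' = (c / 2) *s z + (\<i> * of_real \<nu>) *s N"
  obtain x y where xy: "(p * n1 z + 4 * q * (m1 z)\<^sup>2) * x + (4 * q * m1 z * m2 z) * y = kahler p q z (X1 z) w' - r1"
      "(4 * q * m1 z * m2 z) * x + (p * n2 z + 4 * q * (m2 z)\<^sup>2) * y = kahler p q z (X2 z) w' - r2"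
    using linear_system_2[OF Gram_det] by blast
  define w where "w = w' + x *\<^sub>R (\<i> *s X1 z) + y *\<^sub>R (\<i> *s X2 z)"
  have "cdot z w = c / 2 * cdot z z + \<i> * of_real \<nu> * ((z$0 * N$0 + z$1 * N$1) + (z$2 * N$2 + z$3 * N$3))"
    by (simp add: w_def w'_def cdot_def X1_def X2_def scaleR_complex algebra_simps)
  then have c2: "cdot z w = c / 2" using zQ by (simp add: Q_iff_cdot N)
  have "2 * cdot z w = c" unfolding c2 by simp
  moreover have "z$0 * w$0 + z$1 * w$1 = c / 2 * ((z$0)\<^sup>2 + (z$1)\<^sup>2) + \<i> * of_real \<nu> * (z$0 * N$0 + z$1 * N$1)"
    by (simp add: w_def w'_def X1_def X2_def scaleR_complex power2_eq_square algebra_simps)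
  then have "2 * Im (z$0 * w$0 + z$1 * w$1) = r3" by (simp add: N \<nu>_def)
  moreover have "kahler p q z (X1 z) w = r1" "kahler p q z (X2 z) w = r2"
    using xy by (simp_all add: w_def kahler_linear kahler_X_X algebra_simps)
  ultimately show ?thesis by blast
qed

end

section \<open>The Kaehler form and the moment maps\<close>

lemma Q_subset_stenzel_dom: "Q \<subseteq> stenzel_dom"
  using n_sum_ge_1 by (auto simp: stenzel_dom_def norm_sq_n)

lemma frechet_derivative_stenzel_dom:
  assumes z: "z \<in> stenzel_dom" and D: "(f has_derivative D) (at z within stenzel_dom)"
  shows "frechet_derivative f (at z within stenzel_dom) = D"
proof (rule frechet_derivative_unique_within[OF _ D])
  show "(f has_derivative frechet_derivative f (at z within stenzel_dom)) (at z within stenzel_dom)"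
    using D by (metis differentiableI frechet_derivative_works)
next
  fix i :: "complex^4" and e :: real assume "i \<in> Basis" "e > 0"
  \<comment> \<open>The sign is chosen so that the step along \<open>i\<close> does not decrease the
    norm: from a boundary point of \<open>stenzel_dom\<close> some directions are admissible with
    one sign only.\<close>
  define d where "d = (if z \<bullet> i \<ge> 0 then e / 2 else - (e / 2))"
  have "(norm (z + d *\<^sub>R i))\<^sup>2 = (norm z)\<^sup>2 + 2 * (d * (z \<bullet> i)) + (norm (d *\<^sub>R i))\<^sup>2"
    unfolding power2_norm_eq_inner by (simp add: inner_simps inner_commute)
  moreover have "d * (z \<bullet> i) \<ge> 0" using \<open>e > 0\<close> by (simp add: d_def mult_le_0_iff)
  moreover have "1 \<le> (norm z)\<^sup>2" using z by (simp add: stenzel_dom_def)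
  ultimately have "1 \<le> (norm (z + d *\<^sub>R i))\<^sup>2" using zero_le_power2[of "norm (d *\<^sub>R i)"] by linarith
  then have "z + d *\<^sub>R i \<in> stenzel_dom" by (simp add: stenzel_dom_def)
  then show "\<exists>d. 0 < \<bar>d\<bar> \<and> \<bar>d\<bar> < e \<and> z + d *\<^sub>R i \<in> stenzel_dom"
    using \<open>e > 0\<close> by (intro exI[of _ d]) (simp add: d_def)
qed

lemma norm_sq_has_derivative: "((\<lambda>z::'a::real_inner. (norm z)\<^sup>2) has_derivative (\<lambda>v. 2 * (z \<bullet> v))) (at z within S)"
  unfolding power2_norm_eq_inner by (auto intro!: derivative_eq_intros simp: inner_commute)

lemma radial_has_derivative:
  fixes P :: "real \<Rightarrow> real"
  assumes "(P has_real_derivative q) (at ((norm z)\<^sup>2) within T)" "(\<lambda>z. (norm z)\<^sup>2) ` S \<subseteq> T"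
  shows "((\<lambda>z::'a::real_inner. P ((norm z)\<^sup>2)) has_derivative (\<lambda>v. q * (2 * (z \<bullet> v)))) (at z within S)"
  by (rule has_derivative_in_compose[OF norm_sq_has_derivative has_derivative_subset[OF assms(1)[unfolded has_field_derivative_def] assms(2)]])

lemma stenzel_dom_norm: "(\<lambda>z. (norm z)\<^sup>2) ` stenzel_dom \<subseteq> {1..}"
  by (auto simp: stenzel_dom_def)

lemma wirt_bar_stenzel:
  assumes "\<kappa> > 0" "z \<in> stenzel_dom"
  shows "wirt_bar stenzel_dom k (\<lambda>z. of_real (stenzel_u \<kappa> ((norm z)\<^sup>2))) z = of_real (stenzel_u' \<kappa> ((norm z)\<^sup>2)) * z$k"
proof -
  have t: "(norm z)\<^sup>2 \<ge> 1" using assms(2) by (simp add: stenzel_dom_def)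
  have "((\<lambda>z. complex_of_real (stenzel_u \<kappa> ((norm z)\<^sup>2))) has_derivative
      (\<lambda>v. of_real (stenzel_p \<kappa> ((norm z)\<^sup>2) * (2 * (z \<bullet> v))))) (at z within stenzel_dom)"
    by (rule has_derivative_of_real[OF radial_has_derivative[OF stenzel_u_deriv[OF assms(1) t] stenzel_dom_norm]])
  note D = frechet_derivative_stenzel_dom[OF assms(2) this]
  show ?thesis
    unfolding wirt_bar_def D
    by (simp add: inner_axis stenzel_u'_eq[OF assms(1) t] complex_eq_iff)
qed

lemma wirt_wirt_bar_stenzel:
  assumes "\<kappa> > 0" "z \<in> stenzel_dom"
    and der: "(stenzel_u' \<kappa> has_real_derivative q) (at ((norm z)\<^sup>2) within {1..})"
  shows "wirt stenzel_dom j (wirt_bar stenzel_dom k (\<lambda>z. of_real (stenzel_u \<kappa> ((norm z)\<^sup>2)))) z =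
    of_real q * (cnj (z$j) * z$k) + (if j = k then of_real (stenzel_u' \<kappa> ((norm z)\<^sup>2)) else 0)"
proof -
  let ?p = "stenzel_u' \<kappa> ((norm z)\<^sup>2)"
  have "((\<lambda>z. complex_of_real (stenzel_u' \<kappa> ((norm z)\<^sup>2)) * z$k) has_derivative
      (\<lambda>v. of_real ?p * v$k + of_real (q * (2 * (z \<bullet> v))) * z$k)) (at z within stenzel_dom)"
    by (rule has_derivative_mult[OF has_derivative_of_real[OF radial_has_derivative[OF der stenzel_dom_norm]]
          bounded_linear_imp_has_derivative[OF bounded_linear_vec_nth]])
  then have "(wirt_bar stenzel_dom k (\<lambda>z. of_real (stenzel_u \<kappa> ((norm z)\<^sup>2))) has_derivative
      (\<lambda>v. of_real ?p * v$k + of_real (q * (2 * (z \<bullet> v))) * z$k)) (at z within stenzel_dom)"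
    by (rule has_derivative_transform[OF assms(2), rotated]) (rule wirt_bar_stenzel[OF assms(1)])
  note D = frechet_derivative_stenzel_dom[OF assms(2) this]
  have "axis j x $ k = (if j = k then x else 0)" for x :: complex by (simp add: axis_def)
  then show ?thesis
    unfolding wirt_def D by (simp add: inner_axis complex_eq_iff field_simps)
qed

text \<open>The factor -2 arises because x - cnj x = 2 i Im x is multiplied by another i.\<close>

lemma omega_St_kahler:
  assumes "\<kappa> > 0" "z \<in> stenzel_dom"
    and der: "(stenzel_u' \<kappa> has_real_derivative q) (at ((norm z)\<^sup>2) within {1..})"
  shows "omega_St \<kappa> z v w = of_real (- 2 * kahler (stenzel_u' \<kappa> ((norm z)\<^sup>2)) q z v w)"
proof -
  let ?p = "stenzel_u' \<kappa> ((norm z)\<^sup>2)"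
  have "omega_St \<kappa> z v w = \<i> * (\<Sum>j\<in>UNIV. \<Sum>k\<in>UNIV.
      of_real q * (cnj (z$j) * z$k) * (v$j * cnj (w$k) - w$j * cnj (v$k)) +
      (if j = k then of_real ?p else 0) * (v$j * cnj (w$k) - w$j * cnj (v$k)))"
    unfolding omega_St_def i_del_delbar_def wirt_wirt_bar_stenzel[OF assms] by (simp only: distrib_right)
  also have "\<dots> = \<i> * (of_real ?p * (herm v w - herm w v) + of_real q * (herm v z * herm z w - herm w z * herm z v))"
  proof -
    have "(\<Sum>j\<in>UNIV. \<Sum>k\<in>UNIV. (if j = k then of_real ?p else 0) * (v$j * cnj (w$k) - w$j * cnj (v$k)))
        = of_real ?p * (herm v w - herm w v)"
      by (simp add: if_distrib[where f = "\<lambda>x. x * _"] herm_def right_diff_distrib sum_subtractf sum_distrib_left cong: if_cong)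
    moreover have "(\<Sum>j\<in>UNIV. \<Sum>k\<in>UNIV. of_real q * (cnj (z$j) * z$k) * (v$j * cnj (w$k) - w$j * cnj (v$k)))
        = of_real q * (herm v z * herm z w - herm w z * herm z v)"
    proof -
      have "herm v z * herm z w - herm w z * herm z v =
          (\<Sum>j\<in>UNIV. \<Sum>k\<in>UNIV. (cnj (z$j) * z$k) * (v$j * cnj (w$k) - w$j * cnj (v$k)))"
        unfolding herm_def sum_product sum_subtractf[symmetric] by (intro sum.cong refl) (simp add: algebra_simps)
      then show ?thesis by (simp add: sum_distrib_left mult.assoc)
    qed
    ultimately show ?thesis by (simp add: sum.distrib)
  qed
  also have "\<dots> = of_real (- 2 * kahler ?p q z v w)"
    unfolding kahler_def herm_swap[of v w, symmetric] herm_swap[of v z, symmetric] herm_swap[of w z, symmetric]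
    by (simp add: complex_eq_iff algebra_simps)
  finally show ?thesis .
qed

section \<open>Differentials of the defining functions and regularity of the free locus\<close>

lemma m_has_derivative:
  "(m1 has_derivative (\<lambda>w. Im (w$0 * cnj (z$1) + z$0 * cnj (w$1)))) (at z within S)"
  "(m2 has_derivative (\<lambda>w. Im (w$2 * cnj (z$3) + z$2 * cnj (w$3)))) (at z within S)"
  unfolding m1_def m2_def
  by (auto intro!: derivative_eq_intros bounded_linear_imp_has_derivative[OF bounded_linear_vec_nth] simp: add.commute)

lemma mu_has_derivative:
  fixes P :: "real \<Rightarrow> real"
  assumes "(P has_real_derivative q) (at ((norm z)\<^sup>2) within T)" "(\<lambda>z. (norm z)\<^sup>2) ` S \<subseteq> T"
  shows "((\<lambda>z. P ((norm z)\<^sup>2) * m1 z) has_derivative kahler (P ((norm z)\<^sup>2)) q z (X1 z)) (at z within S)"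
    "((\<lambda>z. P ((norm z)\<^sup>2) * m2 z) has_derivative kahler (P ((norm z)\<^sup>2)) q z (X2 z)) (at z within S)"
proof -
  note d = has_derivative_mult[OF radial_has_derivative[OF assms]]
  show "((\<lambda>z. P ((norm z)\<^sup>2) * m1 z) has_derivative kahler (P ((norm z)\<^sup>2)) q z (X1 z)) (at z within S)"
    by (rule has_derivative_eq_rhs[OF d[OF m_has_derivative(1)]]) (simp add: fun_eq_iff kahler_X)
  show "((\<lambda>z. P ((norm z)\<^sup>2) * m2 z) has_derivative kahler (P ((norm z)\<^sup>2)) q z (X2 z)) (at z within S)"
    by (rule has_derivative_eq_rhs[OF d[OF m_has_derivative(2)]]) (simp add: fun_eq_iff kahler_X)
qed

lemma cdot_has_derivative: "((\<lambda>z. cdot z z) has_derivative (\<lambda>w. 2 * cdot z w)) (at z within S)"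
  unfolding cdot_def
  by (auto intro!: derivative_eq_intros bounded_linear_imp_has_derivative[OF bounded_linear_vec_nth] simp: fun_eq_iff)

definition m3 :: "complex^4 \<Rightarrow> real" where "m3 z = Im ((z$0)\<^sup>2 + (z$1)\<^sup>2)"

lemma m3_has_derivative: "(m3 has_derivative (\<lambda>w. 2 * Im (z$0 * w$0 + z$1 * w$1))) (at z within S)"
  unfolding m3_def power2_eq_square
  by (auto intro!: derivative_eq_intros bounded_linear_imp_has_derivative[OF bounded_linear_vec_nth] simp: fun_eq_iff)

lemma T2_locus_iff:
  "z \<in> T2_locus \<kappa> c1 c2 c3 \<longleftrightarrow> z \<in> Q \<and> stenzel_u' \<kappa> ((norm z)\<^sup>2) * m1 z = c1 \<and>
     stenzel_u' \<kappa> ((norm z)\<^sup>2) * m2 z = c2 \<and> m3 z = c3"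
  by (simp add: T2_locus_def m1_def m2_def m3_def)

text \<open>\<open>F\<close> need only be differentiable within \<open>Z\<close>: a curve in
  \<open>L\<close> stays in \<open>Z\<close>, and its parameter 0 is interior, so differentiating
  the constant \<open>F (\<gamma> s)\<close> is legitimate even on the boundary of
  \<open>stenzel_dom\<close>.\<close>

lemma tangent_space_level:
  assumes "w \<in> tangent_space L z" "L \<subseteq> Z" "(F has_derivative F') (at z within Z)" "\<And>x. x \<in> L \<Longrightarrow> F x = c"
  shows "F' w = 0"
proof -
  obtain \<epsilon> \<gamma> where g: "\<epsilon> > 0" "\<And>s. s \<in> {-\<epsilon><..<\<epsilon>} \<Longrightarrow> \<gamma> s \<in> L" "\<gamma> 0 = z"
    "(\<gamma> has_vector_derivative w) (at 0)" using tangent_spaceE[OF assms(1)] by blast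
  let ?I = "{-\<epsilon><..<\<epsilon>}"
  have o: "open ?I" "0 \<in> ?I" using g(1) by auto
  have "(\<gamma> has_derivative (\<lambda>h. h *\<^sub>R w)) (at 0 within ?I)"
    using g(4) unfolding has_vector_derivative_def by (rule has_derivative_at_withinI)
  moreover have "(F has_derivative F') (at (\<gamma> 0) within \<gamma> ` ?I)"
    unfolding g(3) by (rule has_derivative_subset[OF assms(3)]) (use g(2) assms(2) in blast)
  ultimately have "((\<lambda>s. F (\<gamma> s)) has_derivative (\<lambda>h. F' (h *\<^sub>R w))) (at 0 within ?I)"
    by (rule has_derivative_in_compose)
  then have "((\<lambda>s. F (\<gamma> s)) has_derivative (\<lambda>h. F' (h *\<^sub>R w))) (at 0)"
    using at_within_open[OF o(2,1)] by simp
  moreover have "((\<lambda>s. F (\<gamma> s)) has_derivative (\<lambda>h. 0)) (at 0)"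
    by (rule has_derivative_transform_within_open[OF has_derivative_const[of c] o]) (simp add: assms(4) g(2))
  ultimately have "(\<lambda>h::real. F' (h *\<^sub>R w)) = (\<lambda>h. 0)" by (rule has_derivative_unique)
  from fun_cong[OF this, of 1] show ?thesis by simp
qed

lemma tangent_space_Q:
  assumes "w \<in> tangent_space L z" "L \<subseteq> Q"
  shows "cdot z w = 0"
proof -
  have "2 * cdot z w = 0"
    by (rule tangent_space_level[OF assms(1) subset_UNIV cdot_has_derivative])
      (use assms(2) Q_iff_cdot in blast)
  then show ?thesis by simp
qed

lemma smooth_on_norm_sq: "open S \<Longrightarrow> smooth_on S (\<lambda>z::'a::euclidean_space. (norm z)\<^sup>2)"
  unfolding power2_norm_eq_inner by (rule smooth_on_inner_self)

lemma smooth_on_coordinate_mult: "open S \<Longrightarrow> smooth_on S (\<lambda>z::complex^4. z$i * z$j)"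
  by (intro smooth_on_bilinear[OF _ bounded_bilinear_mult] smooth_on_linear bounded_linear_vec_nth)

lemma smooth_on_coordinate_cnj: "open S \<Longrightarrow> smooth_on S (\<lambda>z::complex^4. Im (z$i * cnj (z$j)))"
  by (intro smooth_on_bounded_linear[OF _ bounded_linear_Im] smooth_on_bilinear[OF _ bounded_bilinear_mult]
      smooth_on_linear smooth_on_bounded_linear[OF _ bounded_linear_cnj] bounded_linear_vec_nth)

text \<open>\<open>P\<close> and \<open>T\<close> are general because two cases are needed: the
  constant 1 on \<open>UNIV\<close>, and u' on \<open>{1<..}\<close>, where it is smooth. One
  complex and three real equations cut real dimension 8 down to 3.\<close>

lemma regular_locus_submanifold:
  fixes P :: "real \<Rightarrow> real"
  assumes "open T" "smooth_on T P"
    and pos: "\<And>t. t \<in> T \<Longrightarrow> t \<ge> 1 \<Longrightarrow> P t > 0"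
    and der: "\<And>t. t \<in> T \<Longrightarrow> t \<ge> 1 \<Longrightarrow> (P has_real_derivative q t) (at t)"
    and radial: "\<And>t. t \<in> T \<Longrightarrow> t \<ge> 1 \<Longrightarrow> t * P t + (t\<^sup>2 - 1) * q t > 0"
  shows "smooth_submanifold 3 {z. (norm z)\<^sup>2 \<in> T \<and> n1 z > 0 \<and> n2 z > 0 \<and> z \<in> Q \<and>
      P ((norm z)\<^sup>2) * m1 z = c1 \<and> P ((norm z)\<^sup>2) * m2 z = c2 \<and> m3 z = c3}"
proof -
  define U where "U = {z::complex^4. (norm z)\<^sup>2 \<in> T \<and> n1 z > 0 \<and> n2 z > 0}"
  define G where "G z = (cdot z z, P ((norm z)\<^sup>2) * m1 z, P ((norm z)\<^sup>2) * m2 z, m3 z)" for z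
  have "U = (\<lambda>z. (norm z)\<^sup>2) -` T \<inter> {z. n1 z > 0} \<inter> {z. n2 z > 0}" by (auto simp: U_def)
  moreover have "open ((\<lambda>z::complex^4. (norm z)\<^sup>2) -` T)" by (intro open_vimage assms continuous_intros)
  moreover have "open {z. n1 z > 0}" "open {z. n2 z > 0}"
    unfolding n1_def n2_def by (intro open_Collect_less continuous_intros)+
  ultimately have oU: "open U" by (simp add: open_Int)
  have smP: "smooth_on U (\<lambda>z. P ((norm z)\<^sup>2))"
    by (rule smooth_on_compose[OF oU assms(1) _ smooth_on_norm_sq[OF oU] assms(2)]) (auto simp: U_def)
  have "smooth_on U (\<lambda>z. cdot z z)" "smooth_on U m3"
    unfolding cdot_def m3_def power2_eq_square
    by (intro smooth_on_add oU smooth_on_coordinate_mult smooth_on_bounded_linear[OF _ bounded_linear_Im])+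
  moreover have "smooth_on U m1" "smooth_on U m2"
    unfolding m1_def m2_def by (intro smooth_on_coordinate_cnj oU)+
  ultimately have smG: "smooth_on U G"
    unfolding G_def by (intro smooth_on_Pair smooth_on_bilinear[OF oU bounded_bilinear_mult] smP oU)
  have "smooth_submanifold 3 {z \<in> U. G z = (1, c1, c2, c3)}"
  proof (rule smooth_submanifold_level_set[OF oU smG])
    show "DIM(complex^4) = 3 + DIM(complex \<times> real \<times> real \<times> real)" by simp
    fix z assume z: "z \<in> U" "G z = (1, c1, c2, c3)"
    let ?t = "(norm z)\<^sup>2"
    have zQ: "z \<in> Q" using z(2) by (simp add: G_def Q_iff_cdot)
    have t: "?t \<in> T" "?t \<ge> 1" using z(1) n_sum_ge_1[OF zQ] by (simp_all add: U_def norm_sq_n)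
    interpret free_point z "P ?t" "q ?t"
      by unfold_locales (use zQ pos[OF t] radial[OF t] z(1) in \<open>simp_all add: U_def\<close>)
    have "(G has_derivative (\<lambda>w. (2 * cdot z w, kahler (P ?t) (q ?t) z (X1 z) w, kahler (P ?t) (q ?t) z (X2 z) w,
        2 * Im (z$0 * w$0 + z$1 * w$1)))) (at z)"
      unfolding G_def
      by (intro has_derivative_Pair cdot_has_derivative m3_has_derivative mu_has_derivative[where T = UNIV] der[OF t]) auto
    from frechet_derivative_at[OF this]
    have D: "frechet_derivative G (at z) = (\<lambda>w. (2 * cdot z w, kahler (P ?t) (q ?t) z (X1 z) w, kahler (P ?t) (q ?t) z (X2 z) w,
        2 * Im (z$0 * w$0 + z$1 * w$1)))" by simp
    show "surj (frechet_derivative G (at z))"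
      unfolding D surj_def
    proof
      fix y :: "complex \<times> real \<times> real \<times> real"
      obtain c r1 r2 r3 where y: "y = (c, r1, r2, r3)" by (metis prod_cases4)
      show "\<exists>w. y = (2 * cdot z w, kahler (P ?t) (q ?t) z (X1 z) w, kahler (P ?t) (q ?t) z (X2 z) w,
          2 * Im (z$0 * w$0 + z$1 * w$1))"
        using differential_surj[of c r1 r2 r3] unfolding y by auto
    qed
  qed
  moreover have "{z \<in> U. G z = (1, c1, c2, c3)} = {z. (norm z)\<^sup>2 \<in> T \<and> n1 z > 0 \<and> n2 z > 0 \<and> z \<in> Q \<and>
      P ((norm z)\<^sup>2) * m1 z = c1 \<and> P ((norm z)\<^sup>2) * m2 z = c2 \<and> m3 z = c3}"
    by (auto simp: U_def G_def Q_iff_cdot)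
  ultimately show ?thesis by simp
qed

section \<open>Stabilizers of the torus action\<close>

lemma act_torus_mat:
  "act (torus_mat a b) z = vec4
     (of_real (cos a) * z$0 - of_real (sin a) * z$1) (of_real (sin a) * z$0 + of_real (cos a) * z$1)
     (of_real (cos b) * z$2 - of_real (sin b) * z$3) (of_real (sin b) * z$2 + of_real (cos b) * z$3)"
  unfolding vec4_eq_iff
  by (simp add: act_def torus_mat_def map_matrix_def matrix_vector_mult_def sum_4')

lemma torus_mat_in_maximal_torus: "torus_mat a b \<in> maximal_torus"
proof -
  have "\<exists>x\<in>{0..<2*pi}. cos x = cos a \<and> sin x = sin a" for a :: real
    using sincos_total_2pi[of "cos a" "sin a"] by (metis atLeastLessThan_iff sin_cos_squared_add2)
  then obtain x y where xy: "x \<in> {0..<2*pi}" "y \<in> {0..<2*pi}" "cos x = cos a" "sin x = sin a" "cos y = cos b" "sin y = sin b"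
    by metis
  have "torus_mat x y = torus_mat a b" unfolding torus_mat_def xy(3-6) ..
  then show ?thesis using xy(1,2) unfolding maximal_torus_def by (metis (mono_tags, lifting) mem_Collect_eq)
qed

text \<open>A rotation other than the identity fixes no nonzero vector of C^2, since the determinant
  of R - 1 is (cos a - 1)^2 + (sin a)^2. Conversely, if one part of \<open>z\<close> vanishes,
  rotating that part by \<open>pi\<close> fixes \<open>z\<close>.\<close>

lemma Q_free_iff: "z \<in> Q_free \<longleftrightarrow> z \<in> Q \<and> n1 z > 0 \<and> n2 z > 0"
proof -
  have 0: "torus_mat a b = mat 1 \<longleftrightarrow> cos a = 1 \<and> sin a = 0 \<and> cos b = 1 \<and> sin b = 0" for a b
    by (auto simp: torus_mat_def mat_def vec_eq_iff forall_4')
  have n0: "n1 z > 0 \<longleftrightarrow> z$0 \<noteq> 0 \<or> z$1 \<noteq> 0" "n2 z > 0 \<longleftrightarrow> z$2 \<noteq> 0 \<or> z$3 \<noteq> 0"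
    by (auto simp: n1_def n2_def sum_power2_gt_zero_iff)
  have rot: "cos a = 1 \<and> sin a = 0"
    if "of_real (cos a) * x - of_real (sin a) * y = x" "of_real (sin a) * x + of_real (cos a) * y = y" "x \<noteq> 0 \<or> y \<noteq> 0"
    for a :: real and x y :: complex
  proof -
    let ?c = "complex_of_real (cos a) - 1" and ?s = "complex_of_real (sin a)"
    have "?c * x = (of_real (cos a) * x - ?s * y) - x + ?s * y" by (simp add: algebra_simps)
    then have e1: "?c * x = ?s * y" unfolding that(1) by simp
    have "?c * y = (?s * x + of_real (cos a) * y) - y - ?s * x" by (simp add: algebra_simps)
    then have e2: "?c * y = - (?s * x)" unfolding that(2) by simp
    have "(?c * ?c + ?s * ?s) * x = ?c * (?c * x) + ?s * (?s * x)" by (simp only: distrib_right mult.assoc)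
    also have "\<dots> = ?s * (?c * y) + ?s * (?s * x)" unfolding e1 by (simp only: mult.left_commute)
    also have "\<dots> = 0" unfolding e2 by simp
    finally have "(?c * ?c + ?s * ?s) * x = 0" .
    moreover have "(?c * ?c + ?s * ?s) * y = ?c * (?c * y) + ?s * (?s * y)" by (simp only: distrib_right mult.assoc)
    then have "(?c * ?c + ?s * ?s) * y = - (?s * (?c * x)) + ?s * (?s * y)" unfolding e2 by (simp only: mult.left_commute mult_minus_right)
    then have "(?c * ?c + ?s * ?s) * y = 0" unfolding e1 by simp
    ultimately have "?c * ?c + ?s * ?s = 0" using that(3) by auto
    then have "of_real ((cos a - 1)\<^sup>2 + (sin a)\<^sup>2) = (0::complex)" by (simp add: power2_eq_square)
    then have "(cos a - 1)\<^sup>2 + (sin a)\<^sup>2 = 0" unfolding of_real_eq_0_iff .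
    then show ?thesis by (simp add: sum_power2_eq_zero_iff)
  qed
  show ?thesis
  proof
    assume z: "z \<in> Q_free"
    have "n1 z > 0"
    proof (rule ccontr)
      assume "\<not> n1 z > 0"
      then have "act (torus_mat pi 0) z = z" using n0 by (simp add: act_torus_mat vec4_eq_iff)
      then show False using z torus_mat_in_maximal_torus[of pi 0] 0[of pi 0] unfolding Q_free_def by auto
    qed
    moreover have "n2 z > 0"
    proof (rule ccontr)
      assume "\<not> n2 z > 0"
      then have "act (torus_mat 0 pi) z = z" using n0 by (simp add: act_torus_mat vec4_eq_iff)
      then show False using z torus_mat_in_maximal_torus[of 0 pi] 0[of 0 pi] unfolding Q_free_def by auto
    qed
    ultimately show "z \<in> Q \<and> n1 z > 0 \<and> n2 z > 0" using z by (simp add: Q_free_def)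
  next
    assume z: "z \<in> Q \<and> n1 z > 0 \<and> n2 z > 0"
    have "g = mat 1" if g: "g \<in> maximal_torus" "act g z = z" for g
    proof -
      obtain a b where ab: "g = torus_mat a b" using g(1) by (auto simp: maximal_torus_def)
      have "of_real (cos a) * z$0 - of_real (sin a) * z$1 = z$0" "of_real (sin a) * z$0 + of_real (cos a) * z$1 = z$1"
        "of_real (cos b) * z$2 - of_real (sin b) * z$3 = z$2" "of_real (sin b) * z$2 + of_real (cos b) * z$3 = z$3"
        using g(2) unfolding ab act_torus_mat by (metis vec4_nth)+
      then show ?thesis using rot z unfolding ab 0 n0 by blast
    qed
    then show "z \<in> Q_free" using z by (simp add: Q_free_def)
  qed
qed

lemma T2_locus_Q_free_submanifold:
  assumes "\<kappa> > 0"
  shows "smooth_submanifold 3 (T2_locus \<kappa> c1 c2 c3 \<inter> Q_free)"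
proof (cases "c1 = 0 \<and> c2 = 0")
  case True
  have "smooth_submanifold 3 {z. (norm z)\<^sup>2 \<in> UNIV \<and> n1 z > 0 \<and> n2 z > 0 \<and> z \<in> Q \<and> 1 * m1 z = 0 \<and> 1 * m2 z = 0 \<and> m3 z = c3}"
    by (rule regular_locus_submanifold[where q = "\<lambda>_. 0" and P = "\<lambda>_. 1"]) (auto intro: smooth_on_const)
  moreover have "stenzel_u' \<kappa> ((norm z)\<^sup>2) \<noteq> 0" if "z \<in> Q" for z
    using stenzel_p_pos[OF assms, of "(norm z)\<^sup>2"] stenzel_u'_eq[OF assms, of "(norm z)\<^sup>2"] n_sum_ge_1[OF that]
    by (simp add: norm_sq_n)
  ultimately show ?thesis
    using True by (auto simp: T2_locus_iff Q_free_iff elim!: back_subst[where P = "smooth_submanifold 3"])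
next
  case False
  obtain p' where p': "\<And>t. t \<ge> 1 \<Longrightarrow> (stenzel_u' \<kappa> has_real_derivative p' t) (at t within {1..})"
    "\<And>t. t \<ge> 1 \<Longrightarrow> t * stenzel_u' \<kappa> t + (t\<^sup>2 - 1) * p' t > 0" using stenzel_u'_derivative[OF assms] by blast
  have "smooth_submanifold 3 {z. (norm z)\<^sup>2 \<in> {1<..} \<and> n1 z > 0 \<and> n2 z > 0 \<and> z \<in> Q \<and>
      stenzel_u' \<kappa> ((norm z)\<^sup>2) * m1 z = c1 \<and> stenzel_u' \<kappa> ((norm z)\<^sup>2) * m2 z = c2 \<and> m3 z = c3}"
  proof (rule regular_locus_submanifold[where q = p'])
    show "open {1::real<..}" by simp
    then show "smooth_on {1<..} (stenzel_u' \<kappa>)"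
      using smooth_on_stenzel_p[OF assms] smooth_on_cong[of "{1<..}" "stenzel_u' \<kappa>" "stenzel_p \<kappa>"]
        stenzel_u'_eq[OF assms] by simp
    fix t :: real assume t: "t \<in> {1<..}" "t \<ge> 1"
    show "stenzel_u' \<kappa> t > 0" using stenzel_p_pos[OF assms t(2)] stenzel_u'_eq[OF assms t(2)] by simp
    show "t * stenzel_u' \<kappa> t + (t\<^sup>2 - 1) * p' t > 0" by (rule p'(2)[OF t(2)])
    have "t \<in> interior {1..}" using t(1) by simp
    then show "(stenzel_u' \<kappa> has_real_derivative p' t) (at t)" using p'(1)[OF t(2)] at_within_interior by metis
  qed
  moreover have "(norm z)\<^sup>2 > 1" if "z \<in> T2_locus \<kappa> c1 c2 c3" for z
  proof -
    have "n1 z + n2 z \<noteq> 1" using zero_section_m[of z] that False by (auto simp: T2_locus_iff)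
    then show ?thesis using n_sum_ge_1[of z] that by (simp add: norm_sq_n T2_locus_iff)
  qed
  moreover have "T2_locus \<kappa> c1 c2 c3 \<inter> Q_free = {z. z \<in> T2_locus \<kappa> c1 c2 c3 \<and> n1 z > 0 \<and> n2 z > 0}"
    by (auto simp: Q_free_iff T2_locus_iff)
  ultimately show ?thesis
    by (auto simp: T2_locus_iff elim!: back_subst[where P = "smooth_submanifold 3"])
qed

section \<open>Special Lagrangian submanifolds\<close>

lemma rotation_invariants:
  fixes x y :: complex and c s :: real
  defines "x' \<equiv> of_real c * x - of_real s * y" and "y' \<equiv> of_real s * x + of_real c * y"
  assumes cs: "c\<^sup>2 + s\<^sup>2 = 1"
  shows "(norm x')\<^sup>2 + (norm y')\<^sup>2 = (norm x)\<^sup>2 + (norm y)\<^sup>2" "Im (x' * cnj y') = Im (x * cnj y)"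
    "x'\<^sup>2 + y'\<^sup>2 = x\<^sup>2 + y\<^sup>2"
proof -
  have "(norm x')\<^sup>2 + (norm y')\<^sup>2 = (c\<^sup>2 + s\<^sup>2) * ((norm x)\<^sup>2 + (norm y)\<^sup>2)"
    unfolding x'_def y'_def cmod_power2 by (simp add: power2_eq_square algebra_simps)
  then show "(norm x')\<^sup>2 + (norm y')\<^sup>2 = (norm x)\<^sup>2 + (norm y)\<^sup>2" unfolding cs by simp
  have "Im (x' * cnj y') = (c\<^sup>2 + s\<^sup>2) * Im (x * cnj y)"
    unfolding x'_def y'_def by (simp add: power2_eq_square algebra_simps)
  then show "Im (x' * cnj y') = Im (x * cnj y)" unfolding cs by simp
  have "x'\<^sup>2 + y'\<^sup>2 = of_real (c\<^sup>2 + s\<^sup>2) * (x\<^sup>2 + y\<^sup>2)"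
    unfolding x'_def y'_def by (simp add: power2_eq_square algebra_simps)
  then show "x'\<^sup>2 + y'\<^sup>2 = x\<^sup>2 + y\<^sup>2" unfolding cs by simp
qed

lemma T2_locus_torus_invariant: "torus_invariant (T2_locus \<kappa> c1 c2 c3)"
  unfolding torus_invariant_def
proof (intro ballI image_subsetI)
  fix g z assume g: "g \<in> maximal_torus" and z: "z \<in> T2_locus \<kappa> c1 c2 c3"
  obtain a b where ab: "g = torus_mat a b" using g by (auto simp: maximal_torus_def)
  let ?z = "act (torus_mat a b) z"
  have n: "n1 ?z = n1 z" "n2 ?z = n2 z" and m: "m1 ?z = m1 z" "m2 ?z = m2 z"
    by (simp_all only: n1_def n2_def m1_def m2_def act_torus_mat vec4_nth rotation_invariants[OF sin_cos_squared_add2])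
  have s: "(?z$0)\<^sup>2 + (?z$1)\<^sup>2 = (z$0)\<^sup>2 + (z$1)\<^sup>2" "(?z$2)\<^sup>2 + (?z$3)\<^sup>2 = (z$2)\<^sup>2 + (z$3)\<^sup>2"
    by (simp_all only: act_torus_mat vec4_nth rotation_invariants[OF sin_cos_squared_add2])
  have "z \<in> Q" using z by (simp add: T2_locus_iff)
  then have "((?z$0)\<^sup>2 + (?z$1)\<^sup>2) + ((?z$2)\<^sup>2 + (?z$3)\<^sup>2) = 1"
    unfolding s by (simp add: Q_def add.assoc)
  then have "?z \<in> Q" by (simp add: Q_def add.assoc)
  then show "act g z \<in> T2_locus \<kappa> c1 c2 c3"
    using z unfolding ab T2_locus_iff norm_sq_n n m m3_def s by blast
qed

text \<open>The family is closed under differentiation, with (A, B, C) replaced by (B, -A, 0) up to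
  a factor, so the induction needs all coefficients arbitrary.\<close>

lemma Ck_on_cos_sin: "Ck_on k S (\<lambda>x. cos x *\<^sub>R A + sin x *\<^sub>R B + C)"
  if "open S" for A B C :: "'a::euclidean_space" and S :: "real set"
proof (induction k arbitrary: A B C)
  case 0
  show ?case by (simp add: continuous_intros)
next
  case (Suc k)
  show ?case
  proof (rule Ck_on_SucI[OF that])
    fix x :: real
    show "((\<lambda>x. cos x *\<^sub>R A + sin x *\<^sub>R B + C) has_derivative (\<lambda>v. cos x *\<^sub>R (v *\<^sub>R B) + sin x *\<^sub>R (v *\<^sub>R (- A)) + 0)) (at x)"
      by (auto intro!: derivative_eq_intros simp: algebra_simps)
  next
    fix v :: real
    show "Ck_on k S (\<lambda>x. cos x *\<^sub>R (v *\<^sub>R B) + sin x *\<^sub>R (v *\<^sub>R (- A)) + 0)" by (rule Suc)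
  qed
qed

lemma rotation_tangent:
  fixes L :: "'a::euclidean_space set"
  assumes "\<And>s. cos s *\<^sub>R A + sin s *\<^sub>R B + C \<in> L"
  shows "B \<in> tangent_space L (A + C)"
proof -
  define \<gamma> where "\<gamma> s = cos s *\<^sub>R A + sin s *\<^sub>R B + C" for s
  have "smooth_on {-1<..<1} \<gamma>"
    unfolding smooth_on_def \<gamma>_def by (intro allI Ck_on_cos_sin) simp
  moreover have "(\<gamma> has_vector_derivative B) (at 0)"
    unfolding \<gamma>_def has_vector_derivative_def by (auto intro!: derivative_eq_intros)
  moreover have "\<gamma> ` {-1<..<1} \<subseteq> L" using assms by (auto simp: \<gamma>_def)
  moreover have "\<gamma> 0 = A + C" by (simp add: \<gamma>_def)
  ultimately show ?thesis unfolding tangent_space_def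
    by - (rule CollectI, rule exI[of _ 1], rule exI[of _ \<gamma>], simp)
qed

lemma generators_tangent:
  assumes "torus_invariant L" "z \<in> L"
  shows "X1 z \<in> tangent_space L z" "X2 z \<in> tangent_space L z"
proof -
  have L: "act (torus_mat a b) z \<in> L" for a b
    using assms torus_mat_in_maximal_torus unfolding torus_invariant_def by blast
  let ?A = "vec4 (z$0) (z$1) 0 0" and ?C = "vec4 0 0 (z$2) (z$3)"
  have z: "?A + ?C = z" "?C + ?A = z" by (simp_all add: vec4_eq_iff)
  have "cos s *\<^sub>R ?A + sin s *\<^sub>R X1 z + ?C = act (torus_mat s 0) z"
    "cos s *\<^sub>R ?C + sin s *\<^sub>R X2 z + ?A = act (torus_mat 0 s) z" for s
    unfolding act_torus_mat by (simp_all add: vec4_eq_iff X1_def X2_def scaleR_complex)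
  then have "cos s *\<^sub>R ?A + sin s *\<^sub>R X1 z + ?C \<in> L" "cos s *\<^sub>R ?C + sin s *\<^sub>R X2 z + ?A \<in> L" for s
    using L by metis+
  from rotation_tangent[OF this(1)] rotation_tangent[OF this(2)]
  show "X1 z \<in> tangent_space L z" "X2 z \<in> tangent_space L z" by (simp_all only: z)
qed

text \<open>Both functions are homogeneous quadratic in the two coordinates that vanish at
  \<open>z\<close>. Divided by s^2 along a curve they tend to their values at the velocity
  \<open>w\<close>.\<close>

lemma tangent_second_order:
  fixes L :: "(complex^4) set"
  assumes "w \<in> tangent_space L z" "z$i = 0" "z$j = 0"
    and L: "\<And>x. x \<in> L \<Longrightarrow> Im (x$i * cnj (x$j)) = 0" "\<And>x. x \<in> L \<Longrightarrow> Im ((x$i)\<^sup>2 + (x$j)\<^sup>2) = 0"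
  shows "Im (w$i * cnj (w$j)) = 0" "Im ((w$i)\<^sup>2 + (w$j)\<^sup>2) = 0"
proof -
  obtain \<epsilon> \<gamma> where g: "\<epsilon> > 0" "\<And>s. s \<in> {-\<epsilon><..<\<epsilon>} \<Longrightarrow> \<gamma> s \<in> L" "\<gamma> 0 = z"
    "(\<gamma> has_vector_derivative w) (at 0)" using tangent_spaceE[OF assms(1)] by blast
  define f where "f s k = ((\<gamma> s - \<gamma> 0) /\<^sub>R s)$k" for s k
  have lim: "((\<lambda>s. f s k) \<longlongrightarrow> w$k) (at 0)" for k
    unfolding f_def by (rule tendsto_vec_nth[OF has_vector_derivative_quotient[OF g(4)]])
  have fij: "f s i = inverse s *\<^sub>R (\<gamma> s$i)" "f s j = inverse s *\<^sub>R (\<gamma> s$j)" for s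
    using assms(2,3) by (simp_all add: f_def g(3))
  have ev: "\<forall>\<^sub>F s in at 0. s \<in> {-\<epsilon><..<\<epsilon>}"
    using g(1) eventually_at_in_open'[of "{-\<epsilon><..<\<epsilon>}" 0] by simp
  have "((\<lambda>s. Im (f s i * cnj (f s j))) \<longlongrightarrow> Im (w$i * cnj (w$j))) (at 0)"
    by (intro tendsto_intros lim)
  moreover have "\<forall>\<^sub>F s in at 0. Im (f s i * cnj (f s j)) \<in> {0}"
    using ev
  proof eventually_elim
    case (elim s)
    have "Im (f s i * cnj (f s j)) = (inverse s)\<^sup>2 * Im (\<gamma> s$i * cnj (\<gamma> s$j))"
      unfolding fij by (simp add: power2_eq_square algebra_simps)
    then show ?case using L(1)[OF g(2)[OF elim]] by simp
  qed
  ultimately have "Im (w$i * cnj (w$j)) \<in> {0}"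
    by (intro Lim_in_closed_set[of "{0}" _ "at (0::real)"]) auto
  then show "Im (w$i * cnj (w$j)) = 0" by simp
  have "((\<lambda>s. Im ((f s i)\<^sup>2 + (f s j)\<^sup>2)) \<longlongrightarrow> Im ((w$i)\<^sup>2 + (w$j)\<^sup>2)) (at 0)"
    by (intro tendsto_intros lim)
  moreover have "\<forall>\<^sub>F s in at 0. Im ((f s i)\<^sup>2 + (f s j)\<^sup>2) \<in> {0}"
    using ev
  proof eventually_elim
    case (elim s)
    have "Im ((f s i)\<^sup>2 + (f s j)\<^sup>2) = (inverse s)\<^sup>2 * Im ((\<gamma> s$i)\<^sup>2 + (\<gamma> s$j)\<^sup>2)"
      unfolding fij by (simp add: power2_eq_square algebra_simps)
    then show ?case using L(2)[OF g(2)[OF elim]] by simp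
  qed
  ultimately have "Im ((w$i)\<^sup>2 + (w$j)\<^sup>2) \<in> {0}"
    by (intro Lim_in_closed_set[of "{0}" _ "at (0::real)"]) auto
  then show "Im ((w$i)\<^sup>2 + (w$j)\<^sup>2) = 0" by simp
qed

text \<open>The real and the imaginary part of (a, b), as vectors of R^2, are parallel by the first
  hypothesis and orthogonal by the second, so one of them is zero.\<close>

lemma real_or_imaginary_pair:
  assumes "Im (a * cnj b) = 0" "Im (a\<^sup>2 + b\<^sup>2) = 0"
  shows "(Im a = 0 \<and> Im b = 0) \<or> (Re a = 0 \<and> Re b = 0)"
proof -
  have "Im a * Re b - Re a * Im b = 0" using assms(1) by simp
  moreover have "2 * (Re a * Im a + Re b * Im b) = 0"
    using assms(2) by (simp add: power2_eq_square algebra_simps)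
  then have "Re a * Im a + Re b * Im b = 0" by simp
  moreover have "((Re a)\<^sup>2 + (Re b)\<^sup>2) * ((Im a)\<^sup>2 + (Im b)\<^sup>2) =
      (Im a * Re b - Re a * Im b)\<^sup>2 + (Re a * Im a + Re b * Im b)\<^sup>2"
    by (simp add: power2_eq_square algebra_simps)
  ultimately have "((Re a)\<^sup>2 + (Re b)\<^sup>2) * ((Im a)\<^sup>2 + (Im b)\<^sup>2) = 0" by simp
  then show ?thesis by (auto simp: sum_power2_eq_zero_iff)
qed

text \<open>At a point with \<open>z\<^sub>0 = z\<^sub>1 = 0\<close> the first-order conditions are too weak, but the second-order ones
  force the \<open>(0, 1)\<close>-part of \<open>V\<close> into \<open>\<real>\<^sup>2 \<union> \<i>\<real>\<^sup>2\<close>, hence, \<open>V\<close> being additive, into one of the two.\<close>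

lemma circle_orbit_point:
  assumes z: "z \<in> Q" "z$0 = 0" "z$1 = 0"
    and radial: "(norm z)\<^sup>2 * p + ((norm z)^4 - 1) * q > 0"
    and add: "\<And>v w. v \<in> V \<Longrightarrow> w \<in> V \<Longrightarrow> v + w \<in> V"
    and tan: "\<And>w. w \<in> V \<Longrightarrow> cdot z w = 0" "\<And>w. w \<in> V \<Longrightarrow> kahler p q z (X2 z) w = 0"
    and sec: "\<And>w. w \<in> V \<Longrightarrow> Im (w$0 * cnj (w$1)) = 0" "\<And>w. w \<in> V \<Longrightarrow> Im ((w$0)\<^sup>2 + (w$1)\<^sup>2) = 0"
  shows "v \<in> V \<Longrightarrow> w \<in> V \<Longrightarrow> kahler p q z v w = 0"
    and "u \<in> V \<Longrightarrow> v \<in> V \<Longrightarrow> w \<in> V \<Longrightarrow> Im (Omega_St z u v w) = 0"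
proof -
  have one: "z$2 * z$2 + z$3 * z$3 = 1" using z by (simp add: Q_def power2_eq_square)
  have n: "(norm z)\<^sup>2 = n2 z" using z by (simp add: norm_sq_n n1_def)
  \<comment> \<open>At such a point |z|^4 - 1 equals 4 (m2)^2, so the radial hypothesis is exactly
    positivity of the Gram entry of \<open>X2\<close>.\<close>
  have "(n2 z)\<^sup>2 - 4 * (m2 z)\<^sup>2 = 1"
    unfolding norm_sum_squares(2)[symmetric] using one by (simp add: power2_eq_square)
  moreover have "(norm z)^4 = (n2 z)\<^sup>2"
    unfolding n[symmetric] by simp
  ultimately have pos: "p * n2 z + 4 * q * (m2 z)\<^sup>2 > 0"
    using radial unfolding n by (simp add: algebra_simps)
  \<comment> \<open>Tangency makes the (2, 3)-part a complex multiple \<open>c\<close> of that of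
    \<open>X2 z\<close>; the condition against \<open>X2 z\<close> makes \<open>c\<close>
    real.\<close>
  have "\<exists>a. w$2 = - (of_real a * z$3) \<and> w$3 = of_real a * z$2" if w: "w \<in> V" for w
  proof -
    define c where "c = z$2 * w$3 - z$3 * w$2"
    have t: "z$2 * w$2 + z$3 * w$3 = 0" using tan(1)[OF w] z by (simp add: cdot_def)
    have "- (c * z$3) = w$2 * (z$2 * z$2 + z$3 * z$3) - z$2 * (z$2 * w$2 + z$3 * w$3)"
      "c * z$2 = w$3 * (z$2 * z$2 + z$3 * z$3) - z$3 * (z$2 * w$2 + z$3 * w$3)"
      by (simp_all add: c_def algebra_simps)
    then have w23: "w$2 = - (c * z$3)" "w$3 = c * z$2" unfolding t one by simp_all
    define w' where "w' = vec4 (w$0) (w$1) 0 0"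
    have "w = w' + Re c *\<^sub>R X2 z + Im c *\<^sub>R (\<i> *s X2 z)"
      unfolding vec4_eq_iff by (simp add: w'_def X2_def w23 complex_eq_iff)
    moreover have "kahler p q z (X2 z) w' = 0"
      using z by (simp add: kahler_X w'_def inner_herm herm_4)
    moreover have "kahler p q z (X2 z) (X2 z) = 0" using kahler_swap[of p q z "X2 z" "X2 z"] by linarith
    ultimately have "kahler p q z (X2 z) w = - (Im c * (p * n2 z + 4 * q * (m2 z)\<^sup>2))"
      by (simp add: kahler_linear kahler_X_X algebra_simps)
    then have "Im c = 0" using pos tan(2)[OF w] by simp
    then have "c = of_real (Re c)" by (simp add: complex_eq_iff)
    then show ?thesis using w23 by metis
  qed
  then obtain a where a: "\<And>w. w \<in> V \<Longrightarrow> w$2 = - (of_real (a w) * z$3)" "\<And>w. w \<in> V \<Longrightarrow> w$3 = of_real (a w) * z$2"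
    by metis
  have ri: "(Im (w$0) = 0 \<and> Im (w$1) = 0) \<or> (Re (w$0) = 0 \<and> Re (w$1) = 0)" if "w \<in> V" for w
    by (rule real_or_imaginary_pair[OF sec[OF that]])
  have V: "(\<forall>w\<in>V. Im (w$0) = 0 \<and> Im (w$1) = 0) \<or> (\<forall>w\<in>V. Re (w$0) = 0 \<and> Re (w$1) = 0)"
  proof (rule ccontr)
    assume "\<not> ?thesis"
    then obtain v w where vw: "v \<in> V" "\<not> (Im (v$0) = 0 \<and> Im (v$1) = 0)" "w \<in> V" "\<not> (Re (w$0) = 0 \<and> Re (w$1) = 0)"
      by blast
    then have "Re (v$0) = 0 \<and> Re (v$1) = 0" "Im (w$0) = 0 \<and> Im (w$1) = 0" using ri by blast+
    then show False using ri[OF add[OF vw(1,3)]] vw by auto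
  qed
  {
    fix v w assume v: "v \<in> V" and w: "w \<in> V"
    have "Im (v$0 * cnj (w$0) + v$1 * cnj (w$1)) = 0" using V v w by auto
    then show "kahler p q z v w = 0"
      using z by (simp add: kahler_def herm_4 a[OF v] a[OF w] algebra_simps)
  }
  {
    fix u v w assume u: "u \<in> V" and v: "v \<in> V" and w: "w \<in> V"
    \<comment> \<open>Each term has one real factor from \<open>a\<close> and two factors from the
      (0, 1)-part. These two are both real or both imaginary, so their product is real.\<close>
    have "Omega_St z u v w = (z$2 * z$2 + z$3 * z$3) *
       (u$0 * (v$1 * of_real (a w) - of_real (a v) * w$1) - u$1 * (v$0 * of_real (a w) - of_real (a v) * w$0)
         + of_real (a u) * (v$0 * w$1 - v$1 * w$0))"
      using z by (simp add: Omega_St_eq a[OF u] a[OF v] a[OF w] algebra_simps)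
    then show "Im (Omega_St z u v w) = 0" using V u v w unfolding one by auto
  }
qed

text \<open>Reduces the points with \<open>z\<^sub>2 = z\<^sub>3 = 0\<close> to the previous lemma.\<close>

definition swap4 :: "complex^4 \<Rightarrow> complex^4" where
  "swap4 z = vec4 (z$2) (z$3) (z$0) (z$1)"

lemma swap4_invariants:
  "cdot (swap4 z) (swap4 w) = cdot z w"
  "X2 (swap4 z) = swap4 (X1 z)"
  "kahler p q (swap4 z) (swap4 v) (swap4 w) = kahler p q z v w"
  "Omega_St (swap4 z) (swap4 u) (swap4 v) (swap4 w) = Omega_St z u v w"
  "norm (swap4 z) = norm z"
  "swap4 v + swap4 w = swap4 (v + w)"
proof -
  have h: "herm (swap4 v) (swap4 w) = herm v w" for v w by (simp add: herm_4 swap4_def)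
  show "kahler p q (swap4 z) (swap4 v) (swap4 w) = kahler p q z v w" by (simp add: kahler_def h)
  show "cdot (swap4 z) (swap4 w) = cdot z w" by (simp add: cdot_def swap4_def)
  show "X2 (swap4 z) = swap4 (X1 z)" by (simp add: X1_def X2_def swap4_def)
  show "Omega_St (swap4 z) (swap4 u) (swap4 v) (swap4 w) = Omega_St z u v w"
    by (simp add: Omega_St_eq swap4_def algebra_simps)
  have "(norm (swap4 z))\<^sup>2 = (norm z)\<^sup>2" by (simp add: norm_sq_n n1_def n2_def swap4_def)
  then show "norm (swap4 z) = norm z" by simp
  show "swap4 v + swap4 w = swap4 (v + w)" by (simp add: vec4_eq_iff swap4_def)
qed

lemma circle_orbit_point':
  assumes z: "z \<in> Q" "z$2 = 0" "z$3 = 0"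
    and radial: "(norm z)\<^sup>2 * p + ((norm z)^4 - 1) * q > 0"
    and add: "\<And>v w. v \<in> V \<Longrightarrow> w \<in> V \<Longrightarrow> v + w \<in> V"
    and tan: "\<And>w. w \<in> V \<Longrightarrow> cdot z w = 0" "\<And>w. w \<in> V \<Longrightarrow> kahler p q z (X1 z) w = 0"
    and sec: "\<And>w. w \<in> V \<Longrightarrow> Im (w$2 * cnj (w$3)) = 0" "\<And>w. w \<in> V \<Longrightarrow> Im ((w$2)\<^sup>2 + (w$3)\<^sup>2) = 0"
  shows "v \<in> V \<Longrightarrow> w \<in> V \<Longrightarrow> kahler p q z v w = 0"
    and "u \<in> V \<Longrightarrow> v \<in> V \<Longrightarrow> w \<in> V \<Longrightarrow> Im (Omega_St z u v w) = 0"
proof -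
  have *: "swap4 z \<in> Q" "swap4 z$0 = 0" "swap4 z$1 = 0"
    using z by (simp_all add: Q_iff_cdot swap4_invariants) (simp_all add: swap4_def)
  note co = circle_orbit_point[OF *, of p q "swap4 ` V", unfolded swap4_invariants(5), OF radial]
  have add': "v + w \<in> swap4 ` V" if "v \<in> swap4 ` V" "w \<in> swap4 ` V" for v w
    using that add by (auto simp: swap4_invariants)
  have tan': "cdot (swap4 z) w = 0" "kahler p q (swap4 z) (X2 (swap4 z)) w = 0" if "w \<in> swap4 ` V" for w
    using that tan by (auto simp: swap4_invariants)
  have sec': "Im (w$0 * cnj (w$1)) = 0" "Im ((w$0)\<^sup>2 + (w$1)\<^sup>2) = 0" if "w \<in> swap4 ` V" for w
  proof -
    obtain x where x: "x \<in> V" "w = swap4 x" using \<open>w \<in> swap4 ` V\<close> by blast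
    then show "Im (w$0 * cnj (w$1)) = 0" "Im ((w$0)\<^sup>2 + (w$1)\<^sup>2) = 0"
      using sec[OF x(1)] by (simp_all add: swap4_def)
  qed
  note co' = co[OF add' tan' sec']
  show "v \<in> V \<Longrightarrow> w \<in> V \<Longrightarrow> kahler p q z v w = 0"
    using co'(1)[of "swap4 v" "swap4 w"] by (simp add: swap4_invariants)
  show "u \<in> V \<Longrightarrow> v \<in> V \<Longrightarrow> w \<in> V \<Longrightarrow> Im (Omega_St z u v w) = 0"
    using co'(2)[of "swap4 u" "swap4 v" "swap4 w"] by (simp add: swap4_invariants)
qed

section \<open>The two implications and openness in the free locus\<close>

lemma stenzel_u'_pos: "\<kappa> > 0 \<Longrightarrow> z \<in> Q \<Longrightarrow> stenzel_u' \<kappa> ((norm z)\<^sup>2) > 0"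
  using stenzel_p_pos[of \<kappa> "(norm z)\<^sup>2"] stenzel_u'_eq[of \<kappa> "(norm z)\<^sup>2"] n_sum_ge_1[of z]
  by (simp add: norm_sq_n)

theorem T2_locus_special_lagrangian:
  assumes "\<kappa> > 0" "smooth_submanifold 3 L" "L \<subseteq> T2_locus \<kappa> c1 c2 c3"
  shows "special_lagrangian \<kappa> L"
proof -
  obtain p' where p': "\<And>t. t \<ge> 1 \<Longrightarrow> (stenzel_u' \<kappa> has_real_derivative p' t) (at t within {1..})"
    "\<And>t. t \<ge> 1 \<Longrightarrow> t * stenzel_u' \<kappa> t + (t\<^sup>2 - 1) * p' t > 0" using stenzel_u'_derivative[OF assms(1)] by blast
  have LQ: "L \<subseteq> Q" using assms(3) by (auto simp: T2_locus_iff)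
  have Ldom: "L \<subseteq> stenzel_dom" using LQ Q_subset_stenzel_dom by blast
  have loc: "stenzel_u' \<kappa> ((norm x)\<^sup>2) * m1 x = c1" "stenzel_u' \<kappa> ((norm x)\<^sup>2) * m2 x = c2" "m3 x = c3" if "x \<in> L" for x
    using that assms(3) by (auto simp: T2_locus_iff)
  have m_zero: "m1 x = 0" if "c1 = 0" "x \<in> L" for x
    using loc(1)[OF that(2)] stenzel_u'_pos[OF assms(1), of x] that LQ by auto
  have m_zero': "m2 x = 0" if "c2 = 0" "x \<in> L" for x
    using loc(2)[OF that(2)] stenzel_u'_pos[OF assms(1), of x] that LQ by auto
  have main: "omega_St \<kappa> z v w = 0 \<and> Im (Omega_St z u v w) = 0"
    if z: "z \<in> L" and uvw: "u \<in> tangent_space L z" "v \<in> tangent_space L z" "w \<in> tangent_space L z" for z u v w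
  proof -
    let ?t = "(norm z)\<^sup>2"
    let ?p = "stenzel_u' \<kappa> ?t" and ?q = "p' ?t" and ?T = "tangent_space L z"
    have zQ: "z \<in> Q" and zdom: "z \<in> stenzel_dom" using z LQ Ldom by auto
    have t: "?t \<ge> 1" using zdom by (simp add: stenzel_dom_def)
    have pp: "?p > 0" by (rule stenzel_u'_pos[OF assms(1) zQ])
    have radial: "?t * ?p + ((norm z)^4 - 1) * ?q > 0" using p'(2)[OF t] by simp
    note mu = mu_has_derivative[OF p'(1)[OF t] stenzel_dom_norm]
    have T: "cdot z x = 0" "kahler ?p ?q z (X1 z) x = 0" "kahler ?p ?q z (X2 z) x = 0"
      "Im (z$0 * x$0 + z$1 * x$1) = 0" if x: "x \<in> ?T" for x
    proof -
      show "cdot z x = 0" by (rule tangent_space_Q[OF x LQ])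
      show "kahler ?p ?q z (X1 z) x = 0" by (rule tangent_space_level[OF x Ldom mu(1) loc(1)])
      show "kahler ?p ?q z (X2 z) x = 0" by (rule tangent_space_level[OF x Ldom mu(2) loc(2)])
      show "Im (z$0 * x$0 + z$1 * x$1) = 0"
        using tangent_space_level[OF x Ldom m3_has_derivative loc(3)] by simp
    qed
    note add = tangent_space_add[OF assms(2) z]
    have "kahler ?p ?q z v w = 0 \<and> Im (Omega_St z u v w) = 0"
    proof (cases "n1 z > 0")
      case False
      then have z0: "z$0 = 0" "z$1 = 0" by (auto simp: n1_def sum_power2_gt_zero_iff)
      \<comment> \<open>The constants are read off at \<open>z\<close>, so \<open>m1\<close> and
        \<open>m3\<close> vanish on all of \<open>L\<close>; the second-order argument needs this
        along whole curves.\<close>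
      then have c: "c1 = 0" "c3 = 0" using loc[OF z] by (auto simp: m1_def m3_def)
      have s: "Im (x$0 * cnj (x$1)) = 0" "Im ((x$0)\<^sup>2 + (x$1)\<^sup>2) = 0" if "x \<in> L" for x
        using m_zero[OF c(1) that] loc(3)[OF that] c(2) by (simp_all only: m1_def m3_def)
      have sec: "Im (x$0 * cnj (x$1)) = 0" "Im ((x$0)\<^sup>2 + (x$1)\<^sup>2) = 0" if "x \<in> ?T" for x
        using tangent_second_order[OF that z0 s] by blast+
      show ?thesis
        using circle_orbit_point[OF zQ z0 radial add T(1,3) sec] uvw by blast
    next
      case n1: True
      show ?thesis
      proof (cases "n2 z > 0")
        case False
        then have z0: "z$2 = 0" "z$3 = 0" by (auto simp: n2_def sum_power2_gt_zero_iff)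
        have "(z$0)\<^sup>2 + (z$1)\<^sup>2 = 1" using zQ z0 by (simp add: Q_def)
        then have c: "c2 = 0" "c3 = 0" using loc[OF z] z0 by (auto simp: m2_def m3_def)
        have s: "Im (x$2 * cnj (x$3)) = 0" "Im ((x$2)\<^sup>2 + (x$3)\<^sup>2) = 0" if x: "x \<in> L" for x
        proof -
          show "Im (x$2 * cnj (x$3)) = 0" using m_zero'[OF c(1) x] by (simp only: m2_def)
          \<comment> \<open>The third equation concerns coordinates 0 and 1, but here 2 and 3 vanish
            at \<open>z\<close>; the quadric equation trades one sum of squares for the
            other.\<close>
          have "(x$2)\<^sup>2 + (x$3)\<^sup>2 = 1 - ((x$0)\<^sup>2 + (x$1)\<^sup>2)"
            using x LQ by (auto simp: Q_def algebra_simps)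
          then have "Im ((x$2)\<^sup>2 + (x$3)\<^sup>2) = - m3 x" by (simp add: m3_def)
          then show "Im ((x$2)\<^sup>2 + (x$3)\<^sup>2) = 0" using loc(3)[OF x] c(2) by linarith
        qed
        have sec: "Im (x$2 * cnj (x$3)) = 0" "Im ((x$2)\<^sup>2 + (x$3)\<^sup>2) = 0" if "x \<in> ?T" for x
          using tangent_second_order[OF that z0 s] by blast+
        show ?thesis
          using circle_orbit_point'[OF zQ z0 radial add T(1,2) sec] uvw by blast
      next
        case True
        interpret free_point z ?p ?q
          by unfold_locales (rule zQ pp radial n1 True)+
        have "?T \<subseteq> K" using T by (auto simp only: K_def)
        then show ?thesis using kahler_K Omega_K uvw by blast
      qed
    qed
    then show ?thesis using omega_St_kahler[OF assms(1) zdom p'(1)[OF t]] by simp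
  qed
  show ?thesis
    unfolding special_lagrangian_def using LQ assms(2) main by blast
qed

theorem special_lagrangian_T2_locus:
  assumes "\<kappa> > 0" "special_lagrangian \<kappa> L" "connected L" "torus_invariant L"
  shows "\<exists>c1 c2 c3. L \<subseteq> T2_locus \<kappa> c1 c2 c3"
proof -
  obtain p' where p': "\<And>t. t \<ge> 1 \<Longrightarrow> (stenzel_u' \<kappa> has_real_derivative p' t) (at t within {1..})"
    using stenzel_u'_derivative[OF assms(1)] by blast
  have LQ: "L \<subseteq> Q" and sub: "smooth_submanifold 3 L"
    and om: "\<And>z v w. z \<in> L \<Longrightarrow> v \<in> tangent_space L z \<Longrightarrow> w \<in> tangent_space L z \<Longrightarrow> omega_St \<kappa> z v w = 0"
    and Om: "\<And>z u v w. z \<in> L \<Longrightarrow> u \<in> tangent_space L z \<Longrightarrow> v \<in> tangent_space L z \<Longrightarrow> w \<in> tangent_space L z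
        \<Longrightarrow> Im (Omega_St z u v w) = 0"
    using assms(2) unfolding special_lagrangian_def by blast+
  have Ldom: "L \<subseteq> stenzel_dom" using LQ Q_subset_stenzel_dom by blast
  have t: "(norm z)\<^sup>2 \<ge> 1" if "z \<in> L" for z using that Ldom by (auto simp: stenzel_dom_def)
  have k: "kahler (stenzel_u' \<kappa> ((norm z)\<^sup>2)) (p' ((norm z)\<^sup>2)) z v w = 0"
    if "z \<in> L" "v \<in> tangent_space L z" "w \<in> tangent_space L z" for z v w
  proof -
    have "complex_of_real (- 2 * kahler (stenzel_u' \<kappa> ((norm z)\<^sup>2)) (p' ((norm z)\<^sup>2)) z v w) = 0"
      using om[OF that] omega_St_kahler[OF assms(1) _ p'[OF t[OF that(1)]], of v w] that(1) Ldom by (metis subsetD)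
    then show ?thesis by simp
  qed
  note X = generators_tangent[OF assms(4)]
  note const = constant_on_connected_submanifold[OF sub assms(3) Ldom]
  note mu = mu_has_derivative[OF p'[OF t] stenzel_dom_norm]
  have "\<exists>c. \<forall>z\<in>L. stenzel_u' \<kappa> ((norm z)\<^sup>2) * m1 z = c"
    by (rule const[OF mu(1)]) (auto intro: k X)
  moreover have "\<exists>c. \<forall>z\<in>L. stenzel_u' \<kappa> ((norm z)\<^sup>2) * m2 z = c"
    by (rule const[OF mu(2)]) (auto intro: k X)
  moreover have "\<exists>c. \<forall>z\<in>L. m3 z = c"
  proof (rule const[OF m3_has_derivative])
    fix z w assume z: "z \<in> L" and w: "w \<in> tangent_space L z"
    have "Omega_St z (X1 z) (X2 z) w = z$0 * w$0 + z$1 * w$1"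
      using Omega_St_X1_X2 tangent_space_Q[OF w LQ] z LQ by blast
    then show "2 * Im (z$0 * w$0 + z$1 * w$1) = 0" using Om[OF z X[OF z] w] by simp
  qed
  ultimately show ?thesis using LQ by (fastforce simp: T2_locus_iff)
qed

text \<open>Both sets are submanifolds of dimension 3 and one contains the other.\<close>

lemma openin_T2_locus_free:
  assumes "\<kappa> > 0" "smooth_submanifold 3 L" "L \<subseteq> T2_locus \<kappa> c1 c2 c3"
  shows "openin (top_of_set (T2_locus \<kappa> c1 c2 c3 \<inter> Q_free)) (L \<inter> Q_free)"
proof (rule openin_smooth_submanifold[OF T2_locus_Q_free_submanifold[OF assms(1)]])
  have "open {z. n1 z > 0}" "open {z. n2 z > 0}"
    unfolding n1_def n2_def by (intro open_Collect_less continuous_intros)+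
  then have "smooth_submanifold 3 (L \<inter> ({z. n1 z > 0} \<inter> {z. n2 z > 0}))"
    by (intro smooth_submanifold_Int_open[OF assms(2)] open_Int)
  moreover have "L \<inter> Q_free = L \<inter> ({z. n1 z > 0} \<inter> {z. n2 z > 0})"
    using assms(3) by (auto simp: Q_free_iff T2_locus_iff)
  ultimately show "smooth_submanifold 3 (L \<inter> Q_free)" by simp
  show "L \<inter> Q_free \<subseteq> T2_locus \<kappa> c1 c2 c3 \<inter> Q_free" using assms(3) by blast
qed

text \<open>The locus is claimed to be a submanifold only over \<open>Q_free\<close>, where the
  differentials are independent. Connectedness of \<open>L\<close> turns local constancy of the
  three functions into single constants. The last clause strengthens containment: near each of its
  free points \<open>L\<close> is the whole locus.\<close>

theorem theorem6p1:
  fixes \<kappa> :: real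
  assumes "\<kappa> > 0"
  shows
    "(\<forall>c1 c2 c3. torus_invariant (T2_locus \<kappa> c1 c2 c3) \<and>
        special_lagrangian \<kappa> (T2_locus \<kappa> c1 c2 c3 \<inter> Q_free)) \<and>
     (\<forall>L. L \<subseteq> Q \<and> smooth_submanifold 3 L \<and> connected L \<and> torus_invariant L \<longrightarrow>
        (special_lagrangian \<kappa> L \<longleftrightarrow> (\<exists>c1 c2 c3. L \<subseteq> T2_locus \<kappa> c1 c2 c3)) \<and>
        (\<forall>c1 c2 c3. L \<subseteq> T2_locus \<kappa> c1 c2 c3 \<longrightarrow>
           openin (top_of_set (T2_locus \<kappa> c1 c2 c3 \<inter> Q_free)) (L \<inter> Q_free)))"
proof (intro conjI allI impI)
  fix c1 c2 c3
  show "torus_invariant (T2_locus \<kappa> c1 c2 c3)" by (rule T2_locus_torus_invariant)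
  show "special_lagrangian \<kappa> (T2_locus \<kappa> c1 c2 c3 \<inter> Q_free)"
    by (rule T2_locus_special_lagrangian[OF assms T2_locus_Q_free_submanifold[OF assms] Int_lower1])
next
  fix L assume L: "L \<subseteq> Q \<and> smooth_submanifold 3 L \<and> connected L \<and> torus_invariant L"
  then show "special_lagrangian \<kappa> L \<longleftrightarrow> (\<exists>c1 c2 c3. L \<subseteq> T2_locus \<kappa> c1 c2 c3)"
    using special_lagrangian_T2_locus[OF assms] T2_locus_special_lagrangian[OF assms] by blast
next
  fix L c1 c2 c3
  assume "L \<subseteq> Q \<and> smooth_submanifold 3 L \<and> connected L \<and> torus_invariant L" "L \<subseteq> T2_locus \<kappa> c1 c2 c3"
  then show "openin (top_of_set (T2_locus \<kappa> c1 c2 c3 \<inter> Q_free)) (L \<inter> Q_free)"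
    using openin_T2_locus_free[OF assms] by blast
qed

end
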